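(* Let $n\ge1$ and let $L$ be the sub-Laplacian on $\mathbb{S}^{4n+3}$ associated to the quaternionic Hopf fibration. For all $r\in[0,\pi/2)$, $\eta\in[0,\pi]$ with $(r,\eta)\neq(0,0)$, the Green function $G$ (with pole at the north pole) of the conformal sub-Laplacian $-L+4n(n+1)$, i.e. $G(r,\eta)=\int_0^{+\infty}e^{-4n(n+1)t}p_t(r,\eta)\,dt$, is given by $$G(r,\eta)=\frac{\Gamma(n)\Gamma(n+1)}{8\pi^{2n+2}\,(1-2\cos r\cos\eta+\cos^2 r)^{n+1}}.$$
   Context: $\mathbb{S}^{4n+3}=\{q\in\mathbb{H}^{n+1}:\|q\|=1\}$ ($\mathbb{H}$ the quaternions) with its round metric and Laplace–Beltrami operator $\Delta$. The unit quaternions $\mathbf{SU}(2)$ act isometrically by $g\cdot(q_1,\dots,q_{n+1})=(gq_1,\dots,gq_{n+1})$ with quotient $\mathbb{HP}^n$. The sub-Laplacian $L$ is the lift of the Laplace–Beltrami operator of $\mathbb{HP}^n$, i.e. $L=\Delta-T_1^2-T_2^2-T_3^2$ with $T_1,T_2,T_3$ the unit-length generators $f\mapsto\frac{d}{d\theta}|_{\theta=0}f(e^{S\theta}q)$, $S=I,J,K$. $p_t$ is the kernel of $e^{tL}$ from the north pole $(0,\dots,0,1)$ with respect to the Riemannian volume; it depends only on $(r,\eta)\in[0,\pi/2)\times[0,\pi]$ defined by $|q_{n+1}|=\cos r$, $\mathrm{Re}(q_{n+1})=\cos r\cos\eta$. *)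

theory Defs
  imports "HOL-Analysis.Analysis"
begin

section \<open>Calculus on the unit sphere of a Euclidean space\<close>

text \<open>
  Functions on the unit sphere are represented by functions on the ambient Euclidean space of which
  only the values on \<open>sphere 0 1\<close> are used. The derivative at a point \<open>x\<close> of the sphere in the
  direction of the ambient vector \<open>v\<close> is taken along the curve \<open>s \<mapsto> (x + s v) / |x + s v|\<close> on the
  sphere, whose velocity at \<open>s = 0\<close> is the orthogonal projection of \<open>v\<close> to the tangent space at \<open>x\<close>
  (recall that \<open>sgn y\<close> is \<open>y\<close> divided by its norm).
\<close>

definition sphere_deriv ::
    "('a::euclidean_space \<Rightarrow> 'b::real_normed_vector) \<Rightarrow> 'a \<Rightarrow> 'a \<Rightarrow> 'b"
  where "sphere_deriv f x v = vector_derivative (\<lambda>s. f (sgn (x + s *\<^sub>R v))) (at 0)"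

definition sphere_grad :: "('a::euclidean_space \<Rightarrow> real) \<Rightarrow> 'a \<Rightarrow> 'a"
  where "sphere_grad f x = (\<Sum>b\<in>Basis. sphere_deriv f x b *\<^sub>R b)"

text \<open>
  The Levi-Civita connection of the round metric is the tangential part of the ambient derivative.
  The divergence of a tangent field, the trace of its covariant derivative, is therefore the trace
  of \<open>sphere_deriv\<close>. This trace may be taken over the ambient basis, because \<open>sphere_deriv X x x = 0\<close>.
\<close>

definition sphere_div :: "('a::euclidean_space \<Rightarrow> 'a) \<Rightarrow> 'a \<Rightarrow> real"
  where "sphere_div X x = (\<Sum>b\<in>Basis. sphere_deriv X x b \<bullet> b)"

definition laplace_beltrami :: "('a::euclidean_space \<Rightarrow> real) \<Rightarrow> 'a \<Rightarrow> real"
  where "laplace_beltrami f = sphere_div (sphere_grad f)"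

text \<open>
  \<open>C_k_on k S f\<close> is only meant for open \<open>S\<close>, where the Frechet derivative is unique.
\<close>

primrec C_k_on :: "nat \<Rightarrow> 'a::euclidean_space set \<Rightarrow> ('a \<Rightarrow> real) \<Rightarrow> bool" where
  "C_k_on 0 S f \<longleftrightarrow> continuous_on S f"
| "C_k_on (Suc k) S f \<longleftrightarrow>
     f differentiable_on S \<and> (\<forall>v. C_k_on k S (\<lambda>x. frechet_derivative f (at x) v))"

definition smooth_on_sphere :: "('a::euclidean_space \<Rightarrow> real) \<Rightarrow> bool"
  where "smooth_on_sphere f \<longleftrightarrow> (\<forall>k. C_k_on k (- {0}) (\<lambda>x. f (sgn x)))"

text \<open>
  The Riemannian volume of the round sphere: in polar coordinates Lebesgue measure is
  \<open>\<rho> ^ (N - 1) d\<rho> d\<sigma>\<close> with \<open>N\<close> the ambient dimension, so that the image of Lebesgue measure on the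
  unit ball under \<open>x \<mapsto> x / |x|\<close> is \<open>\<sigma> / N\<close>.
\<close>

definition sphere_volume :: "'a::euclidean_space measure"
  where "sphere_volume =
    scale_measure (of_nat DIM('a)) (distr (restrict_space lborel (ball 0 1)) borel sgn)"


section \<open>Quaternions and the quaternionic Hopf fibration\<close>

text \<open>
  The quaternion \<open>a + b J\<close> with complex \<open>a\<close> and \<open>b\<close> is represented by the pair \<open>(a, b)\<close>, where
  \<open>J z = cnj z J\<close>. The norm and the inner product of the product type are those of the quaternions.
\<close>

type_synonym quat = "complex \<times> complex"

definition qmult :: "quat \<Rightarrow> quat \<Rightarrow> quat"
  where "qmult p q =
    (fst p * fst q - snd p * cnj (snd q), fst p * snd q + snd p * cnj (fst q))"

definition q_one :: quat where "q_one = (1, 0)"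
definition q_I :: quat where "q_I = (\<i>, 0)"
definition q_J :: quat where "q_J = (0, 1)"
definition q_K :: quat where "q_K = (0, \<i>)"

definition qRe :: "quat \<Rightarrow> real" where "qRe q = Re (fst q)"

definition qexp :: "quat \<Rightarrow> quat"
  where "qexp q = (\<Sum>k. (qmult q ^^ k) q_one /\<^sub>R fact k)"

lemma quaternion_relations:
  "qmult q_I q_I = - q_one" "qmult q_J q_J = - q_one" "qmult q_K q_K = - q_one"
  "qmult q_I q_J = q_K" "qmult q_J q_K = q_I" "qmult q_K q_I = q_J"
  by (simp_all add: qmult_def q_one_def q_I_def q_J_def q_K_def)

lemma norm_qmult: "norm (qmult p q) = norm p * norm q"
proof -
  have "(norm (qmult p q))\<^sup>2 = (norm p * norm q)\<^sup>2"
    by (simp add: norm_prod_def qmult_def cmod_power2 power_mult_distrib)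
       (simp add: power2_eq_square algebra_simps)
  then show ?thesis by (simp add: power2_eq_iff_nonneg)
qed

lemma qexp_imaginary_unit:
  assumes "qmult S S = - q_one"
  shows "qexp (\<theta> *\<^sub>R S) = cos \<theta> *\<^sub>R q_one + sin \<theta> *\<^sub>R S"
proof -
  have lin: "qmult (c *\<^sub>R S) (a *\<^sub>R q_one + b *\<^sub>R S) = (c * a) *\<^sub>R S - (c * b) *\<^sub>R q_one" for a b c
  proof -
    have "qmult (c *\<^sub>R S) (a *\<^sub>R q_one + b *\<^sub>R S) = (c * a) *\<^sub>R S + (c * b) *\<^sub>R qmult S S"
      by (simp add: qmult_def q_one_def prod_eq_iff scaleR_conv_of_real algebra_simps)
    then show ?thesis using assms by simp
  qed
  have pow: "(qmult (\<theta> *\<^sub>R S) ^^ k) q_one =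
      (fact k * cos_coeff k * \<theta> ^ k) *\<^sub>R q_one + (fact k * sin_coeff k * \<theta> ^ k) *\<^sub>R S" for k
  proof (induction k)
    case (Suc k)
    show ?case
      unfolding funpow.simps comp_def Suc lin
      by (simp add: cos_coeff_Suc sin_coeff_Suc algebra_simps del: of_nat_Suc)
  qed simp
  have "(\<lambda>k. (cos_coeff k *\<^sub>R \<theta> ^ k) *\<^sub>R q_one + (sin_coeff k *\<^sub>R \<theta> ^ k) *\<^sub>R S) sums
      (cos \<theta> *\<^sub>R q_one + sin \<theta> *\<^sub>R S)"
    by (intro sums_add sums_scaleR_left cos_converges sin_converges)
  moreover have "(qmult (\<theta> *\<^sub>R S) ^^ k) q_one /\<^sub>R fact k =
      (cos_coeff k *\<^sub>R \<theta> ^ k) *\<^sub>R q_one + (sin_coeff k *\<^sub>R \<theta> ^ k) *\<^sub>R S" for k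
    unfolding pow by (simp add: scaleR_add_right field_simps)
  ultimately show ?thesis
    unfolding qexp_def by (simp add: sums_iff)
qed

text \<open>
  With \<open>n = CARD('n)\<close>, the type \<open>'n qspace\<close> is the space of \<open>(n + 1)\<close>-tuples of quaternions: the
  first component holds \<open>q\<^sub>1, \<dots>, q\<^sub>n\<close> and the second one \<open>q\<^sub>n\<^sub>+\<^sub>1\<close>. The sphere of dimension
  \<open>4 n + 3\<close> is \<open>sphere 0 1\<close> in this space.
\<close>

type_synonym 'n qspace = "(quat ^ 'n) \<times> quat"

definition qact :: "quat \<Rightarrow> 'n::finite qspace \<Rightarrow> 'n qspace"
  where "qact g q = (\<chi> i. qmult g (fst q $ i), qmult g (snd q))"

definition north_pole :: "'n::finite qspace"
  where "north_pole = (0, q_one)"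

definition hopf_field :: "quat \<Rightarrow> ('n::finite qspace \<Rightarrow> real) \<Rightarrow> 'n qspace \<Rightarrow> real"
  where "hopf_field S f q = deriv (\<lambda>\<theta>. f (qact (qexp (\<theta> *\<^sub>R S)) q)) 0"

definition sub_laplacian :: "('n::finite qspace \<Rightarrow> real) \<Rightarrow> 'n qspace \<Rightarrow> real"
  where "sub_laplacian f q =
    laplace_beltrami f q - (\<Sum>S\<in>{q_I, q_J, q_K}. hopf_field S (hopf_field S f) q)"


section \<open>Heat semigroup and heat kernel\<close>

text \<open>
  \<open>heat_semigroup P\<close> says that \<open>P t\<close> is \<open>e ^ (t L)\<close>, with \<open>L\<close> the sub-Laplacian: \<open>P\<close> is a strongly
  continuous contraction semigroup on the continuous functions on the sphere with the supremum norm,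
  and its generator extends \<open>L\<close> on the smooth functions. Since the smooth functions are a core, there
  is exactly one such semigroup.
\<close>

definition heat_semigroup ::
    "(real \<Rightarrow> ('n::finite qspace \<Rightarrow> real) \<Rightarrow> 'n qspace \<Rightarrow> real) \<Rightarrow> bool"
  where "heat_semigroup P \<longleftrightarrow>
    (\<forall>f t. continuous_on (sphere 0 1) f \<longrightarrow> 0 \<le> t \<longrightarrow> continuous_on (sphere 0 1) (P t f)) \<and>
    (\<forall>f g a b t. continuous_on (sphere 0 1) f \<longrightarrow> continuous_on (sphere 0 1) g \<longrightarrow> 0 \<le> t \<longrightarrow>
       (\<forall>x\<in>sphere 0 1. P t (\<lambda>y. a * f y + b * g y) x = a * P t f x + b * P t g x)) \<and>
    (\<forall>f t M. continuous_on (sphere 0 1) f \<longrightarrow> 0 \<le> t \<longrightarrow> (\<forall>x\<in>sphere 0 1. \<bar>f x\<bar> \<le> M) \<longrightarrow>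
       (\<forall>x\<in>sphere 0 1. \<bar>P t f x\<bar> \<le> M)) \<and>
    (\<forall>f. continuous_on (sphere 0 1) f \<longrightarrow> (\<forall>x\<in>sphere 0 1. P 0 f x = f x)) \<and>
    (\<forall>f s t. continuous_on (sphere 0 1) f \<longrightarrow> 0 \<le> s \<longrightarrow> 0 \<le> t \<longrightarrow>
       (\<forall>x\<in>sphere 0 1. P (s + t) f x = P s (P t f) x)) \<and>
    (\<forall>f. continuous_on (sphere 0 1) f \<longrightarrow>
       uniform_limit (sphere 0 1) (\<lambda>t. P t f) f (at_right 0)) \<and>
    (\<forall>f. smooth_on_sphere f \<longrightarrow>
       uniform_limit (sphere 0 1) (\<lambda>t x. (P t f x - f x) / t) (sub_laplacian f) (at_right 0))"

definition heat_kernel :: "(real \<Rightarrow> 'n::finite qspace \<Rightarrow> real) \<Rightarrow> bool"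
  where "heat_kernel p \<longleftrightarrow>
    (\<exists>P. heat_semigroup P \<and>
      (\<forall>t>0. continuous_on (sphere 0 1) (p t) \<and>
        (\<forall>f. continuous_on (sphere 0 1) f \<longrightarrow>
           P t f north_pole = (LINT x:sphere 0 1|sphere_volume. p t x * f x))))"

end

theory Submission
  imports Defs
begin

text \<open>
  Let \<open>\<lambda> = 4 n (n + 1)\<close> and let \<open>\<langle>x, y\<rangle> = \<Sum>\<^sub>i x\<^sub>i cnj y\<^sub>i\<close>. For \<open>s > 1\<close> the function
  \<open>|s - \<langle>x, y\<rangle>| ^ (-2 n - 2)\<close> of \<open>x\<close> is smooth on the sphere, and a direct computation shows that
  \<open>\<lambda> - L\<close> maps it to \<open>\<lambda> (s\<^sup>2 - 1) |s - \<langle>x, y\<rangle>| ^ (-2 n - 4)\<close>. After division by its total mass the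
  latter is an approximate identity at \<open>y\<close> as \<open>s \<rightarrow> 1\<close>. Because \<open>L\<close> is a combination of squares of
  generators of isometries, the total mass satisfies a linear differential equation in \<open>s\<close>, and its
  Wronskian with a polynomial solution yields the limit of the mass.
  Since \<open>P\<close> is a semigroup generated by \<open>L\<close>, integrating \<open>exp (- \<lambda> t) P t\<close> of the approximate
  identity over \<open>t\<close> gives the regularised Green function. Finite combinations of the approximate
  identities are dense, hence \<open>P t\<close> preserves the volume. This bounds the heat kernel uniformly for
  \<open>t \<ge> a > 0\<close>, and dominated convergence allows to let \<open>s \<rightarrow> 1\<close>; monotonicity in \<open>s\<close> and in \<open>a\<close>
  then allows to let \<open>a \<rightarrow> 0\<close>.
\<close>

section \<open>The volume of the sphere\<close>

text \<open>The semigroup is known only through its axioms: \<open>p t\<close> is the density of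
  \<open>P t\<close> at the north pole, and neither its sign, a bound nor a symmetry is given. So
  \<open>q\<close> is never the starting point of the flow: an approximate identity placed at
  \<open>q\<close> is flowed and evaluated at the north pole, and \<open>p t q\<close> is recovered
  as a limit. The main obstacle is the mass bound. \<open>P t f\<close> is only known to be
  continuous, so invariance of the volume cannot come from integrating \<open>L\<close> of
  \<open>P t f\<close> by parts. It is extracted from explicit functions instead: for the
  approximate identity the resolvent is the explicit regularised Green function, whose integral is
  known, and density extends the resulting identity to all continuous functions. The constant of the
  theorem is the limit of a mass as s \<rightarrow> 1, where the kernel degenerates. At s
  \<rightarrow> \<infinity> only the volume of the sphere matters, and a conserved Wronskian carries
  this value back to s = 1. This takes the place of an integration in the coordinates r and
  \<eta>.\<close>

lemma distr_lborel_linear_isometry: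
  fixes T :: "'a::euclidean_space \<Rightarrow> 'a"
  assumes T: "linear T" "\<And>x. norm (T x) = norm x"
  shows "distr lborel borel T = lborel"
proof (rule measure_eqI)
  \<comment> \<open>Both measures are translation invariant, hence proportional, and the unit ball is preserved.\<close>
  have cT: "continuous_on UNIV T"
    using T(1) by (simp add: linear_continuous_on linear_conv_bounded_linear)
  then have mT [measurable]: "T \<in> borel_measurable borel"
    by (rule borel_measurable_continuous_onI)
  have "inj T"
    using T by (metis linear_injective_0 norm_eq_zero)
  then have surj: "surj T"
    using T(1) linear_injective_imp_surjective by blast
  fix A assume "A \<in> sets (distr lborel borel T)"
  then have A [measurable]: "A \<in> sets borel" by simp
  define B where "B = ball (0::'a) 1"
  have B [measurable]: "B \<in> sets borel" by (simp add: B_def)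
  have B_shift: "emeasure lborel {y. x - y \<in> B} = emeasure lborel B" for x
  proof -
    have "{y. x - y \<in> B} = ball x 1" by (auto simp: B_def dist_norm norm_minus_commute)
    then show ?thesis by (simp add: B_def emeasure_ball)
  qed
  have TB: "emeasure lborel {x. T x \<in> B} = emeasure lborel B"
    using T(2) by (simp add: B_def ball_def dist_norm)
  have shift: "(\<integral>\<^sup>+x. f (c + x) \<partial>lborel) = (\<integral>\<^sup>+x. f x \<partial>lborel)"
    if [measurable]: "f \<in> borel_measurable borel" for f :: "'a \<Rightarrow> ennreal" and c
  proof -
    have "(\<integral>\<^sup>+x. f x \<partial>lborel) = (\<integral>\<^sup>+x. f x \<partial>distr lborel borel ((+) c))"
      by (simp add: lborel_distr_plus)
    also have "\<dots> = (\<integral>\<^sup>+x. f (c + x) \<partial>lborel)"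
      by (rule nn_integral_distr) auto
    finally show ?thesis by simp
  qed
  have nn_ind: "(\<integral>\<^sup>+x. c * indicator S (h x) \<partial>lborel) = c * emeasure lborel {x. h x \<in> S}"
    if [measurable]: "S \<in> sets borel" "h \<in> borel_measurable borel" for c and S :: "'a set" and h :: "'a \<Rightarrow> 'a"
  proof -
    have "(\<integral>\<^sup>+x. c * indicator S (h x) \<partial>lborel) = (\<integral>\<^sup>+x. c * indicator {x. h x \<in> S} x \<partial>lborel)"
      by (intro nn_integral_cong) (auto simp: indicator_def)
    also have "\<dots> = c * emeasure lborel {x. h x \<in> S}"
      by (rule nn_integral_cmult_indicator) simp
    finally show ?thesis .
  qed
  \<comment> \<open>The double integral of the indicators of \<open>T x \<in> A\<close> and
    \<open>T x - y \<in> B\<close> is computed twice. Substituting \<open>c + x\<close> for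
    \<open>x\<close>, where \<open>T c = y\<close>, moves the translation from \<open>B\<close> to
    \<open>A\<close>; integrating over \<open>y\<close> first then exchanges the roles of the two
    sets.\<close>
  have "emeasure lborel {x. T x \<in> A} * emeasure lborel B
      = (\<integral>\<^sup>+x. (\<integral>\<^sup>+y. indicator A (T x) * indicator B (T x - y) \<partial>lborel) \<partial>lborel)"
    using nn_ind[of A T "emeasure lborel B"] by (simp add: nn_ind B_shift mult.commute)
  also have "\<dots> = (\<integral>\<^sup>+y. (\<integral>\<^sup>+x. indicator A (T x) * indicator B (T x - y) \<partial>lborel) \<partial>lborel)"
    by (rule lborel_pair.Fubini') measurable
  also have "\<dots> = (\<integral>\<^sup>+y. (\<integral>\<^sup>+x. indicator A (T x + y) * indicator B (T x) \<partial>lborel) \<partial>lborel)"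
  proof (rule nn_integral_cong)
    fix y :: 'a
    obtain c where c: "T c = y" using surj by (metis surjD)
    have "T (c + x) = T x + y" for x using c T(1) by (simp add: linear_add)
    then show "(\<integral>\<^sup>+x. indicator A (T x) * indicator B (T x - y) \<partial>lborel)
        = (\<integral>\<^sup>+x. indicator A (T x + y) * indicator B (T x) \<partial>lborel)"
      using shift[of "\<lambda>x. indicator A (T x) * indicator B (T x - y)" c] by simp
  qed
  also have "\<dots> = (\<integral>\<^sup>+x. (\<integral>\<^sup>+y. indicator A (T x + y) * indicator B (T x) \<partial>lborel) \<partial>lborel)"
    by (rule lborel_pair.Fubini') measurable
  also have "\<dots> = (\<integral>\<^sup>+x. emeasure lborel A * indicator B (T x) \<partial>lborel)"
  proof (rule nn_integral_cong)
    fix x :: 'a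
    have "(\<integral>\<^sup>+y. indicator A (T x + y) * indicator B (T x) \<partial>lborel)
        = (\<integral>\<^sup>+y. indicator A y * indicator B (T x) \<partial>lborel)"
      using shift[of "\<lambda>y. indicator A y * indicator B (T x)" "T x"] by simp
    also have "\<dots> = emeasure lborel A * indicator B (T x)"
      using nn_ind[of A "\<lambda>y. y" "indicator B (T x)"] by (simp add: mult.commute)
    finally show "(\<integral>\<^sup>+y. indicator A (T x + y) * indicator B (T x) \<partial>lborel)
        = emeasure lborel A * indicator B (T x)" .
  qed
  also have "\<dots> = emeasure lborel A * emeasure lborel B"
    by (simp add: nn_ind TB)
  finally have "emeasure lborel B * emeasure lborel {x. T x \<in> A} = emeasure lborel B * emeasure lborel A"
    by (simp add: mult.commute)
  moreover have "emeasure lborel B \<noteq> 0" "emeasure lborel B \<noteq> top"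
    by (simp_all add: B_def emeasure_ball ennreal_eq_0_iff not_le)
  ultimately have "emeasure lborel {x. T x \<in> A} = emeasure lborel A"
    by (simp add: ennreal_mult_cancel_left)
  then show "emeasure (distr lborel borel T) A = emeasure lborel A"
    by (simp add: emeasure_distr vimage_def)
qed simp

text \<open>The sphere itself is made the space of the measure: functions are controlled there only,
  so measurability and bounds can be asked for only there.\<close>

definition sphere_measure :: "'a::euclidean_space measure"
  where "sphere_measure = restrict_space sphere_volume (sphere 0 1)"

lemma sets_sphere_volume [simp, measurable_cong]: "sets sphere_volume = sets borel"
  by (simp add: sphere_volume_def)

lemma space_sphere_volume [simp]: "space sphere_volume = UNIV"
  by (simp add: sphere_volume_def space_scale_measure)

lemma space_sphere_measure [simp]: "space sphere_measure = sphere 0 1"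
  by (simp add: sphere_measure_def space_restrict_space)

lemma sgn_measurable [measurable]: "(sgn :: 'a::euclidean_space \<Rightarrow> 'a) \<in> borel_measurable borel"
  unfolding sgn_div_norm by measurable

lemma emeasure_sphere_volume:
  fixes A :: "'a::euclidean_space set"
  assumes [measurable]: "A \<in> sets borel"
  shows "emeasure sphere_volume A = of_nat DIM('a) * emeasure lborel (sgn -` A \<inter> ball 0 1)"
proof -
  have [measurable]: "sgn \<in> restrict_space lborel (ball (0::'a) 1) \<rightarrow>\<^sub>M borel"
    by (intro measurable_restrict_space1) simp
  have "sgn -` A \<in> sets (borel :: 'a measure)"
    using measurable_sets[OF sgn_measurable assms] by simp
  then have [measurable]: "sgn -` A \<inter> ball 0 1 \<in> sets (borel :: 'a measure)"
    by (rule sets.Int) simp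
  show ?thesis
    unfolding sphere_volume_def
    by (simp add: emeasure_distr emeasure_restrict_space space_restrict_space)
qed

lemma distr_sphere_volume_linear_isometry:
  fixes T :: "'a::euclidean_space \<Rightarrow> 'a"
  assumes T: "linear T" "\<And>x. norm (T x) = norm x"
  shows "distr sphere_volume borel T = sphere_volume"
proof (rule measure_eqI)
  have cT: "continuous_on UNIV T"
    using T(1) by (simp add: linear_continuous_on linear_conv_bounded_linear)
  then have mT [measurable]: "T \<in> borel_measurable borel"
    by (rule borel_measurable_continuous_onI)
  fix A assume "A \<in> sets (distr sphere_volume borel T)"
  then have A [measurable]: "A \<in> sets borel" by simp
  have TA: "T -` A \<in> sets borel"
    using measurable_sets[OF mT A] by simp
  have sA: "sgn -` A \<inter> ball 0 1 \<in> sets (borel :: 'a measure)"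
    using measurable_sets[OF sgn_measurable A] by (intro sets.Int) auto
  have eq: "sgn -` (T -` A) \<inter> ball 0 1 = T -` (sgn -` A \<inter> ball 0 1)"
    using T by (auto simp: sgn_div_norm linear_cmul)
  have "emeasure lborel (T -` (sgn -` A \<inter> ball 0 1)) = emeasure (distr lborel borel T) (sgn -` A \<inter> ball 0 1)"
    using sA by (simp add: emeasure_distr)
  also have "\<dots> = emeasure lborel (sgn -` A \<inter> ball 0 1)"
    using distr_lborel_linear_isometry[OF T] by simp
  finally show "emeasure (distr sphere_volume borel T) A = emeasure sphere_volume A"
    using A TA by (simp add: emeasure_distr emeasure_sphere_volume eq)
qed simp

lemma emeasure_sphere_measure:
  "emeasure (sphere_measure :: 'a::euclidean_space measure) (sphere 0 1)
    = ennreal (real DIM('a) * unit_ball_vol (real DIM('a)))"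
proof -
  have "emeasure (sphere_measure :: 'a measure) (sphere 0 1) = emeasure sphere_volume (sphere 0 1 :: 'a set)"
    by (simp add: sphere_measure_def emeasure_restrict_space)
  also have "\<dots> = of_nat DIM('a) * emeasure lborel (sgn -` sphere 0 1 \<inter> ball 0 1 :: 'a set)"
    by (intro emeasure_sphere_volume) simp
  \<comment> \<open>Since \<open>sgn 0 = 0\<close> is off the sphere, the preimage misses exactly
    the origin, a null set.\<close>
  also have "(sgn -` sphere 0 1 \<inter> ball 0 1 :: 'a set) = ball 0 1 - {0}"
    by (auto simp: norm_sgn)
  also have "emeasure lborel (ball 0 1 - {0} :: 'a set) = emeasure lborel (ball 0 1 :: 'a set)"
    by (subst emeasure_Diff) auto
  finally show ?thesis by (simp add: emeasure_ball ennreal_mult ennreal_of_nat_eq_real_of_nat)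
qed

interpretation sphere_measure: finite_measure "sphere_measure :: 'a::euclidean_space measure"
  by standard (simp add: emeasure_sphere_measure)

lemma measure_sphere_measure:
  "measure (sphere_measure :: 'a::euclidean_space measure) (sphere 0 1) = real DIM('a) * unit_ball_vol (real DIM('a))"
  by (simp add: measure_def emeasure_sphere_measure)

lemma borel_measurable_sphere_measure:
  fixes f :: "'a::euclidean_space \<Rightarrow> real"
  assumes "continuous_on (sphere 0 1) f"
  shows "f \<in> borel_measurable sphere_measure"
proof -
  have "f \<in> borel_measurable (restrict_space borel (sphere 0 1))"
    using assms by (rule borel_measurable_continuous_on_restrict)
  then show ?thesis
    unfolding sphere_measure_def
    by (simp cong: measurable_cong_sets add: sets_restrict_space_cong[OF sets_sphere_volume])
qed

lemma integrable_sphere_measure: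
  fixes f :: "'a::euclidean_space \<Rightarrow> real"
  assumes "continuous_on (sphere 0 1) f"
  shows "integrable sphere_measure f"
proof -
  have "bounded (f ` sphere 0 1)"
    by (intro compact_imp_bounded compact_continuous_image assms) simp
  then obtain B where "\<And>x. x \<in> sphere 0 1 \<Longrightarrow> norm (f x) \<le> B"
    unfolding bounded_iff by blast
  then show ?thesis
    by (intro sphere_measure.integrable_const_bound[where B = B])
       (auto intro!: borel_measurable_sphere_measure assms)
qed

lemma set_integral_sphere_volume:
  fixes f :: "'a::euclidean_space \<Rightarrow> real"
  shows "(LINT x:sphere 0 1|sphere_volume. f x) = integral\<^sup>L sphere_measure f"
  by (simp add: set_lebesgue_integral_def sphere_measure_def integral_restrict_space)

lemma integral_sphere_measure_isometry:
  fixes T :: "'a::euclidean_space \<Rightarrow> 'a" and f :: "'a \<Rightarrow> real"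
  assumes T: "linear T" "\<And>x. norm (T x) = norm x" and f: "continuous_on (sphere 0 1) f"
  shows "(\<integral>x. f (T x) \<partial>sphere_measure) = integral\<^sup>L sphere_measure f"
proof -
  have cT: "continuous_on UNIV T"
    using T(1) by (simp add: linear_continuous_on linear_conv_bounded_linear)
  then have mT [measurable]: "T \<in> borel_measurable borel"
    by (rule borel_measurable_continuous_onI)
  have mf: "(\<lambda>x. indicat_real (sphere 0 1) x *\<^sub>R f x) \<in> borel_measurable borel"
    using borel_measurable_continuous_on_indicator[OF _ f] by simp
  have "(\<integral>x. f (T x) \<partial>sphere_measure) = (\<integral>x. indicator (sphere 0 1) (T x) *\<^sub>R f (T x) \<partial>sphere_volume)"
    unfolding sphere_measure_def by (subst integral_restrict_space) (auto simp: T(2) indicator_def intro!: Bochner_Integration.integral_cong)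
  also have "\<dots> = (\<integral>x. indicator (sphere 0 1) x *\<^sub>R f x \<partial>distr sphere_volume borel T)"
    by (rule integral_distr[symmetric]) (use mf in auto)
  also have "\<dots> = integral\<^sup>L sphere_measure f"
    unfolding distr_sphere_volume_linear_isometry[OF T] sphere_measure_def
    by (subst integral_restrict_space) auto
  finally show ?thesis .
qed

lemma integral_sphere_measure_mono:
  fixes f g :: "'a::euclidean_space \<Rightarrow> real"
  assumes "continuous_on (sphere 0 1) f" "continuous_on (sphere 0 1) g"
    and "\<And>x. x \<in> sphere 0 1 \<Longrightarrow> f x \<le> g x"
  shows "integral\<^sup>L sphere_measure f \<le> integral\<^sup>L sphere_measure g"
  using assms by (intro integral_mono integrable_sphere_measure) auto

text \<open>By the mean value theorem the bound on \<open>h'\<close> also bounds the difference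
  quotients, and on a finite measure space a constant is an integrable majorant.\<close>

lemma has_real_derivative_integral:
  fixes h :: "real \<Rightarrow> 'a \<Rightarrow> real"
  assumes "finite_measure M" and "open T" "t\<^sub>0 \<in> T" "convex T"
    and int: "\<And>t. t \<in> T \<Longrightarrow> integrable M (h t)"
    and der: "\<And>t x. t \<in> T \<Longrightarrow> x \<in> space M \<Longrightarrow> ((\<lambda>t. h t x) has_real_derivative h' t x) (at t)"
    and bd: "\<And>t x. t \<in> T \<Longrightarrow> x \<in> space M \<Longrightarrow> \<bar>h' t x\<bar> \<le> C"
  shows "((\<lambda>t. integral\<^sup>L M (h t)) has_real_derivative integral\<^sup>L M (h' t\<^sub>0)) (at t\<^sub>0)"
proof -
  interpret finite_measure M by fact
  have lip: "\<bar>(h t x - h t\<^sub>0 x) / (t - t\<^sub>0)\<bar> \<le> C" if t: "t \<in> T" "t \<noteq> t\<^sub>0" and x: "x \<in> space M" for t x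
  proof -
    have "norm (h t x - h t\<^sub>0 x) \<le> C * norm (t - t\<^sub>0)"
    proof (rule field_differentiable_bound[where S = T and f' = "\<lambda>t. h' t x"])
      show "((\<lambda>t. h t x) has_field_derivative h' z x) (at z within T)" if "z \<in> T" for z
        using der[OF that x] by (rule has_field_derivative_at_within)
    qed (use assms t x in auto)
    then show ?thesis using t by (simp add: field_simps)
  qed
  have "((\<lambda>t. (integral\<^sup>L M (h t) - integral\<^sup>L M (h t\<^sub>0)) / (t - t\<^sub>0)) \<longlongrightarrow> integral\<^sup>L M (h' t\<^sub>0)) (at t\<^sub>0 within T)"
    unfolding tendsto_at_iff_sequentially
  proof (intro allI impI)
    fix X assume X: "\<forall>i. X i \<in> T - {t\<^sub>0}" "X \<longlonglongrightarrow> t\<^sub>0"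
    have *: "(\<lambda>i. (h (X i) x - h t\<^sub>0 x) / (X i - t\<^sub>0)) \<longlonglongrightarrow> h' t\<^sub>0 x" if "x \<in> space M" for x
    proof -
      have "((\<lambda>t. (h t x - h t\<^sub>0 x) / (t - t\<^sub>0)) \<longlongrightarrow> h' t\<^sub>0 x) (at t\<^sub>0)"
        using der[OF \<open>t\<^sub>0 \<in> T\<close> that] by (simp add: has_field_derivative_iff)
      then show ?thesis
        using X by (auto simp: tendsto_at_iff_sequentially o_def)
    qed
    have meas: "(\<lambda>x. (h (X i) x - h t\<^sub>0 x) / (X i - t\<^sub>0)) \<in> borel_measurable M" for i
      using int X \<open>t\<^sub>0 \<in> T\<close> by (intro borel_measurable_divide borel_measurable_diff) auto
    have lim: "(\<lambda>i. \<integral>x. (h (X i) x - h t\<^sub>0 x) / (X i - t\<^sub>0) \<partial>M) \<longlonglongrightarrow> integral\<^sup>L M (h' t\<^sub>0)"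
    proof (rule integral_dominated_convergence[where w = "\<lambda>_. C"])
      show "h' t\<^sub>0 \<in> borel_measurable M"
        using * meas by (rule borel_measurable_LIMSEQ_metric[rotated])
      show "AE x in M. norm ((h (X i) x - h t\<^sub>0 x) / (X i - t\<^sub>0)) \<le> C" for i
        using X lip by (intro AE_I2) auto
    qed (use * meas in auto)
    have eq: "(\<integral>x. (h (X i) x - h t\<^sub>0 x) / (X i - t\<^sub>0) \<partial>M)
        = (integral\<^sup>L M (h (X i)) - integral\<^sup>L M (h t\<^sub>0)) / (X i - t\<^sub>0)" for i
      using int X \<open>t\<^sub>0 \<in> T\<close> by (simp add: Bochner_Integration.integral_diff)
    from lim[unfolded eq] show "((\<lambda>t. (integral\<^sup>L M (h t) - integral\<^sup>L M (h t\<^sub>0)) / (t - t\<^sub>0)) \<circ> X) \<longlonglongrightarrow> integral\<^sup>L M (h' t\<^sub>0)"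
      unfolding o_def .
  qed
  then show ?thesis
    by (simp add: has_field_derivative_iff at_within_open[OF \<open>t\<^sub>0 \<in> T\<close> \<open>open T\<close>])
qed

section \<open>Integrals of second derivatives along rotations\<close>

text \<open>A skew map generates isometries, which preserve the volume; so the integral of
  \<open>u\<close> along the flow is constant and its derivative at time 0 vanishes. The relation
  \<open>Y3\<close>, satisfied by coordinate rotations and by the Hopf fields, gives the exponential
  a closed form (Rodrigues).\<close>

lemma integral_skew_derivative:
  fixes Y :: "'a::euclidean_space \<Rightarrow> 'a" and u :: "'a \<Rightarrow> real"
  assumes Y: "linear Y" and skew: "\<And>x y. Y x \<bullet> y = - (x \<bullet> Y y)"
    and Y3: "\<And>x. Y (Y (Y x)) = - Y x"
    and u: "\<And>x. x \<in> sphere 0 1 \<Longrightarrow> (u has_derivative u' x) (at x)"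
    and cont: "continuous_on (sphere 0 1) (\<lambda>x. u' x (Y x))"
  shows "(\<integral>x. u' x (Y x) \<partial>sphere_measure) = 0"
proof -
  \<comment> \<open>\<open>R \<theta>\<close> is the exponential of \<open>\<theta> Y\<close>.\<close>
  define R where "R \<theta> x = x + sin \<theta> *\<^sub>R Y x + (1 - cos \<theta>) *\<^sub>R Y (Y x)" for \<theta> x
  have linR: "linear (R \<theta>)" for \<theta>
    unfolding R_def using Y
    by (intro linearI) (simp_all add: linear_add linear_cmul algebra_simps)
  have cR: "continuous_on S (R \<theta>)" for \<theta> S
    using linR by (simp add: linear_continuous_on linear_conv_bounded_linear)
  have normR: "norm (R \<theta> x) = norm x" for \<theta> x
  proof -
    have 0: "x \<bullet> Y x = 0" "Y x \<bullet> Y (Y x) = 0"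
      using skew[of x x] skew[of "Y x" "Y x"] by (simp_all add: inner_commute)
    have 1: "x \<bullet> Y (Y x) = - (Y x \<bullet> Y x)" "Y (Y x) \<bullet> Y (Y x) = Y x \<bullet> Y x"
      using skew[of x "Y x"] skew[of "Y x" "Y (Y x)"] by (simp_all add: Y3)
    have 2: "cos \<theta> * (cos \<theta> * k) + sin \<theta> * (sin \<theta> * k) = k" for k
      by (simp flip: mult.assoc distrib_right)
    have "R \<theta> x \<bullet> R \<theta> x = x \<bullet> x + ((sin \<theta>)\<^sup>2 + (1 - cos \<theta>)\<^sup>2 - 2 * (1 - cos \<theta>)) * (Y x \<bullet> Y x)"
      using 0 1 unfolding R_def
      by (simp add: 2 inner_add_left inner_add_right inner_commute[of "Y x" x]
          inner_commute[of "Y (Y x)" "Y x"] inner_commute[of "Y (Y x)" x] power2_eq_square algebra_simps)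
    also have "(sin \<theta>)\<^sup>2 + (1 - cos \<theta>)\<^sup>2 - 2 * (1 - cos \<theta>) = 0"
      by (simp add: power2_diff sin_squared_eq)
    finally show ?thesis by (simp add: norm_eq_sqrt_inner)
  qed
  have R_sphere: "R \<theta> x \<in> sphere 0 1" if "x \<in> sphere 0 1" for \<theta> x
    using that normR by simp
  have dR: "((\<lambda>\<theta>. R \<theta> x) has_vector_derivative Y (R \<theta> x)) (at \<theta>)" for \<theta> x
  proof -
    have "Y (R \<theta> x) = cos \<theta> *\<^sub>R Y x + sin \<theta> *\<^sub>R Y (Y x)"
      unfolding R_def using Y by (simp add: linear_add linear_cmul Y3) (simp add: algebra_simps)
    then show ?thesis unfolding R_def
      by (auto intro!: derivative_eq_intros)
  qed
  define w where "w x = u' x (Y x)" for x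
  have du: "((\<lambda>\<theta>. u (R \<theta> x)) has_real_derivative w (R \<theta> x)) (at \<theta>)" if "x \<in> sphere 0 1" for x \<theta>
  proof -
    have "((\<lambda>\<theta>. u (R \<theta> x)) has_derivative (\<lambda>h. u' (R \<theta> x) (h *\<^sub>R Y (R \<theta> x)))) (at \<theta>)"
      using has_derivative_compose[OF dR[unfolded has_vector_derivative_def] u[OF R_sphere[OF that]]]
      by simp
    moreover have "u' (R \<theta> x) (h *\<^sub>R Y (R \<theta> x)) = w (R \<theta> x) * h" for h
      using has_derivative_linear[OF u[OF R_sphere[OF that]]] by (simp add: w_def linear_cmul)
    ultimately show ?thesis by (simp add: has_field_derivative_def)
  qed
  have uc: "continuous_on (sphere 0 1) u"
    using u by (meson continuous_at_imp_continuous_on has_derivative_continuous)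
  have "bounded (w ` sphere 0 1)"
    using cont by (intro compact_imp_bounded compact_continuous_image) (simp_all add: w_def)
  then obtain C where C: "\<And>x. x \<in> sphere 0 1 \<Longrightarrow> norm (w x) \<le> C"
    unfolding bounded_iff by blast
  have "((\<lambda>\<theta>. \<integral>x. u (R \<theta> x) \<partial>sphere_measure) has_real_derivative (\<integral>x. w (R 0 x) \<partial>sphere_measure)) (at 0)"
  proof (rule has_real_derivative_integral[where T = UNIV and h = "\<lambda>\<theta> x. u (R \<theta> x)" and h' = "\<lambda>\<theta> x. w (R \<theta> x)" and C = C])
    show "integrable sphere_measure (\<lambda>x. u (R t x))" for t
      by (intro integrable_sphere_measure continuous_on_compose2[OF uc cR]) (auto simp: normR)
  qed (use du C[unfolded real_norm_def] R_sphere sphere_measure.finite_measure_axioms in auto)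
  moreover have "(\<integral>x. u (R \<theta> x) \<partial>sphere_measure) = integral\<^sup>L sphere_measure u" for \<theta>
    by (rule integral_sphere_measure_isometry[OF linR normR uc])
  ultimately have "((\<lambda>_. integral\<^sup>L sphere_measure u) has_real_derivative (\<integral>x. w (R 0 x) \<partial>sphere_measure)) (at 0)"
    by simp
  then have "(\<integral>x. w (R 0 x) \<partial>sphere_measure) = 0"
    by (rule DERIV_unique) (rule DERIV_const)
  moreover have "R 0 x = x" for x by (simp add: R_def)
  ultimately show ?thesis by (simp only: w_def)
qed

text \<open>Only the matrix entries of \<open>g'\<close> are assumed continuous; expanding both
  arguments in the basis carries continuity over to vectors varying with \<open>x\<close>.\<close>

lemma continuous_on_bilinear_expand:
  fixes g' :: "'a::euclidean_space \<Rightarrow> 'a \<Rightarrow> 'a"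
  assumes "\<And>x. x \<in> S \<Longrightarrow> linear (g' x)"
    and g': "\<And>v w. continuous_on S (\<lambda>x. g' x v \<bullet> w)"
    and "continuous_on S L" "continuous_on S M"
  shows "continuous_on S (\<lambda>x. g' x (L x) \<bullet> M x)"
proof -
  have "g' x (L x) \<bullet> M x = (\<Sum>b\<in>Basis. (L x \<bullet> b) * (\<Sum>c\<in>Basis. (g' x b \<bullet> c) * (M x \<bullet> c)))"
    if "x \<in> S" for x
  proof -
    have "g' x (L x) = (\<Sum>b\<in>Basis. (L x \<bullet> b) *\<^sub>R g' x b)"
      by (subst euclidean_representation[of "L x", symmetric])
         (simp only: linear_sum[OF assms(1)[OF that]] linear_cmul[OF assms(1)[OF that]])
    then have "g' x (L x) \<bullet> M x = (\<Sum>b\<in>Basis. (L x \<bullet> b) * (g' x b \<bullet> M x))"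
      by (simp only: inner_sum_left inner_scaleR_left)
    then show ?thesis
      by (simp only: euclidean_inner[of "g' x b" "M x" for b])
  qed
  then have eq: "(\<Sum>b\<in>Basis. (L x \<bullet> b) * (\<Sum>c\<in>Basis. (g' x b \<bullet> c) * (M x \<bullet> c))) = g' x (L x) \<bullet> M x"
    if "x \<in> S" for x
    using that by simp
  have "continuous_on S (\<lambda>x. \<Sum>b\<in>Basis. (L x \<bullet> b) * (\<Sum>c\<in>Basis. (g' x b \<bullet> c) * (M x \<bullet> c)))"
    by (intro continuous_on_sum continuous_on_mult continuous_on_inner continuous_on_const g' assms(3,4))
  then show ?thesis
    by (rule continuous_on_eq) (rule eq)
qed

text \<open>If \<open>g\<close> is the gradient of \<open>f\<close>, then
  \<open>g x \<bullet> Y x\<close> is the derivative of \<open>f\<close> along \<open>Y\<close> and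
  the integrand is the second derivative along \<open>Y\<close>; the previous lemma applies to the
  first derivative.\<close>

lemma integral_skew_second_derivative:
  fixes Y :: "'a::euclidean_space \<Rightarrow> 'a" and g :: "'a \<Rightarrow> 'a"
  assumes Y: "linear Y" and skew: "\<And>x y. Y x \<bullet> y = - (x \<bullet> Y y)"
    and Y3: "\<And>x. Y (Y (Y x)) = - Y x"
    and g: "\<And>x. x \<in> sphere 0 1 \<Longrightarrow> (g has_derivative g' x) (at x)"
    and g': "\<And>v w. continuous_on (sphere 0 1) (\<lambda>x. g' x v \<bullet> w)"
  shows "continuous_on (sphere 0 1) (\<lambda>x. g' x (Y x) \<bullet> Y x + g x \<bullet> Y (Y x))"
    and "(\<integral>x. g' x (Y x) \<bullet> Y x + g x \<bullet> Y (Y x) \<partial>sphere_measure) = 0"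
proof -
  have cY: "continuous_on S Y" for S
    using Y by (simp add: linear_continuous_on linear_conv_bounded_linear)
  have gc: "continuous_on (sphere 0 1) g"
    using g by (meson continuous_at_imp_continuous_on has_derivative_continuous)
  have lin: "linear (g' x)" if "x \<in> sphere 0 1" for x
    using g[OF that] by (rule has_derivative_linear)
  have "continuous_on (sphere 0 1) (\<lambda>x. g' x (Y x) \<bullet> Y x)"
    by (rule continuous_on_bilinear_expand[OF lin g' cY cY])
  moreover have "continuous_on (sphere 0 1) (\<lambda>x. Y (Y x))"
    by (rule continuous_on_compose2[OF cY cY subset_UNIV])
  ultimately show c: "continuous_on (sphere 0 1) (\<lambda>x. g' x (Y x) \<bullet> Y x + g x \<bullet> Y (Y x))"
    by (intro continuous_on_add continuous_on_inner[OF gc])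
  have dY: "(Y has_derivative Y) (at x)" for x
    using Y by (simp add: bounded_linear_imp_has_derivative linear_conv_bounded_linear)
  have "((\<lambda>x. g x \<bullet> Y x) has_derivative (\<lambda>h. g x \<bullet> Y h + g' x h \<bullet> Y x)) (at x)"
    if "x \<in> sphere 0 1" for x
    using has_derivative_inner[OF g[OF that] dY] .
  from integral_skew_derivative[OF Y skew Y3 this] c
  show "(\<integral>x. g' x (Y x) \<bullet> Y x + g x \<bullet> Y (Y x) \<partial>sphere_measure) = 0"
    by (simp add: add.commute)
qed

lemma sum_Basis_delta:
  assumes "i \<in> (Basis :: 'a::euclidean_space set)"
  shows "(\<Sum>j\<in>(Basis::'a set). (i \<bullet> j) * f j) = f i"
proof -
  have "(\<Sum>j\<in>(Basis::'a set). (i \<bullet> j) * f j) = (\<Sum>j\<in>(Basis::'a set). if j = i then f j else (0::real))"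
    using assms by (intro sum.cong) (auto simp: inner_Basis)
  then show ?thesis using assms by (simp add: sum.delta)
qed

text \<open>With \<open>g\<close> the gradient of \<open>f\<close>, the integrand is the Laplacian
  of \<open>f\<close> on the sphere by \<open>laplace_beltrami_eq\<close>.\<close>

lemma integral_sphere_laplacian:
  fixes g :: "'a::euclidean_space \<Rightarrow> 'a"
  assumes g: "\<And>x. x \<in> sphere 0 1 \<Longrightarrow> (g has_derivative g' x) (at x)"
    and g': "\<And>v w. continuous_on (sphere 0 1) (\<lambda>x. g' x v \<bullet> w)"
  shows "(\<integral>x. (\<Sum>b\<in>Basis. g' x b \<bullet> b) - g' x x \<bullet> x - (real DIM('a) - 1) * (g x \<bullet> x) \<partial>sphere_measure) = 0"
proof -
  \<comment> \<open>The Laplacian is half the sum of the squares of the rotation fields \<open>Y i j\<close>.\<close>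
  define Y where "Y i j x = (x \<bullet> i) *\<^sub>R j - (x \<bullet> j) *\<^sub>R i" for i j x :: 'a
  have linY: "linear (Y i j)" for i j
    unfolding Y_def by (intro linearI) (simp_all add: algebra_simps inner_add_left)
  have skew: "Y i j x \<bullet> y = - (x \<bullet> Y i j y)" for i j x y
    unfolding Y_def by (simp add: inner_diff_left inner_diff_right inner_commute)
  have Y2: "Y i j (Y i j x) = ((i \<bullet> j) * (x \<bullet> i) - (x \<bullet> j)) *\<^sub>R j - ((x \<bullet> i) - (i \<bullet> j) * (x \<bullet> j)) *\<^sub>R i"
    if "i \<in> Basis" "j \<in> Basis" for i j x
    unfolding Y_def using that
    by (simp add: inner_diff_left inner_commute[of j i] mult.commute)
  have Y3: "Y i j (Y i j (Y i j x)) = - Y i j x" if "i \<in> Basis" "j \<in> Basis" for i j x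
  proof (cases "i = j")
    case False
    then have "i \<bullet> j = 0" "j \<bullet> i = 0" using that by (auto simp: inner_Basis)
    then have "Y i j (Y i j x) = - (x \<bullet> j) *\<^sub>R j - (x \<bullet> i) *\<^sub>R i"
      using Y2[OF that, of x] by simp
    then show ?thesis
      using that \<open>i \<bullet> j = 0\<close> \<open>j \<bullet> i = 0\<close> by (simp add: Y_def inner_diff_left)
  qed (simp add: Y_def)
  define w where "w i j x = g' x (Y i j x) \<bullet> Y i j x + g x \<bullet> Y i j (Y i j x)" for i j x
  have w: "integrable sphere_measure (w i j)" "integral\<^sup>L sphere_measure (w i j) = 0"
    if "i \<in> Basis" "j \<in> Basis" for i j
    unfolding w_def
    using integral_skew_second_derivative[OF linY skew Y3[OF that] g g'] integrable_sphere_measure by auto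
  have sum_w: "(\<Sum>i\<in>Basis. \<Sum>j\<in>Basis. w i j x)
      = 2 * ((\<Sum>b\<in>Basis. g' x b \<bullet> b) - g' x x \<bullet> x - (real DIM('a) - 1) * (g x \<bullet> x))"
    if x: "x \<in> sphere 0 1" for x
  proof -
    have lin: "linear (g' x)" using g[OF x] by (rule has_derivative_linear)
    have xx: "(\<Sum>i\<in>Basis. (x \<bullet> i) * (x \<bullet> i)) = 1"
      using x by (simp add: euclidean_inner[of x x, symmetric] norm_eq_sqrt_inner)
    have gx: "(\<Sum>i\<in>Basis. (x \<bullet> i) * (g x \<bullet> i)) = g x \<bullet> x"
      by (simp add: euclidean_inner[of "g x" x] mult.commute)
    have g'x: "(\<Sum>i\<in>Basis. \<Sum>j\<in>Basis. (x \<bullet> i) * (x \<bullet> j) * (g' x i \<bullet> j)) = g' x x \<bullet> x"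
    proof -
      have "g' x x = (\<Sum>i\<in>Basis. (x \<bullet> i) *\<^sub>R g' x i)"
        by (subst (2) euclidean_representation[of x, symmetric])
           (simp only: linear_sum[OF lin] linear_cmul[OF lin])
      then have "g' x x \<bullet> x = (\<Sum>i\<in>Basis. (x \<bullet> i) * (g' x i \<bullet> x))"
        by (simp only: inner_sum_left inner_scaleR_left)
      also have "\<dots> = (\<Sum>i\<in>Basis. \<Sum>j\<in>Basis. (x \<bullet> i) * (x \<bullet> j) * (g' x i \<bullet> j))"
        by (simp only: euclidean_inner[of "g' x i" x for i] sum_distrib_left mult_ac)
      finally show ?thesis by simp
    qed
    have g'x': "(\<Sum>i\<in>Basis. \<Sum>j\<in>Basis. (x \<bullet> i) * (x \<bullet> j) * (g' x j \<bullet> i)) = g' x x \<bullet> x"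
      unfolding g'x[symmetric] by (subst sum.swap) (simp add: mult.commute)
    have "w i j x = (x \<bullet> i) * (x \<bullet> i) * (g' x j \<bullet> j) + (x \<bullet> j) * (x \<bullet> j) * (g' x i \<bullet> i)
        - (x \<bullet> i) * (x \<bullet> j) * (g' x i \<bullet> j) - (x \<bullet> i) * (x \<bullet> j) * (g' x j \<bullet> i)
        + (i \<bullet> j) * ((x \<bullet> i) * (g x \<bullet> j)) + (i \<bullet> j) * ((x \<bullet> j) * (g x \<bullet> i))
        - (x \<bullet> i) * (g x \<bullet> i) - (x \<bullet> j) * (g x \<bullet> j)" if ij: "i \<in> Basis" "j \<in> Basis" for i j
      unfolding w_def Y2[OF ij] unfolding Y_def
      by (simp add: linear_diff[OF lin] linear_cmul[OF lin] inner_diff_left inner_diff_right algebra_simps)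
    then have "(\<Sum>i\<in>Basis. \<Sum>j\<in>Basis. w i j x) = (\<Sum>i\<in>Basis. \<Sum>j\<in>Basis.
          (x \<bullet> i) * (x \<bullet> i) * (g' x j \<bullet> j) + (x \<bullet> j) * (x \<bullet> j) * (g' x i \<bullet> i)
        - (x \<bullet> i) * (x \<bullet> j) * (g' x i \<bullet> j) - (x \<bullet> i) * (x \<bullet> j) * (g' x j \<bullet> i)
        + (i \<bullet> j) * ((x \<bullet> i) * (g x \<bullet> j)) + (i \<bullet> j) * ((x \<bullet> j) * (g x \<bullet> i))
        - (x \<bullet> i) * (g x \<bullet> i) - (x \<bullet> j) * (g x \<bullet> j))"
      by (intro sum.cong refl)
    also have "\<dots> = (\<Sum>i\<in>Basis. (x \<bullet> i) * (x \<bullet> i)) * (\<Sum>j\<in>Basis. g' x j \<bullet> j)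
        + (\<Sum>j\<in>Basis. (x \<bullet> j) * (x \<bullet> j)) * (\<Sum>i\<in>Basis. g' x i \<bullet> i)
        - g' x x \<bullet> x - g' x x \<bullet> x + g x \<bullet> x + g x \<bullet> x
        - real DIM('a) * (g x \<bullet> x) - real DIM('a) * (g x \<bullet> x)"
    proof -
      have "(\<Sum>i\<in>Basis. \<Sum>j\<in>Basis. (x \<bullet> i) * (x \<bullet> i) * (g' x j \<bullet> j))
          = (\<Sum>i\<in>Basis. (x \<bullet> i) * (x \<bullet> i)) * (\<Sum>j\<in>Basis. g' x j \<bullet> j)"
        by (rule sum_product[symmetric])
      moreover have "(\<Sum>i\<in>Basis. \<Sum>j\<in>Basis. (x \<bullet> j) * (x \<bullet> j) * (g' x i \<bullet> i))
          = (\<Sum>j\<in>Basis. (x \<bullet> j) * (x \<bullet> j)) * (\<Sum>i\<in>Basis. g' x i \<bullet> i)"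
        unfolding sum_product by (rule sum.swap)
      moreover have "(\<Sum>i\<in>Basis. \<Sum>j\<in>Basis. (i \<bullet> j) * ((x \<bullet> i) * (g x \<bullet> j))) = g x \<bullet> x"
        unfolding gx[symmetric] by (intro sum.cong refl sum_Basis_delta)
      moreover have "(\<Sum>i\<in>Basis. \<Sum>j\<in>Basis. (i \<bullet> j) * ((x \<bullet> j) * (g x \<bullet> i))) = g x \<bullet> x"
        unfolding gx[symmetric] by (intro sum.cong refl sum_Basis_delta)
      moreover have "(\<Sum>i\<in>(Basis::'a set). \<Sum>j\<in>(Basis::'a set). (x \<bullet> i) * (g x \<bullet> i)) = real DIM('a) * (g x \<bullet> x)"
        unfolding gx[symmetric] by (subst sum.swap) (simp only: sum_constant)
      moreover have "(\<Sum>i\<in>(Basis::'a set). \<Sum>j\<in>(Basis::'a set). (x \<bullet> j) * (g x \<bullet> j)) = real DIM('a) * (g x \<bullet> x)"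
        unfolding gx[symmetric] by (simp only: sum_constant)
      ultimately show ?thesis
        unfolding sum.distrib sum_subtractf g'x g'x' by (simp only:)
    qed
    finally show ?thesis unfolding xx by (simp add: algebra_simps)
  qed
  have "(\<integral>x. (\<Sum>b\<in>Basis. g' x b \<bullet> b) - g' x x \<bullet> x - (real DIM('a) - 1) * (g x \<bullet> x) \<partial>sphere_measure)
      = (\<integral>x. (\<Sum>i\<in>Basis. \<Sum>j\<in>Basis. w i j x) / 2 \<partial>sphere_measure)"
    by (intro Bochner_Integration.integral_cong) (simp_all add: sum_w)
  also have "\<dots> = 0"
    using w by (simp add: Bochner_Integration.integral_sum)
  finally show ?thesis .
qed

section \<open>Smooth functions and the Laplacian of the sphere\<close>

lemma C_k_on_cong:
  assumes "open S" "\<And>x. x \<in> S \<Longrightarrow> f x = g x"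
  shows "C_k_on k S f \<longleftrightarrow> C_k_on k S g"
proof -
  have "C_k_on k S g" if "C_k_on k S f" "\<And>x. x \<in> S \<Longrightarrow> f x = g x" for f g
    using that
  proof (induction k arbitrary: f g)
    case 0
    then show ?case by (simp cong: continuous_on_cong)
  next
    case (Suc k)
    have der: "(g has_derivative frechet_derivative f (at x)) (at x)" if "x \<in> S" for x
    proof (rule has_derivative_transform_within_open[OF _ \<open>open S\<close> that])
      show "(f has_derivative frechet_derivative f (at x)) (at x)"
        using Suc.prems(1) \<open>open S\<close> that by (auto simp: differentiable_on_eq_differentiable_at frechet_derivative_works)
    qed (use Suc.prems in auto)
    have "C_k_on k S (\<lambda>x. frechet_derivative g (at x) v)" for v
      by (rule Suc.IH[of "\<lambda>x. frechet_derivative f (at x) v"])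
         (use Suc.prems(1) in \<open>auto simp: frechet_derivative_at[OF der, symmetric]\<close>)
    then show ?case
      using der \<open>open S\<close> by (auto simp: differentiable_on_eq_differentiable_at differentiable_def)
  qed
  from this[of f g] this[of g f] show ?thesis using assms by auto
qed

lemma C_k_on_Suc_lower: "C_k_on (Suc k) S f \<Longrightarrow> C_k_on k S f"
proof (induction k arbitrary: f)
  case 0
  then show ?case by (simp add: differentiable_imp_continuous_on)
next
  case (Suc k)
  from Suc.prems have "f differentiable_on S" "\<And>v. C_k_on (Suc k) S (\<lambda>x. frechet_derivative f (at x) v)"
    by simp_all
  then show ?case using Suc.IH by simp
qed

text \<open>Trades the canonical \<open>frechet_derivative\<close> of the definition for any
  derivative found by calculus, so that the closure rules can be proved by induction on explicit
  formulas.\<close>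

lemma C_k_on_SucI:
  assumes "open S" "\<And>x. x \<in> S \<Longrightarrow> (f has_derivative f' x) (at x)" "\<And>v. C_k_on k S (\<lambda>x. f' x v)"
  shows "C_k_on (Suc k) S f"
proof -
  have "C_k_on k S (\<lambda>x. frechet_derivative f (at x) v)" for v
    using assms(3)[of v] by (subst C_k_on_cong[OF assms(1)]) (auto simp: frechet_derivative_at[OF assms(2), symmetric])
  then show ?thesis
    using assms by (auto simp: differentiable_on_eq_differentiable_at differentiable_def)
qed

lemma C_k_on_SucE:
  assumes "open S" "C_k_on (Suc k) S f"
  obtains f' where "\<And>x. x \<in> S \<Longrightarrow> (f has_derivative f' x) (at x)" "\<And>v. C_k_on k S (\<lambda>x. f' x v)"
  using assms that[of "\<lambda>x. frechet_derivative f (at x)"]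
  by (auto simp: differentiable_on_eq_differentiable_at frechet_derivative_works)

lemma C_k_on_const:
  assumes "open S"
  shows "C_k_on k S (\<lambda>_. c)"
  by (induction k arbitrary: c) (auto intro: C_k_on_SucI[OF assms])

lemma C_k_on_linear:
  assumes "open S" "bounded_linear f"
  shows "C_k_on k S f"
proof (cases k)
  case 0
  then show ?thesis using assms by (simp add: linear_continuous_on)
next
  case (Suc l)
  show ?thesis
    unfolding Suc using assms
    by (intro C_k_on_SucI[where f' = "\<lambda>_. f"] C_k_on_const bounded_linear_imp_has_derivative)
qed

lemma C_k_on_add:
  assumes "open S" "C_k_on k S f" "C_k_on k S g"
  shows "C_k_on k S (\<lambda>x. f x + g x)"
  using assms(2,3)
proof (induction k arbitrary: f g)
  case (Suc k)
  obtain f' where "\<And>x. x \<in> S \<Longrightarrow> (f has_derivative f' x) (at x)" "\<And>v. C_k_on k S (\<lambda>x. f' x v)"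
    by (rule C_k_on_SucE[OF assms(1) Suc.prems(1)]) blast
  moreover obtain g' where "\<And>x. x \<in> S \<Longrightarrow> (g has_derivative g' x) (at x)" "\<And>v. C_k_on k S (\<lambda>x. g' x v)"
    by (rule C_k_on_SucE[OF assms(1) Suc.prems(2)]) blast
  ultimately show ?case
    by (intro C_k_on_SucI[OF assms(1), where f' = "\<lambda>x h. f' x h + g' x h"])
       (auto intro: has_derivative_add Suc.IH)
qed (simp add: continuous_on_add)

lemma C_k_on_mult:
  assumes "open S" "C_k_on k S f" "C_k_on k S g"
  shows "C_k_on k S (\<lambda>x. f x * g x)"
  using assms(2,3)
proof (induction k arbitrary: f g)
  case (Suc k)
  obtain f' where f': "\<And>x. x \<in> S \<Longrightarrow> (f has_derivative f' x) (at x)" "\<And>v. C_k_on k S (\<lambda>x. f' x v)"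
    by (rule C_k_on_SucE[OF assms(1) Suc.prems(1)]) blast
  obtain g' where g': "\<And>x. x \<in> S \<Longrightarrow> (g has_derivative g' x) (at x)" "\<And>v. C_k_on k S (\<lambda>x. g' x v)"
    by (rule C_k_on_SucE[OF assms(1) Suc.prems(2)]) blast
  show ?case
    by (rule C_k_on_SucI[OF assms(1), where f' = "\<lambda>x h. f x * g' x h + f' x h * g x"])
       (auto intro!: has_derivative_mult f' g' C_k_on_add assms Suc.IH Suc.prems[THEN C_k_on_Suc_lower])
qed (simp add: continuous_on_mult)

text \<open>The derivative of the reciprocal is a product of the reciprocal itself and the
  derivative of \<open>f\<close>, so the induction hypothesis on the reciprocal closes the
  step.\<close>

lemma C_k_on_inverse:
  assumes "open S" "C_k_on k S f" and nz: "\<And>x. x \<in> S \<Longrightarrow> f x \<noteq> 0"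
  shows "C_k_on k S (\<lambda>x. inverse (f x))"
  using assms(2)
proof (induction k)
  case (Suc k)
  obtain f' where f': "\<And>x. x \<in> S \<Longrightarrow> (f has_derivative f' x) (at x)" "\<And>v. C_k_on k S (\<lambda>x. f' x v)"
    by (rule C_k_on_SucE[OF assms(1) Suc.prems]) blast
  have IH: "C_k_on k S (\<lambda>x. inverse (f x))"
    by (rule Suc.IH[OF C_k_on_Suc_lower[OF Suc.prems]])
  show ?case
  proof (rule C_k_on_SucI[OF assms(1)])
    show "((\<lambda>x. inverse (f x)) has_derivative (\<lambda>h. (-1) * (inverse (f x) * f' x h * inverse (f x)))) (at x)"
      if "x \<in> S" for x
      using Deriv.has_derivative_inverse[OF nz[OF that] f'(1)[OF that]] by simp
    show "C_k_on k S (\<lambda>x. (-1) * (inverse (f x) * f' x v * inverse (f x)))" for v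
      by (intro C_k_on_mult C_k_on_const assms(1) IH f'(2))
  qed
qed (simp add: continuous_on_inverse nz)

lemma C_k_on_power:
  assumes "open S" "C_k_on k S f"
  shows "C_k_on k S (\<lambda>x. f x ^ i)"
  by (induction i) (auto intro: C_k_on_const C_k_on_mult assms)

lemma C_k_on_sum:
  assumes "open S" "\<And>i. i \<in> I \<Longrightarrow> C_k_on k S (f i)"
  shows "C_k_on k S (\<lambda>x. \<Sum>i\<in>I. f i x)"
  using assms(2)
  by (induction I rule: infinite_finite_induct) (auto intro: C_k_on_const C_k_on_add assms)

text \<open>The derivative is a polynomial in \<open>inverse (norm x)\<close> and a linear function,
  hence the induction closes. Together with linear functions this one generates everything that
  occurs after composition with \<open>sgn\<close>.\<close>

lemma C_k_on_inverse_norm: "C_k_on k (- {0}) (\<lambda>x::'a::euclidean_space. inverse (norm x))"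
proof (induction k)
  case 0
  show ?case by (simp add: continuous_on_inverse continuous_on_norm_id)
next
  case (Suc k)
  have der: "((\<lambda>x. inverse (norm x)) has_derivative (\<lambda>h. (-1) * (inverse (norm x) ^ 3 * (h \<bullet> x)))) (at x)"
    if "x \<noteq> 0" for x :: 'a
    using that
    by (auto intro!: derivative_eq_intros has_derivative_norm simp: sgn_div_norm fun_eq_iff inner_commute power3_eq_cube)
  show ?case
  proof (rule C_k_on_SucI[OF _ der])
    show "C_k_on k (- {0}) (\<lambda>x. (-1) * (inverse (norm x) ^ 3 * (v \<bullet> x)))" for v :: 'a
      by (intro C_k_on_mult C_k_on_const C_k_on_power Suc.IH C_k_on_linear bounded_linear_inner_right) auto
  qed auto
qed

section \<open>Derivatives and Laplacian on the sphere from ambient extensions\<close>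

lemma sgn_curve_derivative:
  fixes x v :: "'a::euclidean_space"
  assumes "x \<in> sphere 0 1"
  shows "((\<lambda>t. sgn (x + t *\<^sub>R v)) has_vector_derivative (v - (x \<bullet> v) *\<^sub>R x)) (at 0)"
proof -
  have xx: "x \<bullet> x = 1" using assms by (simp add: norm_eq_sqrt_inner)
  have eq: "sgn (x + t *\<^sub>R v) = inverse (sqrt (1 + 2 * t * (x \<bullet> v) + t\<^sup>2 * (v \<bullet> v))) *\<^sub>R (x + t *\<^sub>R v)" for t
    by (simp add: sgn_div_norm norm_eq_sqrt_inner inner_add_left inner_add_right xx
        inner_commute[of v x] power2_eq_square algebra_simps)
  show ?thesis unfolding eq
    by (auto intro!: derivative_eq_intros simp: algebra_simps)
qed

text \<open>The curve stays on the sphere, so any differentiable extension \<open>g\<close> of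
  \<open>f\<close> computes the derivative, by the chain rule with the tangential part of
  \<open>v\<close>.\<close>

lemma sphere_deriv_eq:
  fixes f :: "'a::euclidean_space \<Rightarrow> 'b::real_normed_vector"
  assumes x: "x \<in> sphere 0 1" and g: "(g has_derivative g') (at x)"
    and eq: "\<And>y. y \<in> sphere 0 1 \<Longrightarrow> f y = g y"
  shows "sphere_deriv f x v = g' (v - (x \<bullet> v) *\<^sub>R x)"
proof -
  have x0: "sgn (x + 0 *\<^sub>R v) = x" using x by (simp add: sgn_div_norm)
  have "((\<lambda>t. g (sgn (x + t *\<^sub>R v))) has_derivative (\<lambda>h. g' (h *\<^sub>R (v - (x \<bullet> v) *\<^sub>R x)))) (at 0)"
    using has_derivative_compose[OF sgn_curve_derivative[OF x, unfolded has_vector_derivative_def], of g g'] g x0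
    by simp
  then have d: "((\<lambda>t. g (sgn (x + t *\<^sub>R v))) has_vector_derivative g' (v - (x \<bullet> v) *\<^sub>R x)) (at 0)"
    using has_derivative_linear[OF g] by (simp add: has_vector_derivative_def linear_cmul)
  \<comment> \<open>Away from the origin \<open>sgn\<close> lands on the sphere, where alone
    \<open>f\<close> and \<open>g\<close> are known to agree.\<close>
  have "\<forall>\<^sub>F t in nhds 0. x + t *\<^sub>R v \<noteq> 0"
  proof -
    have "((\<lambda>t. x + t *\<^sub>R v) \<longlongrightarrow> x + 0 *\<^sub>R v) (nhds 0)"
      by (intro tendsto_intros) (simp add: filterlim_ident)
    moreover have "x \<noteq> 0" using x by auto
    ultimately show ?thesis
      using tendsto_imp_eventually_ne by force
  qed
  then have "\<forall>\<^sub>F t in nhds 0. f (sgn (x + t *\<^sub>R v)) = g (sgn (x + t *\<^sub>R v))"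
    by eventually_elim (auto intro!: eq simp: norm_sgn)
  then have "((\<lambda>t. f (sgn (x + t *\<^sub>R v))) has_vector_derivative g' (v - (x \<bullet> v) *\<^sub>R x)) (at 0)"
    using d by (subst has_vector_derivative_cong_ev[where g = "\<lambda>t. g (sgn (x + t *\<^sub>R v))"])
      (auto elim: eventually_mono dest: eventually_nhds_x_imp_x)
  then show ?thesis
    unfolding sphere_deriv_def by (rule vector_derivative_at)
qed

text \<open>With \<open>g\<close> the ambient gradient and \<open>g'\<close> the ambient Hessian of
  \<open>f\<close>, this is the classical decomposition: ambient Laplacian, minus the second radial
  derivative, minus the dimension of the sphere times the radial derivative.\<close>

lemma laplace_beltrami_eq:
  fixes f :: "'a::euclidean_space \<Rightarrow> real"
  assumes f: "\<And>x. x \<in> sphere 0 1 \<Longrightarrow> (f has_derivative (\<lambda>h. g x \<bullet> h)) (at x)"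
    and g: "\<And>x. x \<in> sphere 0 1 \<Longrightarrow> (g has_derivative g' x) (at x)"
    and q: "q \<in> sphere 0 1"
  shows "laplace_beltrami f q = (\<Sum>b\<in>Basis. g' q b \<bullet> b) - g' q q \<bullet> q - (real DIM('a) - 1) * (g q \<bullet> q)"
proof -
  \<comment> \<open>The tangential part of the ambient gradient, which extends
    \<open>sphere_grad f\<close> off the sphere and can therefore be differentiated at
    \<open>q\<close>.\<close>
  define V where "V x = g x - (g x \<bullet> x) *\<^sub>R x" for x
  have grad: "sphere_grad f x = V x" if "x \<in> sphere 0 1" for x
  proof -
    have "sphere_grad f x = (\<Sum>b\<in>Basis. (V x \<bullet> b) *\<^sub>R b)"
      unfolding sphere_grad_def V_def
      by (intro sum.cong refl)
         (simp add: sphere_deriv_eq[OF that f[OF that]] inner_diff_right inner_diff_left)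
    then show ?thesis by (simp add: euclidean_representation)
  qed
  have qq: "q \<bullet> q = 1" using q by (simp add: norm_eq_sqrt_inner)
  define V' where "V' h = g' q h - ((g' q h \<bullet> q + g q \<bullet> h) *\<^sub>R q + (g q \<bullet> q) *\<^sub>R h)" for h
  have dV: "(V has_derivative V') (at q)"
    unfolding V_def V'_def
    by (auto intro!: derivative_eq_intros g[OF q] simp: fun_eq_iff algebra_simps)
  have lin: "linear (g' q)" using g[OF q] by (rule has_derivative_linear)
  have g'q: "(\<Sum>b\<in>Basis. (q \<bullet> b) * (g' q q \<bullet> b)) = g' q q \<bullet> q"
    by (simp add: euclidean_inner[of "g' q q" q] mult.commute)
  have g'q2: "(\<Sum>b\<in>Basis. (q \<bullet> b) * (g' q b \<bullet> q)) = g' q q \<bullet> q"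
  proof -
    have "g' q q = (\<Sum>i\<in>Basis. (q \<bullet> i) *\<^sub>R g' q i)"
      by (subst (2) euclidean_representation[of q, symmetric])
         (simp only: linear_sum[OF lin] linear_cmul[OF lin])
    then show ?thesis by (simp add: inner_sum_left)
  qed
  have gq: "(\<Sum>b\<in>Basis. (q \<bullet> b) * (g q \<bullet> b)) = g q \<bullet> q"
    by (simp add: euclidean_inner[of "g q" q] mult.commute)
  have qb: "(\<Sum>b\<in>Basis. (q \<bullet> b) * (q \<bullet> b)) = 1"
    by (simp add: euclidean_inner[of q q, symmetric] qq)
  have "sphere_deriv (sphere_grad f) q b = V' (b - (q \<bullet> b) *\<^sub>R q)" for b
    by (rule sphere_deriv_eq[OF q dV]) (rule grad)
  then have "laplace_beltrami f q = (\<Sum>b\<in>Basis. V' (b - (q \<bullet> b) *\<^sub>R q) \<bullet> b)"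
    unfolding laplace_beltrami_def sphere_div_def by simp
  also have "\<dots> = (\<Sum>b\<in>Basis. g' q b \<bullet> b - (q \<bullet> b) * (g' q q \<bullet> b) - (q \<bullet> b) * (g' q b \<bullet> q)
      + (q \<bullet> b) * (q \<bullet> b) * (g' q q \<bullet> q) - (q \<bullet> b) * (g q \<bullet> b) + (q \<bullet> b) * (q \<bullet> b) * (g q \<bullet> q)
      - (g q \<bullet> q) + (q \<bullet> b) * (q \<bullet> b) * (g q \<bullet> q))"
    unfolding V'_def
    by (intro sum.cong refl)
       (simp add: linear_diff[OF lin] linear_cmul[OF lin] inner_diff_left inner_diff_right
         inner_add_left algebra_simps)
  also have "\<dots> = (\<Sum>b\<in>Basis. g' q b \<bullet> b) - g' q q \<bullet> q - (real DIM('a) - 1) * (g q \<bullet> q)"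
    unfolding sum.distrib sum_subtractf g'q g'q2 gq sum_distrib_right[symmetric] qb
    by (simp add: algebra_simps)
  finally show ?thesis .
qed

section \<open>The quaternionic inner product and the sub-Laplacian\<close>

definition qcnj :: "quat \<Rightarrow> quat" where "qcnj q = (cnj (fst q), - snd q)"

text \<open>The conjugate sits on the second argument, so that the form is left linear over the
  quaternions in the first one and matches the left action, see \<open>hdot_qact\<close>.\<close>

definition hdot :: "'n::finite qspace \<Rightarrow> 'n qspace \<Rightarrow> quat"
  where "hdot x y = (\<Sum>i\<in>UNIV. qmult (fst x $ i) (qcnj (fst y $ i))) + qmult (snd x) (qcnj (snd y))"

lemma qmult_assoc: "qmult (qmult a b) c = qmult a (qmult b c)"
  by (simp add: qmult_def algebra_simps)

lemma qmult_add: "qmult (a + b) c = qmult a c + qmult b c" "qmult a (b + c) = qmult a b + qmult a c"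
  by (simp_all add: qmult_def prod_eq_iff algebra_simps)

lemma qmult_scaleR: "qmult (t *\<^sub>R a) c = t *\<^sub>R qmult a c" "qmult a (t *\<^sub>R c) = t *\<^sub>R qmult a c"
  by (simp_all add: qmult_def prod_eq_iff scaleR_conv_of_real algebra_simps)

lemma qmult_sum_right: "qmult a (\<Sum>i\<in>I. f i) = (\<Sum>i\<in>I. qmult a (f i))"
  by (rule linear_sum, rule linearI) (simp_all only: qmult_add qmult_scaleR)

lemma qmult_one [simp]: "qmult q_one a = a"
  by (simp add: qmult_def q_one_def)

lemma norm_qcnj [simp]: "norm (qcnj a) = norm a"
  by (simp add: qcnj_def norm_prod_def)

lemma linear_qcnj: "linear qcnj"
  by (auto intro!: linearI simp: qcnj_def)

lemma qcnj_qmult_qcnj: "qcnj (qmult a (qcnj b)) = qmult b (qcnj a)"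
  by (simp add: qcnj_def qmult_def algebra_simps)

lemma inner_qmult_qcnj: "qmult a (qcnj b) \<bullet> w = a \<bullet> qmult w b"
  by (simp add: qcnj_def qmult_def inner_prod_def inner_complex_def algebra_simps)

lemma inner_qspace: "(x :: 'n::finite qspace) \<bullet> y = (\<Sum>i\<in>UNIV. fst x $ i \<bullet> fst y $ i) + snd x \<bullet> snd y"
  by (simp add: inner_prod_def[where 'a = "quat ^ 'n"] inner_vec_def)

lemma linear_qact: "linear (qact g)"
  by (intro linearI) (simp_all add: qact_def vec_eq_iff prod_eq_iff qmult_add qmult_scaleR)

lemma linear_qact_left: "linear (\<lambda>g. qact g x)"
  by (intro linearI) (simp_all add: qact_def vec_eq_iff prod_eq_iff qmult_add qmult_scaleR)

lemma qact_qmult: "qact g (qact h x) = qact (qmult g h) x"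
  by (simp add: qact_def qmult_assoc)

lemma qact_one [simp]: "qact q_one x = x"
  by (simp add: qact_def)

lemma norm_qact [simp]: "norm (qact g x) = norm g * norm x"
proof -
  have n2: "a \<bullet> a = (norm a)\<^sup>2" for a :: quat by (simp add: power2_norm_eq_inner)
  have "qact g x \<bullet> qact g x = (norm g)\<^sup>2 * (x \<bullet> x)"
    unfolding inner_qspace by (simp add: qact_def n2 norm_qmult power_mult_distrib sum_distrib_left distrib_left)
  then have "(norm (qact g x))\<^sup>2 = (norm g * norm x)\<^sup>2"
    by (simp add: power2_norm_eq_inner power_mult_distrib)
  then show ?thesis by (simp add: power2_eq_iff_nonneg)
qed

text \<open>Adjointness of the maps \<open>\<lambda>x. hdot x y\<close> and
  \<open>\<lambda>w. qact w y\<close>. It reduces quaternionic identities to the real inner product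
  of the ambient space.\<close>

lemma hdot_inner: "hdot x y \<bullet> w = x \<bullet> qact w y"
  by (simp add: hdot_def inner_qspace qact_def inner_add_left inner_sum_left inner_qmult_qcnj)

lemma hdot_qact: "hdot (qact g x) y = qmult g (hdot x y)"
  by (simp add: hdot_def qact_def qmult_add qmult_sum_right qmult_assoc)

lemma hdot_commute: "hdot y x = qcnj (hdot x y)"
  by (simp add: hdot_def linear_add[OF linear_qcnj] linear_sum[OF linear_qcnj] qcnj_qmult_qcnj)

lemma norm_hdot_commute: "norm (hdot y x) = norm (hdot x y)"
  by (simp add: hdot_commute[of y x])

lemma linear_hdot: "linear (\<lambda>x. hdot x y)"
proof (rule linearI)
  show "hdot (x + x') y = hdot x y + hdot x' y" for x x'
    by (rule vector_eq_rdot[THEN iffD1], rule allI) (simp only: hdot_inner inner_add_left)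
  show "hdot (c *\<^sub>R x) y = c *\<^sub>R hdot x y" for c x
    by (rule vector_eq_rdot[THEN iffD1], rule allI) (simp only: hdot_inner inner_scaleR_left)
qed

lemma inner_q_one_hdot: "hdot x y \<bullet> q_one = x \<bullet> y"
  by (simp add: hdot_inner)

text \<open>Adjointness at \<open>w = hdot x y\<close> turns the squared norm into a real inner
  product, to which the real Cauchy-Schwarz inequality applies.\<close>

lemma norm_hdot_le: "norm (hdot x y) \<le> norm x * norm y"
proof -
  have "(norm (hdot x y))\<^sup>2 = x \<bullet> qact (hdot x y) y"
    by (simp add: power2_norm_eq_inner hdot_inner)
  also have "\<dots> \<le> norm x * norm (qact (hdot x y) y)" by (rule norm_cauchy_schwarz)
  finally have "norm (hdot x y) * norm (hdot x y) \<le> (norm x * norm y) * norm (hdot x y)"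
    by (simp add: power2_eq_square mult_ac)
  then show ?thesis by (cases "hdot x y = 0") (auto simp: mult_le_cancel_right)
qed

lemma norm_quat_units [simp]: "norm q_one = 1" "norm q_I = 1" "norm q_J = 1" "norm q_K = 1"
  by (simp_all add: q_one_def q_I_def q_J_def q_K_def norm_prod_def)

lemma norm_hopf_rotation:
  assumes "S \<in> {q_I, q_J, q_K}"
  shows "norm (cos \<theta> *\<^sub>R q_one + sin \<theta> *\<^sub>R S) = 1"
  using assms by (auto simp: norm_prod_def q_one_def q_I_def q_J_def q_K_def cmod_power2)

lemma qmult_hopf: "S \<in> {q_I, q_J, q_K} \<Longrightarrow> qmult S S = - q_one"
  using quaternion_relations by auto

lemma hopf_field_eq:
  fixes f :: "'n::finite qspace \<Rightarrow> real"
  assumes S: "S \<in> {q_I, q_J, q_K}" and x: "x \<in> sphere 0 1"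
    and g: "(g has_derivative g') (at x)"
    and eq: "\<And>y. y \<in> sphere 0 1 \<Longrightarrow> f y = g y"
  shows "hopf_field S f x = g' (qact S x)"
proof -
  define c where "c \<theta> = cos \<theta> *\<^sub>R x + sin \<theta> *\<^sub>R qact S x" for \<theta>
  have c: "qact (qexp (\<theta> *\<^sub>R S)) x = c \<theta>" for \<theta>
    unfolding c_def qexp_imaginary_unit[OF qmult_hopf[OF S]]
    by (simp add: linear_add[OF linear_qact_left] linear_cmul[OF linear_qact_left])
  have "c \<theta> \<in> sphere 0 1" for \<theta>
    using x norm_hopf_rotation[OF S, of \<theta>]
    by (simp add: c[symmetric] qexp_imaginary_unit[OF qmult_hopf[OF S]])
  then have f: "(\<lambda>\<theta>. f (qact (qexp (\<theta> *\<^sub>R S)) x)) = (\<lambda>\<theta>. g (c \<theta>))"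
    by (simp add: c eq)
  have "(c has_vector_derivative qact S x) (at 0)"
    unfolding c_def by (auto intro!: derivative_eq_intros)
  then have "((\<lambda>\<theta>. g (c \<theta>)) has_derivative (\<lambda>h. g' (h *\<^sub>R qact S x))) (at 0)"
    using has_derivative_compose[of c _ 0 UNIV g g'] g by (simp add: has_vector_derivative_def c_def)
  then have "((\<lambda>\<theta>. g (c \<theta>)) has_real_derivative g' (qact S x)) (at 0)"
    using has_derivative_linear[OF g]
    by (simp add: has_field_derivative_def linear_cmul mult_commute_abs)
  then show ?thesis
    unfolding hopf_field_def f by (rule DERIV_imp_deriv)
qed

lemma hopf_units_distinct: "q_I \<noteq> q_J" "q_I \<noteq> q_K" "q_J \<noteq> q_K"
  by (simp_all add: q_I_def q_J_def q_K_def)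

lemma sub_laplacian_eq:
  fixes f :: "'n::finite qspace \<Rightarrow> real"
  assumes f: "\<And>x. x \<in> sphere 0 1 \<Longrightarrow> (f has_derivative (\<lambda>h. g x \<bullet> h)) (at x)"
    and g: "\<And>x. x \<in> sphere 0 1 \<Longrightarrow> (g has_derivative g' x) (at x)"
    and x: "x \<in> sphere 0 1"
  shows "sub_laplacian f x = (\<Sum>b\<in>Basis. g' x b \<bullet> b)
    - (\<Sum>S\<in>{q_one, q_I, q_J, q_K}. g' x (qact S x) \<bullet> qact S x) - 4 * real CARD('n) * (g x \<bullet> x)"
proof -
  have h2: "hopf_field S (hopf_field S f) x = g' x (qact S x) \<bullet> qact S x - g x \<bullet> x"
    if S: "S \<in> {q_I, q_J, q_K}" for S
  proof -
    have 1: "hopf_field S f z = g z \<bullet> qact S z" if "z \<in> sphere 0 1" for z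
      using hopf_field_eq[OF S that f[OF that]] by simp
    have dq: "(qact S has_derivative qact S) (at x)"
      using linear_qact[of S, unfolded linear_conv_bounded_linear] by (rule bounded_linear_imp_has_derivative)
    have "hopf_field S (hopf_field S f) x = g x \<bullet> qact S (qact S x) + g' x (qact S x) \<bullet> qact S x"
      by (rule hopf_field_eq[OF S x has_derivative_inner[OF g[OF x] dq]]) (rule 1)
    also have "qact S (qact S x) = - x"
      by (simp add: qact_qmult qmult_hopf[OF S] linear_neg[OF linear_qact_left])
    finally show ?thesis by simp
  qed
  have ne: "q_one \<noteq> q_I" "q_one \<noteq> q_J" "q_one \<noteq> q_K"
    by (simp_all add: q_one_def q_I_def q_J_def q_K_def complex_eq_iff)
  have dim: "real DIM('n qspace) = 4 * real CARD('n) + 4"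
    by simp
  have lb: "laplace_beltrami f x = (\<Sum>b\<in>Basis. g' x b \<bullet> b) - g' x x \<bullet> x
      - (real DIM('n qspace) - 1) * (g x \<bullet> x)"
    by (rule laplace_beltrami_eq[OF _ _ x]) (rule f g, assumption)+
  show ?thesis
    unfolding sub_laplacian_def lb dim
    using ne hopf_units_distinct by (simp add: h2 algebra_simps)
qed

section \<open>Regularised Green functions\<close>

text \<open>\<open>sdist s y x\<close> is \<open>|s - \<langle>x, y\<rangle>|\<^sup>2\<close>, written as a polynomial in \<open>s\<close>; see \<open>sdist_eq\<close>.\<close>

definition sdist :: "real \<Rightarrow> 'n::finite qspace \<Rightarrow> 'n qspace \<Rightarrow> real"
  where "sdist s y x = s\<^sup>2 - 2 * s * (x \<bullet> y) + (norm (hdot x y))\<^sup>2"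

definition kern :: "nat \<Rightarrow> real \<Rightarrow> 'n::finite qspace \<Rightarrow> 'n qspace \<Rightarrow> real"
  where "kern m s y x = inverse (sdist s y x) ^ m"

text \<open>Half the gradient of \<open>sdist s y\<close> at \<open>x\<close>, see
  \<open>sdist_has_derivative\<close>.\<close>

definition pole_vec :: "real \<Rightarrow> 'n::finite qspace \<Rightarrow> 'n qspace \<Rightarrow> 'n qspace"
  where "pole_vec s y x = qact (hdot x y - s *\<^sub>R q_one) y"

lemma sdist_eq: "sdist s y x = (norm (hdot x y - s *\<^sub>R q_one))\<^sup>2"
proof -
  have "q_one \<bullet> q_one = (1::real)" using norm_quat_units(1) by (simp add: norm_eq_sqrt_inner)
  then show ?thesis
    unfolding sdist_def power2_norm_eq_inner
    by (simp add: inner_diff_left inner_diff_right inner_commute[of q_one "hdot u v" for u v] inner_q_one_hdot power2_eq_square algebra_simps)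
qed

lemma sdist_commute: "sdist s y x = sdist s x y"
  by (simp add: sdist_def norm_hdot_commute[of x y] inner_commute)

lemma inner_sphere:
  fixes x y :: "'a::euclidean_space"
  assumes "x \<in> sphere 0 1" "y \<in> sphere 0 1"
  shows "x \<bullet> y = 1 - (norm (x - y))\<^sup>2 / 2" "\<bar>x \<bullet> y\<bar> \<le> 1"
proof -
  have "x \<bullet> x = 1" "y \<bullet> y = 1" using assms by (simp_all add: norm_eq_sqrt_inner)
  then show "x \<bullet> y = 1 - (norm (x - y))\<^sup>2 / 2"
    by (simp add: power2_norm_eq_inner inner_diff_left inner_diff_right inner_commute field_simps)
  show "\<bar>x \<bullet> y\<bar> \<le> 1" using Cauchy_Schwarz_ineq2[of x y] assms by simp
qed

text \<open>The real part of the quaternion \<open>hdot x y - s *\<^sub>R q_one\<close> is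
  \<open>x \<bullet> y - s\<close>, and \<open>sdist\<close> is the square of its norm.\<close>

lemma sdist_ge_square: "(s - x \<bullet> y)\<^sup>2 \<le> sdist s y x"
proof -
  have "\<bar>hdot x y \<bullet> q_one\<bar> \<le> norm (hdot x y)"
    using Cauchy_Schwarz_ineq2[of "hdot x y" q_one] by simp
  then have "(x \<bullet> y)\<^sup>2 \<le> (norm (hdot x y))\<^sup>2"
    unfolding inner_q_one_hdot using abs_le_square_iff by fastforce
  then show ?thesis by (simp add: sdist_def power2_diff)
qed

text \<open>The first bound serves for fixed \<open>s > 1\<close>. The second one survives s
  \<rightarrow> 1, because \<open>1 - x \<bullet> y\<close> is
  \<open>(norm (x - y))\<^sup>2 / 2\<close>; it makes the mass concentrate at
  \<open>y\<close>.\<close>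

lemma sdist_bounds:
  assumes "x \<in> sphere 0 1" "y \<in> sphere 0 1" "1 \<le> s"
  shows "(s - 1)\<^sup>2 \<le> sdist s y x" "((norm (x - y))\<^sup>2 / 2)\<^sup>2 \<le> sdist s y x" "sdist s y x \<le> (s + 1)\<^sup>2"
proof -
  have "(s - 1)\<^sup>2 \<le> (s - x \<bullet> y)\<^sup>2"
    using inner_sphere(2)[OF assms(1,2)] assms(3) by (intro power_mono) auto
  then show "(s - 1)\<^sup>2 \<le> sdist s y x" using sdist_ge_square[of s x y] by simp
  have "((norm (x - y))\<^sup>2 / 2)\<^sup>2 \<le> (s - x \<bullet> y)\<^sup>2"
    using inner_sphere(1)[OF assms(1,2)] assms(3) by (intro power_mono) auto
  then show "((norm (x - y))\<^sup>2 / 2)\<^sup>2 \<le> sdist s y x" using sdist_ge_square[of s x y] by simp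
  have "norm (hdot x y - s *\<^sub>R q_one) \<le> norm (hdot x y) + norm (s *\<^sub>R q_one)" by (rule norm_triangle_ineq4)
  also have "\<dots> \<le> 1 + s" using norm_hdot_le[of x y] assms by simp
  finally show "sdist s y x \<le> (s + 1)\<^sup>2"
    unfolding sdist_eq by (intro power_mono) auto
qed

lemma sdist_pos:
  assumes "x \<in> sphere 0 1" "y \<in> sphere 0 1" "1 < s"
  shows "0 < sdist s y x"
proof -
  have "0 < (s - 1)\<^sup>2" using assms(3) by simp
  then show ?thesis using sdist_bounds(1)[OF assms(1,2), of s] assms(3) by linarith
qed

lemma inner_pole_vec: "pole_vec s y x \<bullet> h = (hdot x y - s *\<^sub>R q_one) \<bullet> hdot h y"
  by (metis hdot_inner inner_commute pole_vec_def)

section \<open>Gradient, Hessian and sub-Laplacian of the kernel\<close>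

lemma sdist_has_derivative: "(sdist s y has_derivative (\<lambda>h. 2 * (pole_vec s y x \<bullet> h))) (at x)"
proof -
  have dh: "((\<lambda>x. hdot x y) has_derivative (\<lambda>h. hdot h y)) (at x)"
    using linear_hdot[of y, unfolded linear_conv_bounded_linear] by (rule bounded_linear_imp_has_derivative)
  have "((\<lambda>x. s\<^sup>2 - 2 * s * (x \<bullet> y) + hdot x y \<bullet> hdot x y) has_derivative (\<lambda>h. 2 * (pole_vec s y x \<bullet> h))) (at x)"
    by (auto intro!: derivative_eq_intros dh simp: fun_eq_iff inner_pole_vec inner_diff_left
        inner_commute[of q_one "hdot u v" for u v] inner_q_one_hdot inner_commute[of "hdot x y"] algebra_simps)
  then show ?thesis
    by (simp add: sdist_def[abs_def] power2_norm_eq_inner)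
qed

lemma pole_vec_has_derivative: "(pole_vec s y has_derivative (\<lambda>h. qact (hdot h y) y)) (at x)"
proof -
  have dh: "((\<lambda>x. hdot x y - s *\<^sub>R q_one) has_derivative (\<lambda>h. hdot h y)) (at x)"
    using linear_hdot[of y, unfolded linear_conv_bounded_linear]
    by (auto intro!: derivative_eq_intros bounded_linear_imp_has_derivative)
  have "((\<lambda>g. qact g y) has_derivative (\<lambda>g. qact g y)) (at z)" for z
    using linear_qact_left[of y, unfolded linear_conv_bounded_linear] by (rule bounded_linear_imp_has_derivative)
  from has_derivative_compose[OF dh this] show ?thesis
    by (simp add: pole_vec_def[abs_def])
qed

definition kgrad :: "nat \<Rightarrow> real \<Rightarrow> 'n::finite qspace \<Rightarrow> 'n qspace \<Rightarrow> 'n qspace"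
  where "kgrad m s y x = (- 2 * real m * kern (m + 1) s y x) *\<^sub>R pole_vec s y x"

definition kgrad' :: "nat \<Rightarrow> real \<Rightarrow> 'n::finite qspace \<Rightarrow> 'n qspace \<Rightarrow> 'n qspace \<Rightarrow> 'n qspace"
  where "kgrad' m s y x h = (4 * real m * (real m + 1) * kern (m + 2) s y x * (pole_vec s y x \<bullet> h)) *\<^sub>R pole_vec s y x
    - (2 * real m * kern (m + 1) s y x) *\<^sub>R qact (hdot h y) y"

lemma kern_has_derivative:
  assumes "sdist s y x \<noteq> 0"
  shows "(kern m s y has_derivative (\<lambda>h. kgrad m s y x \<bullet> h)) (at x)"
proof -
  have "(kern m s y has_derivative (\<lambda>h. real m * (- (inverse (sdist s y x) * (2 * (pole_vec s y x \<bullet> h)) * inverse (sdist s y x)))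
      * inverse (sdist s y x) ^ (m - 1))) (at x)"
    unfolding kern_def[abs_def]
    by (rule has_derivative_power[OF Deriv.has_derivative_inverse[OF assms sdist_has_derivative]])
  \<comment> \<open>For \<open>m = 0\<close> the exponent \<open>m - 1\<close> is truncated, but the
    factor \<open>real m\<close> annihilates both sides.\<close>
  moreover have "real m * (- (inverse (sdist s y x) * (2 * (pole_vec s y x \<bullet> h)) * inverse (sdist s y x)))
      * inverse (sdist s y x) ^ (m - 1) = kgrad m s y x \<bullet> h" for h
    by (cases m) (simp_all add: kgrad_def kern_def algebra_simps)
  ultimately show ?thesis by simp
qed

lemma kgrad_has_derivative:
  assumes "sdist s y x \<noteq> 0"
  shows "(kgrad m s y has_derivative kgrad' m s y x) (at x)"
proof -
  have "((\<lambda>x. (- 2 * real m * kern (m + 1) s y x) *\<^sub>R pole_vec s y x) has_derivative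
      (\<lambda>h. (- 2 * real m * kern (m + 1) s y x) *\<^sub>R qact (hdot h y) y
        + (- 2 * real m * (kgrad (m + 1) s y x \<bullet> h)) *\<^sub>R pole_vec s y x)) (at x)"
    by (intro has_derivative_scaleR has_derivative_mult_right kern_has_derivative pole_vec_has_derivative assms)
  moreover have "(- 2 * real m * kern (m + 1) s y x) *\<^sub>R qact (hdot h y) y
        + (- 2 * real m * (kgrad (m + 1) s y x \<bullet> h)) *\<^sub>R pole_vec s y x = kgrad' m s y x h" for h
    by (simp add: kgrad_def kgrad'_def algebra_simps)
  ultimately show ?thesis by (simp add: kgrad_def[abs_def])
qed

lemma continuous_on_sdist [continuous_intros]: "continuous_on S (sdist s y)"
  using sdist_has_derivative by (meson continuous_at_imp_continuous_on has_derivative_continuous)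

lemma continuous_on_kern:
  assumes "y \<in> sphere 0 1" "1 < s"
  shows "continuous_on (sphere 0 1) (kern m s y)"
  using kern_has_derivative sdist_pos[OF _ assms]
  by (metis continuous_at_imp_continuous_on has_derivative_continuous less_irrefl)

lemma kern_pos: "x \<in> sphere 0 1 \<Longrightarrow> y \<in> sphere 0 1 \<Longrightarrow> 1 < s \<Longrightarrow> 0 < kern m s y x"
  by (simp add: kern_def sdist_pos)

lemma kern_Suc: "x \<in> sphere 0 1 \<Longrightarrow> y \<in> sphere 0 1 \<Longrightarrow> 1 < s \<Longrightarrow> sdist s y x * kern (Suc m) s y x = kern m s y x"
  using sdist_pos[of x y s] by (simp add: kern_def)

lemma continuous_on_kgrad':
  assumes "y \<in> sphere 0 1" "1 < s"
  shows "continuous_on (sphere 0 1) (\<lambda>x. kgrad' m s y x v \<bullet> w)"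
proof -
  have "continuous_on (sphere 0 1) (pole_vec s y)"
    using pole_vec_has_derivative by (meson continuous_at_imp_continuous_on has_derivative_continuous)
  then show ?thesis
    unfolding kgrad'_def inner_diff_left inner_scaleR_left
    by (intro continuous_intros continuous_on_kern assms)
qed

lemma sum_Basis_inner_square: "(\<Sum>b\<in>Basis. (a \<bullet> b) * (a \<bullet> b)) = (norm a)\<^sup>2"
  by (simp add: power2_norm_eq_inner euclidean_inner[of a a, symmetric])

text \<open>A Hilbert-Schmidt norm may be computed from the adjoint map
  \<open>\<lambda>e. qact e y\<close>, whose domain has only the four basis vectors of the
  quaternions, each sent to a vector of norm \<open>norm y\<close>.\<close>

lemma sum_Basis_hdot:
  "(\<Sum>b\<in>(Basis :: 'n::finite qspace set). hdot b y \<bullet> hdot b y) = 4 * (norm y)\<^sup>2"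
proof -
  have "(\<Sum>b\<in>Basis. hdot b y \<bullet> hdot b y) = (\<Sum>b\<in>Basis. \<Sum>e\<in>Basis. (hdot b y \<bullet> e) * (hdot b y \<bullet> e))"
    by (intro sum.cong refl euclidean_inner)
  also have "\<dots> = (\<Sum>e\<in>Basis. \<Sum>b\<in>Basis. (qact e y \<bullet> b) * (qact e y \<bullet> b))"
  proof -
    have "hdot b y \<bullet> e = qact e y \<bullet> b" for b e by (metis hdot_inner inner_commute)
    then show ?thesis by (subst sum.swap) (simp only:)
  qed
  also have "\<dots> = (\<Sum>e\<in>(Basis::quat set). (norm y)\<^sup>2)"
    by (intro sum.cong refl) (simp only: sum_Basis_inner_square norm_qact norm_Basis mult_1)
  finally show ?thesis by simp
qed

text \<open>Parseval: the four quaternions \<open>qmult S h\<close> are pairwise orthogonal and all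
  have norm \<open>norm h\<close>.\<close>

lemma sum_hopf_inner_square:
  "(\<Sum>S\<in>{q_one, q_I, q_J, q_K}. (a \<bullet> qmult S h)\<^sup>2) = (norm a)\<^sup>2 * (norm h)\<^sup>2"
proof -
  have ne: "q_one \<noteq> q_I" "q_one \<noteq> q_J" "q_one \<noteq> q_K"
    by (simp_all add: q_one_def q_I_def q_J_def q_K_def complex_eq_iff)
  obtain a1 a2 a3 a4 h1 h2 h3 h4 where "a = (Complex a1 a2, Complex a3 a4)" "h = (Complex h1 h2, Complex h3 h4)"
    by (metis complex.exhaust surj_pair)
  then show ?thesis
    using ne hopf_units_distinct
    by (simp add: power2_norm_eq_inner qmult_def q_one_def q_I_def q_J_def q_K_def inner_complex_def)
       (simp add: power2_eq_square algebra_simps)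
qed

lemma trace_kgrad':
  assumes "sdist s y x \<noteq> 0" "norm y = 1"
  shows "(\<Sum>b\<in>Basis. kgrad' m s y x b \<bullet> b) = 4 * real m * (real m - 1) * kern (m + 1) s y x"
proof -
  have "norm (pole_vec s y x) ^ 2 = sdist s y x"
    by (simp add: pole_vec_def sdist_eq assms(2))
  then have 1: "(\<Sum>b\<in>Basis. (pole_vec s y x \<bullet> b) * (pole_vec s y x \<bullet> b)) = sdist s y x"
    by (simp add: sum_Basis_inner_square)
  have 2: "(\<Sum>b\<in>Basis. qact (hdot b y) y \<bullet> b) = 4"
    using sum_Basis_hdot[of y] assms(2) by (simp add: hdot_inner inner_commute)
  have "(\<Sum>b\<in>Basis. kgrad' m s y x b \<bullet> b)
     = 4 * real m * (real m + 1) * kern (m + 2) s y x * (\<Sum>b\<in>Basis. (pole_vec s y x \<bullet> b) * (pole_vec s y x \<bullet> b))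
       - 2 * real m * kern (m + 1) s y x * (\<Sum>b\<in>Basis. qact (hdot b y) y \<bullet> b)"
    unfolding kgrad'_def inner_diff_left sum_subtractf sum_distrib_left
    by (simp add: mult_ac)
  also have "\<dots> = 4 * real m * (real m - 1) * kern (m + 1) s y x"
    unfolding 1 2 using assms(1) by (simp add: kern_def field_simps)
  finally show ?thesis .
qed

lemma kgrad'_qact:
  "kgrad' m s y x (qact S x) \<bullet> qact S x = 4 * real m * (real m + 1) * kern (m + 2) s y x
     * ((hdot x y - s *\<^sub>R q_one) \<bullet> qmult S (hdot x y))\<^sup>2
     - 2 * real m * kern (m + 1) s y x * (norm S * norm (hdot x y))\<^sup>2"
proof -
  have "qact (hdot (qact S x) y) y \<bullet> qact S x = hdot (qact S x) y \<bullet> hdot (qact S x) y"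
    by (simp only: hdot_inner inner_commute)
  then have "qact (hdot (qact S x) y) y \<bullet> qact S x = (norm S * norm (hdot x y))\<^sup>2"
    by (simp add: hdot_qact norm_qmult flip: power2_norm_eq_inner)
  moreover define c where "c = (hdot x y - s *\<^sub>R q_one) \<bullet> qmult S (hdot x y)"
  moreover have "pole_vec s y x \<bullet> qact S x = c"
    by (simp only: c_def inner_pole_vec hdot_qact)
  ultimately show ?thesis
    unfolding kgrad'_def inner_diff_left[of "scaleR u v" for u v] inner_scaleR_left c_def[symmetric]
    by (simp add: power2_eq_square)
qed

lemma kgrad_inner: "kgrad m s y x \<bullet> x = - 2 * real m * kern (m + 1) s y x * ((norm (hdot x y))\<^sup>2 - s * (x \<bullet> y))"
  by (simp add: kgrad_def inner_pole_vec inner_diff_left inner_commute[of q_one "hdot u v" for u v] inner_q_one_hdot power2_norm_eq_inner)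

text \<open>By Parseval the four squares coming from the Hessian add up to a multiple of
  \<open>sdist\<close>, just as the trace does. This lowers \<open>kern (m + 2)\<close> to
  \<open>kern (m + 1)\<close>, so that only one power remains.\<close>

lemma sub_laplacian_kern_formula:
  fixes x y :: "'n::finite qspace"
  assumes "sdist s y x \<noteq> 0" "norm y = 1"
  shows "(\<Sum>b\<in>Basis. kgrad' m s y x b \<bullet> b)
    - (\<Sum>S\<in>{q_one, q_I, q_J, q_K}. kgrad' m s y x (qact S x) \<bullet> qact S x) - 4 * real CARD('n) * (kgrad m s y x \<bullet> x)
    = 4 * real m * kern (m + 1) s y x * ((real m - 1) * (1 - (norm (hdot x y))\<^sup>2)
      + 2 * real CARD('n) * ((norm (hdot x y))\<^sup>2 - s * (x \<bullet> y)))"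
proof -
  have ne: "q_one \<noteq> q_I" "q_one \<noteq> q_J" "q_one \<noteq> q_K"
    by (simp_all add: q_one_def q_I_def q_J_def q_K_def complex_eq_iff)
  have "(\<Sum>S\<in>{q_one, q_I, q_J, q_K}. kgrad' m s y x (qact S x) \<bullet> qact S x)
      = 4 * real m * (real m + 1) * kern (m + 2) s y x
          * (\<Sum>S\<in>{q_one, q_I, q_J, q_K}. ((hdot x y - s *\<^sub>R q_one) \<bullet> qmult S (hdot x y))\<^sup>2)
        - 8 * real m * kern (m + 1) s y x * (norm (hdot x y))\<^sup>2"
    unfolding kgrad'_qact sum_subtractf sum_distrib_left[symmetric]
    using ne hopf_units_distinct by (simp add: algebra_simps)
  also have "\<dots> = 4 * real m * (real m - 1) * kern (m + 1) s y x * (norm (hdot x y))\<^sup>2"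
    unfolding sum_hopf_inner_square sdist_eq[symmetric] using assms(1) by (simp add: kern_def field_simps)
  finally show ?thesis
    unfolding trace_kgrad'[OF assms] kgrad_inner by (simp add: algebra_simps)
qed

text \<open>For \<open>m = n + 1\<close> the bracket of \<open>sub_laplacian_kern_formula\<close> is
  n times \<open>1 + (norm (hdot x y))\<^sup>2 - 2 * s * (x \<bullet> y)\<close>, which is n times
  \<open>sdist s y x - (s\<^sup>2 - 1)\<close>. This is the origin of the exponent n + 1 and of the
  constant 4n(n + 1).\<close>

lemma sub_laplacian_kern:
  fixes x y :: "'n::finite qspace"
  assumes "x \<in> sphere 0 1" "y \<in> sphere 0 1" "1 < s" "n = CARD('n)"
  shows "sub_laplacian (kern (n + 1) s y) x
    = 4 * real n * (real n + 1) * (kern (n + 1) s y x - (s\<^sup>2 - 1) * kern (n + 2) s y x)"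
proof -
  have "sub_laplacian (kern (n + 1) s y) x = (\<Sum>b\<in>Basis. kgrad' (n + 1) s y x b \<bullet> b)
    - (\<Sum>S\<in>{q_one, q_I, q_J, q_K}. kgrad' (n + 1) s y x (qact S x) \<bullet> qact S x)
    - 4 * real CARD('n) * (kgrad (n + 1) s y x \<bullet> x)"
    using sdist_pos[OF _ assms(2,3)]
    by (intro sub_laplacian_eq kern_has_derivative kgrad_has_derivative assms) (auto simp: less_imp_neq[THEN not_sym])
  also have "\<dots> = 4 * real (n + 1) * kern (n + 2) s y x * (real n * (1 - (norm (hdot x y))\<^sup>2)
      + 2 * real n * ((norm (hdot x y))\<^sup>2 - s * (x \<bullet> y)))"
    using sdist_pos[OF assms(1-3)] assms(2,4) by (subst sub_laplacian_kern_formula) auto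
  also have "\<dots> = 4 * real n * (real n + 1) * kern (n + 2) s y x * (sdist s y x - (s\<^sup>2 - 1))"
    by (simp add: sdist_def algebra_simps)
  also have "\<dots> = 4 * real n * (real n + 1) * (kern (n + 1) s y x - (s\<^sup>2 - 1) * kern (n + 2) s y x)"
    using kern_Suc[OF assms(1-3), of "n + 1"] by (simp add: algebra_simps)
  finally show ?thesis .
qed

lemma smooth_on_sphere_kern:
  fixes y :: "'n::finite qspace"
  assumes "y \<in> sphere 0 1" "1 < s"
  shows "smooth_on_sphere (kern m s y)"
  unfolding smooth_on_sphere_def
proof
  fix k
  have op: "open (- {0 :: 'n qspace})" by (rule open_Compl) simp
  \<comment> \<open>The composite is written through linear functions and
    \<open>inverse (norm x)\<close> only, for which the closure rules of \<open>C_k_on\<close> are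
    available.\<close>
  have eq: "sdist s y (sgn x) = s\<^sup>2 + ((- 2 * s) * ((x \<bullet> y) * inverse (norm x))
      + (\<Sum>b\<in>Basis. (x \<bullet> qact b y) ^ 2) * inverse (norm x) ^ 2)" for x
  proof -
    have "hdot (sgn x) y = inverse (norm x) *\<^sub>R hdot x y"
      using linear_cmul[OF linear_hdot[of y], of "inverse (norm x)" x] by (simp add: sgn_div_norm)
    then have "(norm (hdot (sgn x) y))\<^sup>2 = (norm (hdot x y))\<^sup>2 * inverse (norm x) ^ 2"
      by (simp add: power_mult_distrib mult.commute)
    also have "(norm (hdot x y))\<^sup>2 = (\<Sum>b\<in>Basis. (x \<bullet> qact b y) ^ 2)"
      unfolding sum_Basis_inner_square[symmetric] by (simp only: hdot_inner power2_eq_square)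
    finally show ?thesis
      by (simp add: sdist_def sgn_div_norm mult_ac)
  qed
  have "C_k_on k (- {0}) (\<lambda>x. sdist s y (sgn x))"
    unfolding eq
    by (intro C_k_on_add C_k_on_mult C_k_on_const C_k_on_power C_k_on_sum C_k_on_inverse_norm
        C_k_on_linear bounded_linear_inner_left op)
  moreover have "sdist s y (sgn x) \<noteq> 0" if "x \<noteq> 0" for x
    using sdist_pos[OF _ assms, of "sgn x"] that by (simp add: norm_sgn)
  ultimately show "C_k_on k (- {0}) (\<lambda>x. kern m s y (sgn x))"
    unfolding kern_def by (intro C_k_on_power C_k_on_inverse op) auto
qed

section \<open>Integral identities for the kernel\<close>

lemma inner_qact_hopf:
  assumes "S \<in> {q_I, q_J, q_K}"
  shows "qact S x \<bullet> z = - (x \<bullet> qact S z)"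
proof -
  have "qmult S a \<bullet> b = - (a \<bullet> qmult S b)" for a b
    using assms by (auto simp: q_I_def q_J_def q_K_def qmult_def inner_prod_def inner_complex_def)
  then show ?thesis by (simp add: inner_qspace qact_def sum_negf)
qed

lemma qact_hopf_square:
  assumes "S \<in> {q_I, q_J, q_K}"
  shows "qact S (qact S x) = - x"
  by (simp add: qact_qmult qmult_hopf[OF assms] linear_neg[OF linear_qact_left])

lemma integral_hopf:
  fixes g :: "'n::finite qspace \<Rightarrow> 'n qspace"
  assumes S: "S \<in> {q_I, q_J, q_K}"
    and g: "\<And>x. x \<in> sphere 0 1 \<Longrightarrow> (g has_derivative g' x) (at x)"
    and g': "\<And>v w. continuous_on (sphere 0 1) (\<lambda>x. g' x v \<bullet> w)"
  shows "continuous_on (sphere 0 1) (\<lambda>x. g' x (qact S x) \<bullet> qact S x - g x \<bullet> x)"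
    and "(\<integral>x. g' x (qact S x) \<bullet> qact S x - g x \<bullet> x \<partial>sphere_measure) = 0"
proof -
  have "qact S (qact S (qact S x)) = - qact S x" for x :: "'n qspace"
    by (rule qact_hopf_square[OF S])
  from integral_skew_second_derivative[OF linear_qact inner_qact_hopf[OF S] this g g']
  show "continuous_on (sphere 0 1) (\<lambda>x. g' x (qact S x) \<bullet> qact S x - g x \<bullet> x)"
    and "(\<integral>x. g' x (qact S x) \<bullet> qact S x - g x \<bullet> x \<partial>sphere_measure) = 0"
    by (simp_all add: qact_hopf_square[OF S])
qed

lemma integral_sub_laplacian:
  fixes f :: "'n::finite qspace \<Rightarrow> real"
  assumes f: "\<And>x. x \<in> sphere 0 1 \<Longrightarrow> (f has_derivative (\<lambda>h. g x \<bullet> h)) (at x)"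
    and g: "\<And>x. x \<in> sphere 0 1 \<Longrightarrow> (g has_derivative g' x) (at x)"
    and g': "\<And>v w. continuous_on (sphere 0 1) (\<lambda>x. g' x v \<bullet> w)"
  shows "integral\<^sup>L sphere_measure (sub_laplacian f) = 0"
proof -
  define u where "u x = (\<Sum>b\<in>Basis. g' x b \<bullet> b) - g' x x \<bullet> x - (real DIM('n qspace) - 1) * (g x \<bullet> x)" for x
  define v where "v S x = g' x (qact S x) \<bullet> qact S x - g x \<bullet> x" for S x
  have gc: "continuous_on (sphere 0 1) g"
    using g by (meson continuous_at_imp_continuous_on has_derivative_continuous)
  have lin: "linear (g' x)" if "x \<in> sphere 0 1" for x
    using g[OF that] by (rule has_derivative_linear)
  have gxx: "continuous_on (sphere 0 1) (\<lambda>x. g' x x \<bullet> x)"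
    by (rule continuous_on_bilinear_expand[OF lin g' continuous_on_id continuous_on_id])
  have "continuous_on (sphere 0 1) u"
    unfolding u_def
    by (intro continuous_on_diff continuous_on_sum g' gxx continuous_on_mult continuous_on_const
        continuous_on_inner[OF gc continuous_on_id])
  then have u: "integrable sphere_measure u" by (rule integrable_sphere_measure)
  have u0: "integral\<^sup>L sphere_measure u = 0"
    unfolding u_def by (rule integral_sphere_laplacian[OF _ g']) (rule g)
  have v: "integrable sphere_measure (v S)" "integral\<^sup>L sphere_measure (v S) = 0" if "S \<in> {q_I, q_J, q_K}" for S
    unfolding v_def
    by (rule integrable_sphere_measure, rule integral_hopf[OF that _ g'], rule g, assumption)
       (rule integral_hopf[OF that _ g'], rule g)
  have "sub_laplacian f x = u x - (v q_I x + v q_J x + v q_K x)" if x: "x \<in> sphere 0 1" for x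
  proof -
    have ne: "q_one \<noteq> q_I" "q_one \<noteq> q_J" "q_one \<noteq> q_K"
      by (simp_all add: q_one_def q_I_def q_J_def q_K_def complex_eq_iff)
    have "sub_laplacian f x = (\<Sum>b\<in>Basis. g' x b \<bullet> b)
      - (\<Sum>S\<in>{q_one, q_I, q_J, q_K}. g' x (qact S x) \<bullet> qact S x) - 4 * real CARD('n) * (g x \<bullet> x)"
      by (rule sub_laplacian_eq[OF _ _ x]) (rule f g, assumption)+
    then show ?thesis
      unfolding u_def v_def using ne hopf_units_distinct by (simp add: algebra_simps)
  qed
  then have "integral\<^sup>L sphere_measure (sub_laplacian f) = (\<integral>x. u x - (v q_I x + v q_J x + v q_K x) \<partial>sphere_measure)"
    by (intro Bochner_Integration.integral_cong) auto
  also have "\<dots> = 0"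
    using u u0 v by simp
  finally show ?thesis .
qed

lemma sdist_nonzero: "x \<in> sphere 0 1 \<Longrightarrow> y \<in> sphere 0 1 \<Longrightarrow> 1 < s \<Longrightarrow> sdist s y x \<noteq> 0"
  using sdist_pos[of x y s] by simp

lemma integrable_kern: "y \<in> sphere 0 1 \<Longrightarrow> 1 < s \<Longrightarrow> integrable sphere_measure (kern m s y)"
  by (intro integrable_sphere_measure continuous_on_kern)

text \<open>Integration of \<open>sub_laplacian_kern\<close>, whose left side has integral zero. It
  links the masses for the exponents n + 1 and n + 2 and thereby relates the approximate identity to
  the Green function.\<close>

lemma integral_kern_step:
  fixes y :: "'n::finite qspace"
  assumes y: "y \<in> sphere 0 1" and s: "1 < s" and n: "n = CARD('n)"
  shows "(s\<^sup>2 - 1) * integral\<^sup>L sphere_measure (kern (n + 2) s y) = integral\<^sup>L sphere_measure (kern (n + 1) s y)"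
proof -
  have "0 = integral\<^sup>L sphere_measure (sub_laplacian (kern (n + 1) s y))"
    by (rule integral_sub_laplacian[symmetric, OF kern_has_derivative kgrad_has_derivative continuous_on_kgrad'[OF y s]])
       (erule sdist_nonzero[OF _ y s])+
  also have "\<dots> = (\<integral>x. 4 * real n * (real n + 1) * (kern (n + 1) s y x - (s\<^sup>2 - 1) * kern (n + 2) s y x) \<partial>sphere_measure)"
    by (intro Bochner_Integration.integral_cong refl sub_laplacian_kern y s n) simp
  also have "\<dots> = 4 * real n * (real n + 1) * (integral\<^sup>L sphere_measure (kern (n + 1) s y)
      - (s\<^sup>2 - 1) * integral\<^sup>L sphere_measure (kern (n + 2) s y))"
    using y s by (simp add: integrable_kern)
  finally show ?thesis using n by simp
qed

text \<open>The squares of the three Hopf fields, applied to \<open>kern m s y\<close>, have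
  integral zero by themselves. Only their sum, not a single one, depends on \<open>x\<close> through
  \<open>x \<bullet> y\<close> and \<open>sdist\<close> alone, so the three are added.\<close>

lemma integral_kern_rotation:
  fixes y :: "'n::finite qspace"
  assumes y: "y \<in> sphere 0 1" and s: "1 < s" and m: "0 < m"
  shows "2 * (real m + 1) * s * (\<integral>x. kern (m + 1) s y x - (s - x \<bullet> y)\<^sup>2 * kern (m + 2) s y x \<partial>sphere_measure)
    = 3 * (\<integral>x. (x \<bullet> y) * kern (m + 1) s y x \<partial>sphere_measure)"
proof -
  define v where "v S x = kgrad' m s y x (qact S x) \<bullet> qact S x - kgrad m s y x \<bullet> x" for S x
  define w where "w x = kern (m + 1) s y x - (s - x \<bullet> y)\<^sup>2 * kern (m + 2) s y x" for x
  have v: "integrable sphere_measure (v S)" "integral\<^sup>L sphere_measure (v S) = 0" if "S \<in> {q_I, q_J, q_K}" for S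
    unfolding v_def
    by (rule integrable_sphere_measure,
        rule integral_hopf[OF that kgrad_has_derivative continuous_on_kgrad'[OF y s]], erule sdist_nonzero[OF _ y s])
       (rule integral_hopf[OF that kgrad_has_derivative continuous_on_kgrad'[OF y s]], erule sdist_nonzero[OF _ y s])
  have iw: "integrable sphere_measure w"
    unfolding w_def by (intro integrable_sphere_measure continuous_intros continuous_on_kern y s)
  have ir: "integrable sphere_measure (\<lambda>x. (x \<bullet> y) * kern (m + 1) s y x)"
    by (intro integrable_sphere_measure continuous_intros continuous_on_kern y s)
  have eq: "v q_I x + v q_J x + v q_K x
      = 4 * real m * (real m + 1) * s\<^sup>2 * w x - 6 * real m * s * ((x \<bullet> y) * kern (m + 1) s y x)"
    if x: "x \<in> sphere 0 1" for x
  proof -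
    have ne: "q_one \<noteq> q_I" "q_one \<noteq> q_J" "q_one \<noteq> q_K"
      by (simp_all add: q_one_def q_I_def q_J_def q_K_def complex_eq_iff)
    define h where "h = hdot x y"
    define r where "r = sdist s y x"
    have r: "r = s\<^sup>2 - 2 * s * (x \<bullet> y) + (norm h)\<^sup>2" by (simp add: r_def sdist_def h_def)
    have "(\<Sum>S\<in>{q_one, q_I, q_J, q_K}. ((h - s *\<^sub>R q_one) \<bullet> qmult S h)\<^sup>2) = r * (norm h)\<^sup>2"
      by (simp only: sum_hopf_inner_square r_def sdist_eq h_def)
    moreover have "(h - s *\<^sub>R q_one) \<bullet> h = (norm h)\<^sup>2 - s * (x \<bullet> y)"
      by (simp add: inner_diff_left h_def inner_commute[of q_one "hdot u v" for u v] inner_q_one_hdot power2_norm_eq_inner)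
    ultimately have sq: "((h - s *\<^sub>R q_one) \<bullet> qmult q_I h)\<^sup>2 + ((h - s *\<^sub>R q_one) \<bullet> qmult q_J h)\<^sup>2
        + ((h - s *\<^sub>R q_one) \<bullet> qmult q_K h)\<^sup>2 = r * (norm h)\<^sup>2 - ((norm h)\<^sup>2 - s * (x \<bullet> y))\<^sup>2"
      using ne hopf_units_distinct by (simp del: inner_diff_left)
    \<comment> \<open>Both sides are \<open>s\<^sup>2\<close> times the squared norm of the
      imaginary part of \<open>h\<close>.\<close>
    have sq2: "r * (norm h)\<^sup>2 - ((norm h)\<^sup>2 - s * (x \<bullet> y))\<^sup>2 = s\<^sup>2 * (r - (s - x \<bullet> y)\<^sup>2)"
      unfolding r by (simp add: power2_eq_square algebra_simps)
    have kr: "r * kern (m + 2) s y x = kern (m + 1) s y x"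
      using kern_Suc[OF x y s, of "m + 1"] by (simp add: r_def)
    have "v q_I x + v q_J x + v q_K x = 4 * real m * (real m + 1) * kern (m + 2) s y x
        * (((h - s *\<^sub>R q_one) \<bullet> qmult q_I h)\<^sup>2 + ((h - s *\<^sub>R q_one) \<bullet> qmult q_J h)\<^sup>2 + ((h - s *\<^sub>R q_one) \<bullet> qmult q_K h)\<^sup>2)
        - 6 * real m * s * ((x \<bullet> y) * kern (m + 1) s y x)"
      unfolding v_def kgrad'_qact kgrad_inner norm_quat_units h_def[symmetric]
      by (simp only: mult_1) (simp add: algebra_simps del: inner_diff_left)
    also have "\<dots> = 4 * real m * (real m + 1) * s\<^sup>2 * (r * kern (m + 2) s y x - (s - x \<bullet> y)\<^sup>2 * kern (m + 2) s y x)
        - 6 * real m * s * ((x \<bullet> y) * kern (m + 1) s y x)"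
      unfolding sq sq2 by (simp add: algebra_simps)
    finally show ?thesis unfolding w_def kr .
  qed
  have "0 = (\<integral>x. v q_I x + v q_J x + v q_K x \<partial>sphere_measure)"
    using v by simp
  also have "\<dots> = (\<integral>x. 4 * real m * (real m + 1) * s\<^sup>2 * w x - 6 * real m * s * ((x \<bullet> y) * kern (m + 1) s y x) \<partial>sphere_measure)"
    by (intro Bochner_Integration.integral_cong refl eq) simp
  also have "\<dots> = 4 * real m * (real m + 1) * s\<^sup>2 * integral\<^sup>L sphere_measure w
      - 6 * real m * s * (\<integral>x. (x \<bullet> y) * kern (m + 1) s y x \<partial>sphere_measure)"
    using iw ir by simp
  also have "\<dots> = 2 * real m * s * (2 * (real m + 1) * s * integral\<^sup>L sphere_measure w
      - 3 * (\<integral>x. (x \<bullet> y) * kern (m + 1) s y x \<partial>sphere_measure))"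
    by (simp add: power2_eq_square algebra_simps)
  finally show ?thesis using m s by (simp add: w_def[abs_def])
qed

section \<open>The total mass\<close>

text \<open>
  With \<open>z = s\<^sup>2 - 1\<close>, the total mass \<open>B\<close> of \<open>kern (n + 1) s y\<close> satisfies
  \<open>(s\<^sup>2 - 1) (B'' + 3 B' / s) = 4 n (n + 1) B\<close>. A polynomial solution is \<open>z P' (1 + 2 z)\<close> with the
  Legendre polynomial \<open>P\<close> of degree \<open>n\<close>; up to a factor 2 this is \<open>leg n z\<close>. The expansion at \<open>z = 0\<close> makes
  both the lowest and the leading coefficient explicit.
\<close>

definition leg_coeff :: "nat \<Rightarrow> nat \<Rightarrow> real"
  where "leg_coeff n k = real k * real (n choose k) * real ((n + k) choose k)"

definition leg :: "nat \<Rightarrow> real \<Rightarrow> real"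
  where "leg n z = (\<Sum>k\<le>n. leg_coeff n k * z ^ k)"

definition leg' :: "nat \<Rightarrow> real \<Rightarrow> real"
  where "leg' n z = (\<Sum>k\<le>n. leg_coeff n k * (real k * z ^ (k - 1)))"

definition leg'' :: "nat \<Rightarrow> real \<Rightarrow> real"
  where "leg'' n z = (\<Sum>k\<le>n. leg_coeff n k * (real k * (real (k - 1) * z ^ (k - 2))))"

lemma leg_coeff_0 [simp]: "leg_coeff n 0 = 0"
  by (simp add: leg_coeff_def)

lemma leg_coeff_1: "leg_coeff n 1 = real n * (real n + 1)"
  by (simp add: leg_coeff_def)

lemma leg_coeff_nonneg: "0 \<le> leg_coeff n k"
  by (simp add: leg_coeff_def)

text \<open>The two binomial coefficients change by factors with numerators n - k and n + k + 1,
  whose product is n(n + 1) - k(k + 1). The recursion is the differential equation read coefficient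
  by coefficient.\<close>

lemma leg_coeff_Suc:
  "real k * (real k + 1) * leg_coeff n (Suc k) = (real n * (real n + 1) - real k * (real k + 1)) * leg_coeff n k"
proof (cases "k \<le> n")
  case True
  have 1: "(real k + 1) * real (n choose Suc k) = (real n - real k) * real (n choose k)"
    using arg_cong[OF binomial_absorb_comp[of n k], of real] arg_cong[OF binomial_absorption[of k n], of real] True
    by (metis (no_types, lifting) Suc_times_binomial_eq add.commute binomial_absorption choose_reduce_nat
        of_nat_Suc of_nat_diff of_nat_mult Suc_times_binomial)
  have 2: "(real k + 1) * real ((n + Suc k) choose Suc k) = (real n + real k + 1) * real ((n + k) choose k)"
    using arg_cong[OF Suc_times_binomial_eq[of "n + k" k], of real] by (simp add: algebra_simps)
  have "real k * (real k + 1) * leg_coeff n (Suc k)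
      = real k * (((real k + 1) * real (n choose Suc k)) * ((real k + 1) * real ((n + Suc k) choose Suc k)))"
    by (simp add: leg_coeff_def algebra_simps)
  also have "\<dots> = (real n * (real n + 1) - real k * (real k + 1)) * leg_coeff n k"
    unfolding 1 2 by (simp add: leg_coeff_def algebra_simps)
  finally show ?thesis .
qed (simp add: leg_coeff_def binomial_eq_0)

lemma leg_has_derivative [derivative_intros]: "(leg n has_real_derivative leg' n z) (at z)"
  unfolding leg_def[abs_def] leg'_def
  by (intro DERIV_sum) (auto intro!: derivative_eq_intros)

lemma leg'_has_derivative [derivative_intros]: "(leg' n has_real_derivative leg'' n z) (at z)"
  unfolding leg'_def[abs_def] leg''_def
  by (intro DERIV_sum) (auto intro!: derivative_eq_intros simp: numeral_2_eq_2)

text \<open>This is the equation of the mass in the variable \<open>z\<close>. With V a function of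
  z = \<open>s\<^sup>2 - 1\<close>, the expression V'' + 3 V' / s formed with s-derivatives becomes
  4 ((z + 1) V'' + 2 V') with z-derivatives.\<close>

lemma leg_ode: "z * ((z + 1) * leg'' n z + 2 * leg' n z) = real n * (real n + 1) * leg n z"
proof -
  have 1: "z\<^sup>2 * leg'' n z = (\<Sum>k\<le>n. real k * (real k - 1) * leg_coeff n k * z ^ k)"
    unfolding leg''_def sum_distrib_left
  proof (intro sum.cong refl)
    fix k
    consider "k = 0" | "k = 1" | l where "k = Suc (Suc l)" by (metis One_nat_def not0_implies_Suc)
    then show "z\<^sup>2 * (leg_coeff n k * (real k * (real (k - 1) * z ^ (k - 2)))) = real k * (real k - 1) * leg_coeff n k * z ^ k"
      by cases (simp_all add: power2_eq_square)
  qed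
  have 2: "z * leg' n z = (\<Sum>k\<le>n. real k * leg_coeff n k * z ^ k)"
    unfolding leg'_def sum_distrib_left
  proof (intro sum.cong refl)
    fix k show "z * (leg_coeff n k * (real k * z ^ (k - 1))) = real k * leg_coeff n k * z ^ k"
      by (cases k) simp_all
  qed
  have 3: "z * leg'' n z = (\<Sum>k\<le>n. real k * (real k + 1) * leg_coeff n (Suc k) * z ^ k)"
  proof -
    have "z * leg'' n z = (\<Sum>k\<le>n. real k * (real k - 1) * leg_coeff n k * z ^ (k - 1))"
      unfolding leg''_def sum_distrib_left
    proof (intro sum.cong refl)
      fix k
      consider "k = 0" | "k = 1" | l where "k = Suc (Suc l)" by (metis One_nat_def not0_implies_Suc)
      then show "z * (leg_coeff n k * (real k * (real (k - 1) * z ^ (k - 2)))) = real k * (real k - 1) * leg_coeff n k * z ^ (k - 1)"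
        by cases simp_all
    qed
    \<comment> \<open>The added term is zero because \<open>n choose Suc n\<close> is; with it the
      index shift gives a sum up to \<open>n\<close>.\<close>
    also have "\<dots> = (\<Sum>k\<le>Suc n. real k * (real k - 1) * leg_coeff n k * z ^ (k - 1))"
      by (simp add: leg_coeff_def)
    also have "\<dots> = (\<Sum>k\<le>n. real (Suc k) * (real (Suc k) - 1) * leg_coeff n (Suc k) * z ^ k)"
      by (subst sum.atMost_Suc_shift) simp
    also have "\<dots> = (\<Sum>k\<le>n. real k * (real k + 1) * leg_coeff n (Suc k) * z ^ k)"
      by (simp add: algebra_simps)
    finally show ?thesis .
  qed
  have "z * ((z + 1) * leg'' n z + 2 * leg' n z) = z\<^sup>2 * leg'' n z + z * leg'' n z + 2 * (z * leg' n z)"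
    by (simp add: algebra_simps power2_eq_square)
  also have "\<dots> = (\<Sum>k\<le>n. (real k * (real k + 1) * leg_coeff n k + real k * (real k + 1) * leg_coeff n (Suc k)) * z ^ k)"
    unfolding 1 2 3 sum_distrib_left sum.distrib[symmetric] by (intro sum.cong refl) (simp add: algebra_simps)
  also have "\<dots> = real n * (real n + 1) * leg n z"
    unfolding leg_def sum_distrib_left leg_coeff_Suc by (intro sum.cong refl) (simp add: algebra_simps)
  finally show ?thesis .
qed

lemma leg_nonneg: "0 \<le> z \<Longrightarrow> 0 \<le> leg n z"
  unfolding leg_def by (intro sum_nonneg mult_nonneg_nonneg leg_coeff_nonneg) auto

lemma leg'_ge:
  assumes "0 < n" "0 \<le> z"
  shows "real n * (real n + 1) \<le> leg' n z"
proof -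
  have "leg_coeff n 1 * (real 1 * z ^ (1 - 1)) \<le> leg' n z"
    unfolding leg'_def
    by (rule member_le_sum) (use assms leg_coeff_nonneg in \<open>auto intro!: mult_nonneg_nonneg\<close>)
  then show ?thesis using leg_coeff_1 by simp
qed

lemma leg'_0: "0 < n \<Longrightarrow> leg' n 0 = real n * (real n + 1)"
proof -
  assume n: "0 < n"
  have "leg' n 0 = (\<Sum>k\<le>n. if k = 1 then leg_coeff n 1 else 0)"
    unfolding leg'_def by (intro sum.cong refl) (auto simp: power_0_left)
  then show ?thesis using n leg_coeff_1 by simp
qed

text \<open>There is no constant term, and \<open>z ^ k \<le> z\<close> for positive
  \<open>k\<close> on the unit interval. Hence the term of the Wronskian containing
  \<open>leg\<close> fades at s = 1.\<close>

lemma leg_le: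
  assumes "0 \<le> z" "z \<le> 1"
  shows "leg n z \<le> z * leg n 1"
  unfolding leg_def sum_distrib_left
proof (rule sum_mono)
  fix k
  show "leg_coeff n k * z ^ k \<le> z * (leg_coeff n k * 1 ^ k)"
  proof (cases k)
    case (Suc l)
    have "z ^ Suc l \<le> z" using assms by (simp add: mult_left_le power_le_one)
    from mult_left_mono[OF this leg_coeff_nonneg[of n k]] show ?thesis
      using Suc by (simp add: mult.commute)
  qed simp
qed

text \<open>Division by \<open>s ^ (2 * n)\<close> makes every summand a polynomial in
  \<open>inverse s\<close>, and only the leading one survives. The derivative has one degree less in
  z, whence the extra \<open>s\<^sup>2\<close>.\<close>

lemma tendsto_leg_at_top:
  "((\<lambda>s. leg n (s\<^sup>2 - 1) / s ^ (2 * n)) \<longlongrightarrow> leg_coeff n n) at_top"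
  "((\<lambda>s. leg' n (s\<^sup>2 - 1) * s\<^sup>2 / s ^ (2 * n)) \<longlongrightarrow> real n * leg_coeff n n) at_top"
proof -
  have lim: "((\<lambda>s::real. (1 - (inverse s)\<^sup>2) ^ i * ((inverse s)\<^sup>2) ^ j) \<longlongrightarrow> (1 - 0\<^sup>2) ^ i * (0\<^sup>2) ^ j) at_top" for i j :: nat
    by (intro tendsto_intros tendsto_inverse_0_at_top filterlim_ident)
  \<comment> \<open>With \<open>0 ^ 0 = 1\<close> exactly the summand \<open>k = n\<close> is
    left.\<close>
  have pick: "(\<Sum>k\<le>n. a k * ((1 - 0\<^sup>2) ^ b k * (0\<^sup>2) ^ (n - k))) = a n" for a :: "nat \<Rightarrow> real" and b :: "nat \<Rightarrow> nat"
  proof -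
    have "(\<Sum>k\<le>n. a k * ((1 - 0\<^sup>2) ^ b k * (0\<^sup>2) ^ (n - k))) = (\<Sum>k\<le>n. if k = n then a n else 0)"
      by (intro sum.cong refl) (auto simp: power_0_left)
    then show ?thesis by simp
  qed
  have pow: "(s\<^sup>2 - 1) ^ i * s ^ (2 * j) / s ^ (2 * (i + j + l)) = (1 - (inverse s)\<^sup>2) ^ i * ((inverse s)\<^sup>2) ^ l"
    if "s > 0" for s :: real and i j l
  proof -
    have "s\<^sup>2 - 1 = s\<^sup>2 * (1 - (inverse s)\<^sup>2)"
      using that by (simp add: field_simps)
    then have "(s\<^sup>2 - 1) ^ i = (s\<^sup>2) ^ i * (1 - (inverse s)\<^sup>2) ^ i"
      by (simp only: power_mult_distrib)
    then show ?thesis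
      using that by (simp add: power_add power_mult field_simps power_inverse)
        (simp add: power_mult[symmetric] mult.commute)
  qed
  have "((\<lambda>s. \<Sum>k\<le>n. leg_coeff n k * ((1 - (inverse s)\<^sup>2) ^ k * ((inverse s)\<^sup>2) ^ (n - k)))
      \<longlongrightarrow> (\<Sum>k\<le>n. leg_coeff n k * ((1 - 0\<^sup>2) ^ k * (0\<^sup>2) ^ (n - k)))) at_top"
    by (intro tendsto_sum tendsto_mult_left lim)
  then have l1: "((\<lambda>s. \<Sum>k\<le>n. leg_coeff n k * ((1 - (inverse s)\<^sup>2) ^ k * ((inverse s)\<^sup>2) ^ (n - k)))
      \<longlongrightarrow> leg_coeff n n) at_top" by (simp only: pick)
  have "\<forall>\<^sub>F s in at_top. (\<Sum>k\<le>n. leg_coeff n k * ((1 - (inverse s)\<^sup>2) ^ k * ((inverse s)\<^sup>2) ^ (n - k)))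
      = leg n (s\<^sup>2 - 1) / s ^ (2 * n)"
    using eventually_gt_at_top[of "0::real"]
  proof eventually_elim
    case (elim s)
    show ?case unfolding leg_def sum_divide_distrib
    proof (intro sum.cong refl)
      fix k assume "k \<in> {..n}"
      then have e: "(s\<^sup>2 - 1) ^ k / s ^ (2 * n) = (1 - (inverse s)\<^sup>2) ^ k * ((inverse s)\<^sup>2) ^ (n - k)"
        using pow[OF elim, of k 0 "n - k"] by simp
      show "leg_coeff n k * ((1 - (inverse s)\<^sup>2) ^ k * ((inverse s)\<^sup>2) ^ (n - k)) = leg_coeff n k * (s\<^sup>2 - 1) ^ k / s ^ (2 * n)"
        unfolding e[symmetric] by simp
    qed
  qed
  with l1 show "((\<lambda>s. leg n (s\<^sup>2 - 1) / s ^ (2 * n)) \<longlongrightarrow> leg_coeff n n) at_top"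
    by (rule Lim_transform_eventually)
  have "((\<lambda>s. \<Sum>k\<le>n. (real k * leg_coeff n k) * ((1 - (inverse s)\<^sup>2) ^ (k - 1) * ((inverse s)\<^sup>2) ^ (n - k)))
      \<longlongrightarrow> (\<Sum>k\<le>n. (real k * leg_coeff n k) * ((1 - 0\<^sup>2) ^ (k - 1) * (0\<^sup>2) ^ (n - k)))) at_top"
    by (intro tendsto_sum tendsto_mult_left lim)
  then have l2: "((\<lambda>s. \<Sum>k\<le>n. (real k * leg_coeff n k) * ((1 - (inverse s)\<^sup>2) ^ (k - 1) * ((inverse s)\<^sup>2) ^ (n - k)))
      \<longlongrightarrow> real n * leg_coeff n n) at_top" by (simp only: pick)
  have "\<forall>\<^sub>F s in at_top. (\<Sum>k\<le>n. (real k * leg_coeff n k) * ((1 - (inverse s)\<^sup>2) ^ (k - 1) * ((inverse s)\<^sup>2) ^ (n - k)))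
      = leg' n (s\<^sup>2 - 1) * s\<^sup>2 / s ^ (2 * n)"
    using eventually_gt_at_top[of "0::real"]
  proof eventually_elim
    case (elim s)
    show ?case unfolding leg'_def sum_divide_distrib sum_distrib_right
    proof (intro sum.cong refl)
      fix k assume k: "k \<in> {..n}"
      show "(real k * leg_coeff n k) * ((1 - (inverse s)\<^sup>2) ^ (k - 1) * ((inverse s)\<^sup>2) ^ (n - k))
          = leg_coeff n k * (real k * (s\<^sup>2 - 1) ^ (k - 1)) * s\<^sup>2 / s ^ (2 * n)"
      proof (cases k)
        case (Suc l)
        then have "l + 1 + (n - k) = n" using k by simp
        then have e: "(s\<^sup>2 - 1) ^ (k - 1) * s\<^sup>2 / s ^ (2 * n) = (1 - (inverse s)\<^sup>2) ^ (k - 1) * ((inverse s)\<^sup>2) ^ (n - k)"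
          using pow[OF elim, of "k - 1" 1 "n - k"] Suc by (simp only: diff_Suc_1 mult_1_right)
        show ?thesis unfolding e[symmetric] by simp
      qed simp
    qed
  qed
  with l2 show "((\<lambda>s. leg' n (s\<^sup>2 - 1) * s\<^sup>2 / s ^ (2 * n)) \<longlongrightarrow> real n * leg_coeff n n) at_top"
    by (rule Lim_transform_eventually)
qed

section \<open>The total mass as a function of the parameter\<close>

lemma kern_le:
  assumes "x \<in> sphere 0 1" "y \<in> sphere 0 1" "1 < a" "a \<le> s"
  shows "kern m s y x \<le> inverse ((a - 1)\<^sup>2) ^ m"
proof -
  have "(a - 1)\<^sup>2 \<le> (s - 1)\<^sup>2" using assms by (intro power_mono) auto
  also have "\<dots> \<le> sdist s y x" using assms by (intro sdist_bounds) auto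
  finally have "(a - 1)\<^sup>2 \<le> sdist s y x" .
  moreover have "0 < (a - 1)\<^sup>2" using assms by simp
  ultimately show ?thesis
    unfolding kern_def by (intro power_mono le_imp_inverse_le) (auto intro: order_trans[OF zero_le_power2] less_imp_le)
qed

lemma sdist_has_derivative_param: "((\<lambda>s. sdist s y x) has_real_derivative 2 * (s - x \<bullet> y)) (at s)"
  unfolding sdist_def by (auto intro!: derivative_eq_intros)

lemma kern_has_derivative_param:
  assumes "sdist s y x \<noteq> 0"
  shows "((\<lambda>s. kern m s y x) has_real_derivative - 2 * real m * ((s - x \<bullet> y) * kern (m + 1) s y x)) (at s)"
proof -
  have "((\<lambda>s. kern m s y x) has_real_derivative
      real m * inverse (sdist s y x) ^ (m - 1) * (- (inverse (sdist s y x) * (2 * (s - x \<bullet> y)) * inverse (sdist s y x)))) (at s)"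
    unfolding kern_def
    by (rule derivative_eq_intros sdist_has_derivative_param assms refl)+ (simp add: power_Suc0_right)
  then show ?thesis
    by (rule DERIV_cong) (cases m, simp_all add: kern_def algebra_simps)
qed

lemma square_mult_kern_le:
  assumes "x \<in> sphere 0 1" "y \<in> sphere 0 1" "1 < s"
  shows "(s - x \<bullet> y)\<^sup>2 * kern (m + 1) s y x \<le> kern m s y x"
  using mult_right_mono[OF sdist_ge_square[of s x y] less_imp_le[OF kern_pos[OF assms, of "m + 1"]]]
    kern_Suc[OF assms, of m] by simp

lemma integral_kern_derivatives:
  fixes y :: "'n::finite qspace"
  assumes y: "y \<in> sphere 0 1" and s\<^sub>0: "1 < s\<^sub>0"
  shows "((\<lambda>s. integral\<^sup>L sphere_measure (kern m s y)) has_real_derivative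
           - 2 * real m * (\<integral>x. (s\<^sub>0 - x \<bullet> y) * kern (m + 1) s\<^sub>0 y x \<partial>sphere_measure)) (at s\<^sub>0)" (is ?th1)
    and "((\<lambda>s. \<integral>x. (s - x \<bullet> y) * kern (m + 1) s y x \<partial>sphere_measure) has_real_derivative
           (\<integral>x. kern (m + 1) s\<^sub>0 y x - 2 * (real m + 1) * ((s\<^sub>0 - x \<bullet> y)\<^sup>2 * kern (m + 2) s\<^sub>0 y x) \<partial>sphere_measure)) (at s\<^sub>0)" (is ?th2)
proof -
  \<comment> \<open>The midpoint of 1 and \<open>s\<^sub>0\<close> keeps the parameters in
    \<open>T\<close> away from 1, which gives the kernels the common bound \<open>K\<close>.\<close>
  define a where "a = (1 + s\<^sub>0) / 2"
  define T where "T = {a<..<s\<^sub>0 + 1}"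
  have a: "1 < a" "a < s\<^sub>0" using s\<^sub>0 by (auto simp: a_def)
  define K where "K = inverse ((a - 1)\<^sup>2) ^ (m + 1)"
  have T: "open T" "s\<^sub>0 \<in> T" "convex T" and T1: "\<And>t. t \<in> T \<Longrightarrow> 1 < t" using a by (auto simp: T_def)
  have K: "0 \<le> kern (m + 1) t y x" "kern (m + 1) t y x \<le> K" if "t \<in> T" "x \<in> sphere 0 1" for t x
    using kern_le[OF that(2) y a(1), of t "m + 1"] that kern_pos[OF that(2) y T1[OF that(1)], of "m + 1"] by (auto simp: K_def T_def)
  have K0: "0 \<le> K" by (simp add: K_def)
  have rho: "\<bar>t - x \<bullet> y\<bar> \<le> s\<^sub>0 + 2" if "t \<in> T" "x \<in> sphere 0 1" for t x
    using inner_sphere(2)[OF that(2) y] that(1) a by (auto simp: T_def)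
  have b1: "\<bar>(t - x \<bullet> y) * kern (m + 1) t y x\<bar> \<le> (s\<^sub>0 + 2) * K" if "t \<in> T" "x \<in> sphere 0 1" for t x
    unfolding abs_mult using rho[OF that] K[OF that] s\<^sub>0 by (intro mult_mono) auto
  have "((\<lambda>s. integral\<^sup>L sphere_measure (kern m s y)) has_real_derivative
      (\<integral>x. - 2 * real m * ((s\<^sub>0 - x \<bullet> y) * kern (m + 1) s\<^sub>0 y x) \<partial>sphere_measure)) (at s\<^sub>0)"
  proof (rule has_real_derivative_integral[OF sphere_measure.finite_measure_axioms T,
        where h' = "\<lambda>s x. - 2 * real m * ((s - x \<bullet> y) * kern (m + 1) s y x)" and C = "2 * real m * ((s\<^sub>0 + 2) * K)"])
    fix t x assume t: "t \<in> T" and "x \<in> space (sphere_measure :: 'n qspace measure)"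
    then have x: "x \<in> sphere 0 1" by simp
    show "((\<lambda>s. kern m s y x) has_real_derivative - 2 * real m * ((t - x \<bullet> y) * kern (m + 1) t y x)) (at t)"
      by (rule kern_has_derivative_param[OF sdist_nonzero[OF x y T1[OF t]]])
    show "\<bar>- 2 * real m * ((t - x \<bullet> y) * kern (m + 1) t y x)\<bar> \<le> 2 * real m * ((s\<^sub>0 + 2) * K)"
      using mult_left_mono[OF b1[OF t x], of "2 * real m"] by (simp only: abs_mult) simp
  qed (rule integrable_kern[OF y T1])
  then show ?th1 by simp
  show ?th2
  proof (rule has_real_derivative_integral[OF sphere_measure.finite_measure_axioms T,
        where h = "\<lambda>s x. (s - x \<bullet> y) * kern (m + 1) s y x"
          and h' = "\<lambda>s x. kern (m + 1) s y x - 2 * (real m + 1) * ((s - x \<bullet> y)\<^sup>2 * kern (m + 2) s y x)"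
          and C = "K + 2 * (real m + 1) * K"])
    fix t assume t: "t \<in> T"
    show "integrable sphere_measure (\<lambda>x. (t - x \<bullet> y) * kern (m + 1) t y x)"
      by (intro integrable_sphere_measure continuous_intros continuous_on_kern y T1[OF t])
    fix x assume "x \<in> space (sphere_measure :: 'n qspace measure)"
    then have x: "x \<in> sphere 0 1" by simp
    have "((\<lambda>s. (s - x \<bullet> y) * kern (m + 1) s y x) has_real_derivative
        1 * kern (m + 1) t y x + (- 2 * real (m + 1) * ((t - x \<bullet> y) * kern (m + 1 + 1) t y x)) * (t - x \<bullet> y)) (at t)"
      by (rule DERIV_mult[OF _ kern_has_derivative_param[OF sdist_nonzero[OF x y T1[OF t]]]])
         (auto intro!: derivative_eq_intros)
    then show "((\<lambda>s. (s - x \<bullet> y) * kern (m + 1) s y x) has_real_derivative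
        kern (m + 1) t y x - 2 * (real m + 1) * ((t - x \<bullet> y)\<^sup>2 * kern (m + 2) t y x)) (at t)"
      by (rule DERIV_cong) (simp add: power2_eq_square algebra_simps)
    have "0 \<le> (t - x \<bullet> y)\<^sup>2 * kern (m + 2) t y x" "(t - x \<bullet> y)\<^sup>2 * kern (m + 2) t y x \<le> K"
      using square_mult_kern_le[OF x y T1[OF t], of "m + 1"] K[OF t x] kern_pos[OF x y T1[OF t], of "m + 2"]
      by (auto intro: order_trans)
    then have "\<bar>2 * (real m + 1) * ((t - x \<bullet> y)\<^sup>2 * kern (m + 2) t y x)\<bar> \<le> 2 * (real m + 1) * K"
      by (simp only: abs_mult abs_of_nonneg) (intro mult_left_mono, auto)
    then show "\<bar>kern (m + 1) t y x - 2 * (real m + 1) * ((t - x \<bullet> y)\<^sup>2 * kern (m + 2) t y x)\<bar> \<le> K + 2 * (real m + 1) * K"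
      using K[OF t x] by (smt (verit))
  qed
qed

text \<open>The left side is the derivative in \<open>s\<close> of the first moment on the right, by
  \<open>integral_kern_derivatives\<close>. The rotation identity eliminates the quadratic moment,
  so the mass and the first moment form a closed linear system.\<close>

lemma integral_kern_radial:
  fixes y :: "'n::finite qspace"
  assumes y: "y \<in> sphere 0 1" and s: "1 < s" and n: "n = CARD('n)"
  shows "(\<integral>x. kern (n + 2) s y x - 2 * (real n + 2) * ((s - x \<bullet> y)\<^sup>2 * kern (n + 3) s y x) \<partial>sphere_measure)
    = - 2 * real n * integral\<^sup>L sphere_measure (kern (n + 2) s y)
      - 3 / s * (\<integral>x. (s - x \<bullet> y) * kern (n + 2) s y x \<partial>sphere_measure)"
proof -
  have int: "integrable sphere_measure (kern (n + 2) s y)"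
    "integrable sphere_measure (\<lambda>x. (s - x \<bullet> y)\<^sup>2 * kern (n + 3) s y x)"
    "integrable sphere_measure (\<lambda>x. (x \<bullet> y) * kern (n + 2) s y x)"
    by (intro integrable_sphere_measure continuous_intros continuous_on_kern y s)+
  define K where "K = integral\<^sup>L sphere_measure (kern (n + 2) s y)"
  define Q where "Q = (\<integral>x. (s - x \<bullet> y)\<^sup>2 * kern (n + 3) s y x \<partial>sphere_measure)"
  define R where "R = (\<integral>x. (x \<bullet> y) * kern (n + 2) s y x \<partial>sphere_measure)"
  have "2 * (real n + 2) * s * (K - Q) = 3 * R"
    using integral_kern_rotation[OF y s, of "n + 1"] int
    by (simp add: K_def Q_def R_def numeral_3_eq_3 add.commute)
  then have Q: "2 * (real n + 2) * Q = 2 * (real n + 2) * K - 3 * R / s"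
    using s by (simp add: field_simps)
  have I: "(\<integral>x. (s - x \<bullet> y) * kern (n + 2) s y x \<partial>sphere_measure) = s * K - R"
    using int by (simp add: left_diff_distrib K_def R_def)
  have J: "(\<integral>x. kern (n + 2) s y x - 2 * (real n + 2) * ((s - x \<bullet> y)\<^sup>2 * kern (n + 3) s y x) \<partial>sphere_measure)
      = K - 2 * (real n + 2) * Q"
    using int by (simp add: K_def Q_def)
  show ?thesis
    unfolding I J K_def[symmetric] Q using s by (simp add: field_simps)
qed

text \<open>Let B be the mass, E the first moment and V(s) = \<open>leg n (s\<^sup>2 - 1)\<close>.
  Since B' = -2 (n + 1) E, the expression is \<open>s ^ 3 / 2\<close> times the Wronskian B V' - B'
  V in the variable s; \<open>s ^ 3\<close> is the integrating factor for the coefficient 3 /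
  s.\<close>

lemma kern_wronskian:
  fixes y :: "'n::finite qspace"
  assumes y: "y \<in> sphere 0 1" and n: "n = CARD('n)"
  obtains \<Omega> where "\<And>s. 1 < s \<Longrightarrow> s ^ 4 * integral\<^sup>L sphere_measure (kern (n + 1) s y) * leg' n (s\<^sup>2 - 1)
    + (real n + 1) * (s ^ 3 * (\<integral>x. (s - x \<bullet> y) * kern (n + 2) s y x \<partial>sphere_measure) * leg n (s\<^sup>2 - 1)) = \<Omega>"
proof -
  define B where "B s = integral\<^sup>L sphere_measure (kern (n + 1) s y)" for s
  define E where "E s = (\<integral>x. (s - x \<bullet> y) * kern (n + 2) s y x \<partial>sphere_measure)" for s
  define K where "K s = integral\<^sup>L sphere_measure (kern (n + 2) s y)" for s
  define W where "W s = s ^ 4 * B s * leg' n (s\<^sup>2 - 1) + (real n + 1) * (s ^ 3 * E s * leg n (s\<^sup>2 - 1))" for s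
  have dW: "(W has_real_derivative 0) (at s)" if s: "1 < s" for s
  proof -
    have dB: "(B has_real_derivative - 2 * (real n + 1) * E s) (at s)"
      using integral_kern_derivatives(1)[OF y s, of "n + 1"] by (simp add: B_def[abs_def] E_def algebra_simps)
    have dE: "(E has_real_derivative - 2 * real n * K s - 3 / s * E s) (at s)"
      using integral_kern_derivatives(2)[OF y s, of "n + 1"] integral_kern_radial[OF y s n]
      by (simp add: E_def[abs_def] K_def numeral_3_eq_3 add.commute)
    have dz: "((\<lambda>s. s\<^sup>2 - 1) has_real_derivative 2 * s) (at s)"
      by (auto intro!: derivative_eq_intros)
    have dl: "((\<lambda>s. leg n (s\<^sup>2 - 1)) has_real_derivative leg' n (s\<^sup>2 - 1) * (2 * s)) (at s)"
      by (rule DERIV_chain2[OF leg_has_derivative dz])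
    have dl': "((\<lambda>s. leg' n (s\<^sup>2 - 1)) has_real_derivative leg'' n (s\<^sup>2 - 1) * (2 * s)) (at s)"
      by (rule DERIV_chain2[OF leg'_has_derivative dz])
    have KB: "(s\<^sup>2 - 1) * K s = B s"
      unfolding K_def B_def by (rule integral_kern_step[OF y s n])
    define V V' V'' where "V = leg n (s\<^sup>2 - 1)" "V' = leg' n (s\<^sup>2 - 1)" "V'' = leg'' n (s\<^sup>2 - 1)"
    have z: "s\<^sup>2 - 1 \<noteq> 0" using s by (simp add: power2_eq_1_iff)
    have ode: "(s\<^sup>2 - 1) * (s\<^sup>2 * V'' + 2 * V') = real n * (real n + 1) * V"
      using leg_ode[of "s\<^sup>2 - 1" n] by (simp add: V_V'_V''_def)
    have "(W has_real_derivative
        ((4 * s ^ 3 * B s + s ^ 4 * (- 2 * (real n + 1) * E s)) * V' + s ^ 4 * B s * (V'' * (2 * s)))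
        + (real n + 1) * ((3 * s\<^sup>2 * E s + s ^ 3 * (- 2 * real n * K s - 3 / s * E s)) * V + s ^ 3 * E s * (V' * (2 * s)))) (at s)"
      unfolding W_def[abs_def] V_V'_V''_def
      by (rule derivative_eq_intros dB dE dl dl' refl)+ (simp add: algebra_simps)
    \<comment> \<open>All terms containing \<open>E s\<close> cancel. What remains vanishes because
      \<open>leg\<close> solves \<open>ode\<close> and the masses are linked by
      \<open>KB\<close>.\<close>
    moreover have "((4 * s ^ 3 * B s + s ^ 4 * (- 2 * (real n + 1) * E s)) * V' + s ^ 4 * B s * (V'' * (2 * s)))
        + (real n + 1) * ((3 * s\<^sup>2 * E s + s ^ 3 * (- 2 * real n * K s - 3 / s * E s)) * V + s ^ 3 * E s * (V' * (2 * s)))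
        = 2 * s ^ 3 * (B s * (s\<^sup>2 * V'' + 2 * V') - K s * (real n * (real n + 1) * V))"
    proof -
      have "s ^ 3 * (3 / s * E s) = 3 * s\<^sup>2 * E s" using s by (simp add: power3_eq_cube power2_eq_square)
      then have "s ^ 3 * (- 2 * real n * K s - 3 / s * E s) = - 2 * real n * s ^ 3 * K s - 3 * s\<^sup>2 * E s"
        by (simp only: right_diff_distrib) simp
      then show ?thesis by (simp add: algebra_simps power2_eq_square power3_eq_cube power4_eq_xxxx)
    qed
    moreover have "B s * (s\<^sup>2 * V'' + 2 * V') - K s * (real n * (real n + 1) * V) = 0"
      unfolding ode[symmetric] KB[symmetric] by (simp add: algebra_simps)
    ultimately show ?thesis by simp
  qed
  have "W s = W 2" if "1 < s" for s
  proof -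
    have "W constant_on {1<..}"
      using dW by (intro has_field_derivative_0_imp_constant_on) (auto intro: has_field_derivative_at_within)
    then show ?thesis using that unfolding constant_on_def by auto
  qed
  then show thesis by (intro that[of "W 2"]) (simp add: W_def B_def E_def)
qed

text \<open>Both bounds are independent of \<open>x\<close> and tend to 1 as s \<rightarrow>
  \<infinity>, so the scaled integrals tend to the volume of the sphere.\<close>

lemma kern_scaled_bounds:
  assumes x: "x \<in> sphere 0 1" and y: "y \<in> sphere 0 1" and s: "1 < s"
  shows "inverse ((1 + inverse s)\<^sup>2) ^ m \<le> s ^ (2 * m) * kern m s y x"
    and "s ^ (2 * m) * kern m s y x \<le> inverse ((1 - inverse s)\<^sup>2) ^ m"
proof -
  have eq: "s ^ (2 * m) * kern m s y x = inverse (sdist s y x / s\<^sup>2) ^ m"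
    unfolding kern_def power_mult power_mult_distrib[symmetric] by (simp add: divide_inverse mult.commute)
  have 1: "sdist s y x / s\<^sup>2 \<le> (1 + inverse s)\<^sup>2" "(1 - inverse s)\<^sup>2 \<le> sdist s y x / s\<^sup>2"
  proof -
    have "(s + 1)\<^sup>2 = (1 + inverse s)\<^sup>2 * s\<^sup>2" "(s - 1)\<^sup>2 = (1 - inverse s)\<^sup>2 * s\<^sup>2"
      using s by (simp_all add: power_mult_distrib[symmetric] field_simps)
    then show "sdist s y x / s\<^sup>2 \<le> (1 + inverse s)\<^sup>2" "(1 - inverse s)\<^sup>2 \<le> sdist s y x / s\<^sup>2"
      using sdist_bounds[OF x y, of s] s by (simp_all add: pos_divide_le_eq pos_le_divide_eq)
  qed
  have 2: "0 < sdist s y x / s\<^sup>2"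
    by (rule divide_pos_pos[OF sdist_pos[OF x y s]]) (use s in simp)
  have 3: "0 < (1 - inverse s)\<^sup>2"
    using s by simp
  show "inverse ((1 + inverse s)\<^sup>2) ^ m \<le> s ^ (2 * m) * kern m s y x"
    unfolding eq by (rule power_mono[OF le_imp_inverse_le[OF 1(1) 2]]) simp
  show "s ^ (2 * m) * kern m s y x \<le> inverse ((1 - inverse s)\<^sup>2) ^ m"
    unfolding eq by (rule power_mono[OF le_imp_inverse_le[OF 1(2) 3]]) (use 2 in \<open>simp only: inverse_nonnegative_iff_nonnegative less_imp_le\<close>)
qed

abbreviation sphere_vol :: "'n::finite itself \<Rightarrow> real"
  where "sphere_vol _ \<equiv> measure (sphere_measure :: 'n qspace measure) (sphere 0 1)"

lemma integral_sphere_const: "(\<integral>x. c \<partial>(sphere_measure :: 'a::euclidean_space measure)) = c * measure (sphere_measure :: 'a measure) (sphere 0 1)"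
  by simp

lemma integral_sphere_bounds:
  fixes f :: "'a::euclidean_space \<Rightarrow> real"
  assumes "continuous_on (sphere 0 1) f"
  shows "(\<And>x. x \<in> sphere 0 1 \<Longrightarrow> f x \<le> c) \<Longrightarrow> integral\<^sup>L sphere_measure f \<le> c * measure (sphere_measure :: 'a measure) (sphere 0 1)"
    and "(\<And>x. x \<in> sphere 0 1 \<Longrightarrow> c \<le> f x) \<Longrightarrow> c * measure (sphere_measure :: 'a measure) (sphere 0 1) \<le> integral\<^sup>L sphere_measure f"
  using integral_sphere_measure_mono[OF assms, of "\<lambda>_. c"] integral_sphere_measure_mono[OF _ assms, of "\<lambda>_. c"]
  by (auto simp: integral_sphere_const mult.commute)

lemma tendsto_integral_kern_at_top:
  fixes y :: "'n::finite qspace"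
  assumes y: "y \<in> sphere 0 1"
  shows "((\<lambda>s. s ^ (2 * m) * integral\<^sup>L sphere_measure (kern m s y)) \<longlongrightarrow> sphere_vol TYPE('n)) at_top"
    and "((\<lambda>s. s ^ (2 * m) * (inverse s * (\<integral>x. (s - x \<bullet> y) * kern m s y x \<partial>sphere_measure))) \<longlongrightarrow> sphere_vol TYPE('n)) at_top"
proof -
  \<comment> \<open>The exponent \<open>j\<close> is 0 for the mass and 1 for the first moment,
    whose additional factor \<open>inverse s * (s - x \<bullet> y)\<close> lies between
    \<open>1 - inverse s\<close> and \<open>1 + inverse s\<close>.\<close>
  have lo: "((\<lambda>s::real. (1 - inverse s) ^ j * inverse ((1 + inverse s)\<^sup>2) ^ m * sphere_vol TYPE('n)) \<longlongrightarrow> (1 - 0) ^ j * inverse ((1 + 0)\<^sup>2) ^ m * sphere_vol TYPE('n)) at_top" for j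
    by (intro tendsto_intros tendsto_inverse_0_at_top filterlim_ident) auto
  have hi: "((\<lambda>s::real. (1 + inverse s) ^ j * inverse ((1 - inverse s)\<^sup>2) ^ m * sphere_vol TYPE('n)) \<longlongrightarrow> (1 + 0) ^ j * inverse ((1 - 0)\<^sup>2) ^ m * sphere_vol TYPE('n)) at_top" for j
    by (intro tendsto_intros tendsto_inverse_0_at_top filterlim_ident) auto
  have ev: "\<forall>\<^sub>F s::real in at_top. 1 < s" by (rule eventually_gt_at_top)
  show "((\<lambda>s. s ^ (2 * m) * integral\<^sup>L sphere_measure (kern m s y)) \<longlongrightarrow> sphere_vol TYPE('n)) at_top"
  proof (rule tendsto_sandwich[OF _ _ lo[of 0, simplified] hi[of 0, simplified]])
    show "\<forall>\<^sub>F s in at_top. inverse ((1 + inverse s)\<^sup>2) ^ m * sphere_vol TYPE('n) \<le> s ^ (2 * m) * integral\<^sup>L sphere_measure (kern m s y)"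
      using ev
    proof eventually_elim
      case (elim s)
      have "inverse ((1 + inverse s)\<^sup>2) ^ m * sphere_vol TYPE('n) \<le> (\<integral>x. s ^ (2 * m) * kern m s y x \<partial>sphere_measure)"
        by (intro integral_sphere_bounds(2) continuous_intros continuous_on_kern y elim kern_scaled_bounds(1))
      then show ?case by simp
    qed
    show "\<forall>\<^sub>F s in at_top. s ^ (2 * m) * integral\<^sup>L sphere_measure (kern m s y) \<le> inverse ((1 - inverse s)\<^sup>2) ^ m * sphere_vol TYPE('n)"
      using ev
    proof eventually_elim
      case (elim s)
      have "(\<integral>x. s ^ (2 * m) * kern m s y x \<partial>sphere_measure) \<le> inverse ((1 - inverse s)\<^sup>2) ^ m * sphere_vol TYPE('n)"
        by (intro integral_sphere_bounds(1) continuous_intros continuous_on_kern y elim kern_scaled_bounds(2))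
      then show ?case by simp
    qed
  qed
  have rho: "1 - inverse s \<le> inverse s * (s - x \<bullet> y)" "inverse s * (s - x \<bullet> y) \<le> 1 + inverse s" "0 \<le> 1 - inverse s"
    if "1 < s" "x \<in> sphere 0 1" for s x
  proof -
    have e: "inverse s * (s - x \<bullet> y) = 1 - inverse s * (x \<bullet> y)"
      using that(1) by (simp add: right_diff_distrib)
    have "\<bar>inverse s * (x \<bullet> y)\<bar> \<le> inverse s * 1"
      unfolding abs_mult using inner_sphere(2)[OF that(2) y] that(1) by (intro mult_mono) auto
    then show "1 - inverse s \<le> inverse s * (s - x \<bullet> y)" "inverse s * (s - x \<bullet> y) \<le> 1 + inverse s"
      unfolding e by linarith+
    show "0 \<le> 1 - inverse s" using that(1) by (simp add: field_simps)
  qed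
  have scale: "(\<integral>x. (inverse s * (s - x \<bullet> y)) * (s ^ (2 * m) * kern m s y x) \<partial>sphere_measure)
      = s ^ (2 * m) * (inverse s * (\<integral>x. (s - x \<bullet> y) * kern m s y x \<partial>sphere_measure))" for s
  proof -
    have "(inverse s * (s - x \<bullet> y)) * (s ^ (2 * m) * kern m s y x)
        = s ^ (2 * m) * (inverse s * ((s - x \<bullet> y) * kern m s y x))" for x by (simp only: mult_ac)
    then show ?thesis by (simp only: integral_mult_right_zero)
  qed
  show "((\<lambda>s. s ^ (2 * m) * (inverse s * (\<integral>x. (s - x \<bullet> y) * kern m s y x \<partial>sphere_measure))) \<longlongrightarrow> sphere_vol TYPE('n)) at_top"
  proof (rule tendsto_sandwich[OF _ _ lo[of 1, simplified] hi[of 1, simplified]])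
    show "\<forall>\<^sub>F s in at_top. (1 - inverse s) * inverse ((1 + inverse s)\<^sup>2) ^ m * sphere_vol TYPE('n)
        \<le> s ^ (2 * m) * (inverse s * (\<integral>x. (s - x \<bullet> y) * kern m s y x \<partial>sphere_measure))"
      using ev
    proof eventually_elim
      case (elim s)
      have "(1 - inverse s) * inverse ((1 + inverse s)\<^sup>2) ^ m * sphere_vol TYPE('n)
          \<le> (\<integral>x. (inverse s * (s - x \<bullet> y)) * (s ^ (2 * m) * kern m s y x) \<partial>sphere_measure)"
      proof (intro integral_sphere_bounds(2) continuous_intros continuous_on_kern y elim)
        fix x :: "'n qspace" assume x: "x \<in> sphere 0 1"
        show "(1 - inverse s) * inverse ((1 + inverse s)\<^sup>2) ^ m \<le> (inverse s * (s - x \<bullet> y)) * (s ^ (2 * m) * kern m s y x)"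
          using rho[OF elim x] kern_scaled_bounds(1)[OF x y elim, of m] by (intro mult_mono) auto
      qed
      then show ?case unfolding scale .
    qed
    show "\<forall>\<^sub>F s in at_top. s ^ (2 * m) * (inverse s * (\<integral>x. (s - x \<bullet> y) * kern m s y x \<partial>sphere_measure))
        \<le> (1 + inverse s) * inverse ((1 - inverse s)\<^sup>2) ^ m * sphere_vol TYPE('n)"
      using ev
    proof eventually_elim
      case (elim s)
      have "(\<integral>x. (inverse s * (s - x \<bullet> y)) * (s ^ (2 * m) * kern m s y x) \<partial>sphere_measure)
          \<le> (1 + inverse s) * inverse ((1 - inverse s)\<^sup>2) ^ m * sphere_vol TYPE('n)"
      proof (intro integral_sphere_bounds(1) continuous_intros continuous_on_kern y elim)
        fix x :: "'n qspace" assume x: "x \<in> sphere 0 1"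
        show "(inverse s * (s - x \<bullet> y)) * (s ^ (2 * m) * kern m s y x) \<le> (1 + inverse s) * inverse ((1 - inverse s)\<^sup>2) ^ m"
          using rho[OF elim x] kern_scaled_bounds(2)[OF x y elim, of m] kern_pos[OF x y elim, of m] elim
          by (intro mult_mono) auto
      qed
      then show ?case unfolding scale .
    qed
  qed
qed

text \<open>The constant is read off at infinity: the powers of \<open>s\<close> balance in both
  summands, which contribute n and n + 1 times \<open>leg_coeff n n\<close> times the
  volume.\<close>

lemma kern_wronskian_value:
  fixes y :: "'n::finite qspace"
  assumes y: "y \<in> sphere 0 1" and n: "n = CARD('n)" and s: "1 < s"
  shows "s ^ 4 * integral\<^sup>L sphere_measure (kern (n + 1) s y) * leg' n (s\<^sup>2 - 1)
    + (real n + 1) * (s ^ 3 * (\<integral>x. (s - x \<bullet> y) * kern (n + 2) s y x \<partial>sphere_measure) * leg n (s\<^sup>2 - 1))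
    = (2 * real n + 1) * leg_coeff n n * sphere_vol TYPE('n)"
proof -
  define W where "W s = s ^ 4 * integral\<^sup>L sphere_measure (kern (n + 1) s y) * leg' n (s\<^sup>2 - 1)
    + (real n + 1) * (s ^ 3 * (\<integral>x. (s - x \<bullet> y) * kern (n + 2) s y x \<partial>sphere_measure) * leg n (s\<^sup>2 - 1))" for s
  obtain \<Omega> where \<Omega>: "\<And>s. 1 < s \<Longrightarrow> W s = \<Omega>"
    unfolding W_def using kern_wronskian[OF y n] by blast
  have "((\<lambda>s. (s ^ (2 * (n + 1)) * integral\<^sup>L sphere_measure (kern (n + 1) s y)) * (leg' n (s\<^sup>2 - 1) * s\<^sup>2 / s ^ (2 * n))
      + (real n + 1) * ((s ^ (2 * (n + 2)) * (inverse s * (\<integral>x. (s - x \<bullet> y) * kern (n + 2) s y x \<partial>sphere_measure)))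
        * (leg n (s\<^sup>2 - 1) / s ^ (2 * n)))) \<longlongrightarrow> sphere_vol TYPE('n) * (real n * leg_coeff n n)
      + (real n + 1) * (sphere_vol TYPE('n) * leg_coeff n n)) at_top"
    by (intro tendsto_intros tendsto_leg_at_top tendsto_integral_kern_at_top y)
  moreover have "\<forall>\<^sub>F s in at_top. (s ^ (2 * (n + 1)) * integral\<^sup>L sphere_measure (kern (n + 1) s y)) * (leg' n (s\<^sup>2 - 1) * s\<^sup>2 / s ^ (2 * n))
      + (real n + 1) * ((s ^ (2 * (n + 2)) * (inverse s * (\<integral>x. (s - x \<bullet> y) * kern (n + 2) s y x \<partial>sphere_measure)))
        * (leg n (s\<^sup>2 - 1) / s ^ (2 * n))) = \<Omega>"
    using eventually_gt_at_top[of "1::real"]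
  proof eventually_elim
    case (elim s)
    have 1: "s ^ (2 * (n + 1)) = s\<^sup>2 * s ^ (2 * n)" "s ^ (2 * (n + 2)) = s ^ 4 * s ^ (2 * n)"
    proof -
      have "2 * (n + 1) = 2 + 2 * n" "2 * (n + 2) = 4 + 2 * n" by simp_all
      then show "s ^ (2 * (n + 1)) = s\<^sup>2 * s ^ (2 * n)" "s ^ (2 * (n + 2)) = s ^ 4 * s ^ (2 * n)"
        by (simp_all only: power_add)
    qed
    have 2: "s ^ (2 * n) \<noteq> 0" "s \<noteq> 0" using elim by auto
    have a: "(s\<^sup>2 * c * u) * (v * s\<^sup>2 / c) = s ^ 4 * u * v" if "c \<noteq> 0" for c u v :: real
      using that by (simp add: power2_eq_square power4_eq_xxxx)
    have b: "(s ^ 4 * c * (inverse s * u)) * (v / c) = s ^ 3 * u * v" if "c \<noteq> 0" for c u v :: real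
      using that 2 by (simp add: power3_eq_cube power4_eq_xxxx)
    show ?case
      unfolding \<Omega>[OF elim, symmetric] W_def 1 a[OF 2(1)] b[OF 2(1)] ..
  qed
  ultimately have "((\<lambda>_. \<Omega>) \<longlongrightarrow> sphere_vol TYPE('n) * (real n * leg_coeff n n)
      + (real n + 1) * (sphere_vol TYPE('n) * leg_coeff n n)) (at_top :: real filter)"
    by (rule Lim_transform_eventually)
  then have "\<Omega> = sphere_vol TYPE('n) * (real n * leg_coeff n n) + (real n + 1) * (sphere_vol TYPE('n) * leg_coeff n n)"
    using tendsto_unique tendsto_const trivial_limit_at_top_linorder by blast
  then show ?thesis using \<Omega>[OF s] by (simp add: W_def algebra_simps)
qed

text \<open>Both summands of the conserved quantity are nonnegative. Dropping the second and using
  \<open>leg'_ge\<close> and \<open>s ^ 4 \<ge> 1\<close> leaves a bound that coincides with the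
  limit of the mass; this is why the approximate identity later has mass at most 1.\<close>

lemma integral_kern_le:
  fixes y :: "'n::finite qspace"
  assumes y: "y \<in> sphere 0 1" and n: "n = CARD('n)" and s: "1 < s"
  shows "integral\<^sup>L sphere_measure (kern (n + 1) s y)
    \<le> (2 * real n + 1) * leg_coeff n n * sphere_vol TYPE('n) / (real n * (real n + 1))"
proof -
  define B where "B = integral\<^sup>L sphere_measure (kern (n + 1) s y)"
  define E where "E = (\<integral>x. (s - x \<bullet> y) * kern (n + 2) s y x \<partial>sphere_measure)"
  have n0: "0 < n" using n by simp
  have z: "0 \<le> s\<^sup>2 - 1" using s by simp
  have B0: "0 \<le> B" unfolding B_def
    by (rule Bochner_Integration.integral_nonneg) (use kern_pos[OF _ y s] in \<open>auto intro: less_imp_le\<close>)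
  have "0 \<le> (s - x \<bullet> y) * kern (n + 2) s y x" if "x \<in> sphere 0 1" for x
    using kern_pos[OF that y s, of "n + 2"] inner_sphere(2)[OF that y] s by (intro mult_nonneg_nonneg) auto
  then have E0: "0 \<le> E" unfolding E_def
    by (intro Bochner_Integration.integral_nonneg) auto
  have "B * (real n * (real n + 1)) \<le> (s ^ 4 * B) * leg' n (s\<^sup>2 - 1)"
  proof (rule mult_mono)
    show "B \<le> s ^ 4 * B" using s B0 by (simp add: mult_le_cancel_right1)
  qed (use leg'_ge[OF n0 z] B0 s in auto)
  also have "\<dots> \<le> s ^ 4 * B * leg' n (s\<^sup>2 - 1) + (real n + 1) * (s ^ 3 * E * leg n (s\<^sup>2 - 1))"
    using E0 leg_nonneg[OF z] s by simp
  also have "\<dots> = (2 * real n + 1) * leg_coeff n n * sphere_vol TYPE('n)"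
    unfolding B_def E_def by (rule kern_wronskian_value[OF y n s])
  finally show ?thesis using n0 by (simp add: B_def pos_le_divide_eq)
qed

text \<open>The bound 5/4 keeps \<open>s\<^sup>2 - 1\<close> below 1, as \<open>leg_le\<close>
  requires.\<close>

lemma eventually_at_right_one: "\<forall>\<^sub>F s in at_right (1::real). 1 < s" "\<forall>\<^sub>F s in at_right (1::real). s < 5/4"
  using eventually_at_right[of "1::real" 2] by (auto simp: eventually_at_right_field intro: exI[of _ "5/4"])

lemma tendsto_square_minus_one: "((\<lambda>s::real. s\<^sup>2 - 1) \<longlongrightarrow> 0) (at_right 1)"
proof -
  have "((\<lambda>s::real. s\<^sup>2 - 1) \<longlongrightarrow> 1\<^sup>2 - 1) (at_right 1)" by (intro tendsto_intros)
  then show ?thesis by simp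
qed

text \<open>The weight \<open>s - x \<bullet> y\<close> is small where the mass concentrates. Where
  it is at most \<delta>, the factor \<open>s\<^sup>2 - 1\<close> and
  \<open>integral_kern_step\<close> leave \<delta> times a bounded mass; elsewhere the kernel is
  bounded independently of \<open>s\<close> and \<open>s\<^sup>2 - 1\<close> tends to 0.\<close>

lemma kern_moment_small:
  fixes n :: nat and e :: real
  assumes n: "n = CARD('n::finite)" and e: "0 < e"
  shows "\<forall>\<^sub>F s in at_right 1. \<forall>y\<in>sphere (0::'n qspace) 1.
    (s\<^sup>2 - 1) * (\<integral>x. (s - x \<bullet> y) * kern (n + 2) s y x \<partial>sphere_measure) < e"
proof -
  define B\<^sub>0 where "B\<^sub>0 = (2 * real n + 1) * leg_coeff n n * sphere_vol TYPE('n) / (real n * (real n + 1))"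
  have B0: "0 \<le> B\<^sub>0" unfolding B\<^sub>0_def by (intro divide_nonneg_nonneg mult_nonneg_nonneg leg_coeff_nonneg) auto
  define \<delta> where "\<delta> = e / (2 * (B\<^sub>0 + 1))"
  have \<delta>: "0 < \<delta>" "\<delta> * B\<^sub>0 < e / 2"
    using e B0 by (auto simp: \<delta>_def field_simps)
  define C where "C = 3 * inverse (\<delta>\<^sup>2) ^ (n + 2) * sphere_vol TYPE('n)"
  have "((\<lambda>s::real. (s\<^sup>2 - 1) * C) \<longlongrightarrow> 0 * C) (at_right 1)"
    by (intro tendsto_mult_right tendsto_square_minus_one)
  then have "\<forall>\<^sub>F s in at_right 1. (s\<^sup>2 - 1) * C < e / 2"
    using e by (intro order_tendstoD(2)[of _ "0 * C"]) auto
  then show ?thesis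
    using eventually_at_right_one
  proof eventually_elim
    case (elim s)
    show ?case
    proof
      fix y :: "'n qspace" assume y: "y \<in> sphere 0 1"
      have z: "0 \<le> s\<^sup>2 - 1" using elim by simp
      have c: "continuous_on (sphere 0 1) (\<lambda>x. (s - x \<bullet> y) * kern (n + 2) s y x)"
        "continuous_on (sphere 0 1) (\<lambda>x. \<delta> * kern (n + 2) s y x + 3 * inverse (\<delta>\<^sup>2) ^ (n + 2))"
        by (intro continuous_intros continuous_on_kern y elim)+
      have "(\<integral>x. (s - x \<bullet> y) * kern (n + 2) s y x \<partial>sphere_measure)
          \<le> (\<integral>x. \<delta> * kern (n + 2) s y x + 3 * inverse (\<delta>\<^sup>2) ^ (n + 2) \<partial>sphere_measure)"
      proof (rule integral_sphere_measure_mono[OF c])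
        fix x :: "'n qspace" assume x: "x \<in> sphere 0 1"
        have k0: "0 < kern (n + 2) s y x" by (rule kern_pos[OF x y elim(2)])
        have r: "0 \<le> s - x \<bullet> y" "s - x \<bullet> y \<le> 3" using inner_sphere(2)[OF x y] elim by auto
        show "(s - x \<bullet> y) * kern (n + 2) s y x \<le> \<delta> * kern (n + 2) s y x + 3 * inverse (\<delta>\<^sup>2) ^ (n + 2)"
        proof (cases "s - x \<bullet> y \<le> \<delta>")
          case True
          then have "(s - x \<bullet> y) * kern (n + 2) s y x \<le> \<delta> * kern (n + 2) s y x"
            using k0 by (intro mult_right_mono) auto
          moreover have "0 \<le> 3 * inverse (\<delta>\<^sup>2) ^ (n + 2)" using \<delta> by simp
          ultimately show ?thesis by linarith
        next
          case False
          then have "\<delta>\<^sup>2 \<le> (s - x \<bullet> y)\<^sup>2" using \<delta> by (intro power_mono) auto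
          then have "\<delta>\<^sup>2 \<le> sdist s y x" using sdist_ge_square[of s x y] by linarith
          then have "inverse (sdist s y x) \<le> inverse (\<delta>\<^sup>2)"
            by (rule le_imp_inverse_le) (use \<delta> in simp)
          then have "kern (n + 2) s y x \<le> inverse (\<delta>\<^sup>2) ^ (n + 2)"
            unfolding kern_def using sdist_pos[OF x y elim(2)] by (intro power_mono) auto
          then have "(s - x \<bullet> y) * kern (n + 2) s y x \<le> 3 * inverse (\<delta>\<^sup>2) ^ (n + 2)"
            using r k0 by (intro mult_mono) auto
          moreover have "0 \<le> \<delta> * kern (n + 2) s y x" using \<delta> k0 by simp
          ultimately show ?thesis by linarith
        qed
      qed
      also have "\<dots> = \<delta> * integral\<^sup>L sphere_measure (kern (n + 2) s y) + C"
        using y elim by (simp add: integrable_kern C_def)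
      finally have "(s\<^sup>2 - 1) * (\<integral>x. (s - x \<bullet> y) * kern (n + 2) s y x \<partial>sphere_measure)
          \<le> (s\<^sup>2 - 1) * (\<delta> * integral\<^sup>L sphere_measure (kern (n + 2) s y) + C)"
        using z by (rule mult_left_mono)
      also have "\<dots> = \<delta> * ((s\<^sup>2 - 1) * integral\<^sup>L sphere_measure (kern (n + 2) s y)) + (s\<^sup>2 - 1) * C"
        by (simp add: algebra_simps)
      also have "\<dots> \<le> \<delta> * B\<^sub>0 + (s\<^sup>2 - 1) * C"
        unfolding integral_kern_step[OF y elim(2) n] B\<^sub>0_def
        using \<delta> by (intro add_right_mono mult_left_mono integral_kern_le[OF y n elim(2)]) auto
      also have "\<dots> < e" using \<delta> elim by linarith
      finally show "(s\<^sup>2 - 1) * (\<integral>x. (s - x \<bullet> y) * kern (n + 2) s y x \<partial>sphere_measure) < e" .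
    qed
  qed
qed

text \<open>In the conserved identity the second summand is at most a constant times
  \<open>s\<^sup>2 - 1\<close> times the first moment, which vanishes in the limit by
  \<open>kern_moment_small\<close>. The factor of the mass in the first summand tends to
  \<open>leg' n 0\<close>, that is n(n + 1).\<close>

lemma integral_kern_limit:
  fixes n :: nat and e :: real
  assumes n: "n = CARD('n::finite)" and e: "0 < e"
  shows "\<forall>\<^sub>F s in at_right 1. \<forall>y\<in>sphere (0::'n qspace) 1.
    \<bar>integral\<^sup>L sphere_measure (kern (n + 1) s y)
      - (2 * real n + 1) * leg_coeff n n * sphere_vol TYPE('n) / (real n * (real n + 1))\<bar> < e"
proof -
  define \<Omega> where "\<Omega> = (2 * real n + 1) * leg_coeff n n * sphere_vol TYPE('n)"
  define c where "c = real n * (real n + 1)"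
  have n0: "0 < n" and c0: "0 < c" using n by (simp_all add: c_def)
  define D where "D s = s ^ 4 * leg' n (s\<^sup>2 - 1)" for s :: real
  \<comment> \<open>The 8 bounds \<open>s ^ 3\<close> for \<open>s < 2\<close>, and
    \<open>leg n 1\<close> comes from \<open>leg_le\<close>.\<close>
  define K where "K = (real n + 1) * (8 * leg n 1)"
  have K: "0 \<le> K" by (simp add: K_def leg_nonneg)
  have "isCont (leg' n) 0" using leg'_has_derivative by (rule DERIV_isCont)
  then have "((\<lambda>s. leg' n (s\<^sup>2 - 1)) \<longlongrightarrow> leg' n 0) (at_right 1)"
    by (rule isCont_tendsto_compose) (rule tendsto_square_minus_one)
  then have l: "((\<lambda>s. leg' n (s\<^sup>2 - 1)) \<longlongrightarrow> c) (at_right 1)"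
    unfolding leg'_0[OF n0] c_def .
  have "((\<lambda>s. \<Omega> / D s) \<longlongrightarrow> \<Omega> / (1 ^ 4 * c)) (at_right 1)"
    unfolding D_def
    by (intro tendsto_divide tendsto_mult tendsto_power tendsto_const l tendsto_ident_at) (use c0 in simp)
  then have "\<forall>\<^sub>F s in at_right 1. dist (\<Omega> / D s) (\<Omega> / c) < e / 2"
    using e by (intro tendstoD) auto
  moreover have "0 < e * c / (2 * (K + 1))" using e c0 K by simp
  note kern_moment_small[OF n this]
  ultimately show ?thesis
    using eventually_at_right_one
  proof eventually_elim
    case (elim s)
    show ?case
    proof
      fix y :: "'n qspace" assume y: "y \<in> sphere 0 1"
      define B where "B = integral\<^sup>L sphere_measure (kern (n + 1) s y)"
      define E where "E = (\<integral>x. (s - x \<bullet> y) * kern (n + 2) s y x \<partial>sphere_measure)"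
      have s2: "s\<^sup>2 \<le> (5/4)\<^sup>2" using elim by (intro power_mono) auto
      have s1: "1\<^sup>2 \<le> s\<^sup>2" using elim by (intro power_mono) auto
      have z: "0 \<le> s\<^sup>2 - 1" "s\<^sup>2 - 1 \<le> 1" using s1 s2 by (simp_all add: power_divide)
      have "0 \<le> (s - x \<bullet> y) * kern (n + 2) s y x" if "x \<in> sphere 0 1" for x
        using kern_pos[OF that y elim(3), of "n + 2"] inner_sphere(2)[OF that y] elim by (intro mult_nonneg_nonneg) auto
      then have E0: "0 \<le> E" unfolding E_def
        by (intro Bochner_Integration.integral_nonneg) auto
      have Dc: "c \<le> D s"
      proof -
        have "1 * c \<le> s ^ 4 * leg' n (s\<^sup>2 - 1)"
          using leg'_ge[OF n0 z(1)] elim c0 unfolding c_def by (intro mult_mono) auto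
        then show ?thesis by (simp add: D_def)
      qed
      have "D s * B + (real n + 1) * (s ^ 3 * E * leg n (s\<^sup>2 - 1)) = \<Omega>"
        using kern_wronskian_value[OF y n elim(3)] by (simp add: D_def B_def E_def \<Omega>_def mult_ac)
      then have "B = \<Omega> / D s - (real n + 1) * (s ^ 3 * E * leg n (s\<^sup>2 - 1)) / D s"
        using Dc c0 by (simp add: field_simps)
      moreover have "\<bar>(real n + 1) * (s ^ 3 * E * leg n (s\<^sup>2 - 1)) / D s\<bar> < e / 2"
      proof -
        have "s ^ 3 \<le> 2 ^ 3" using elim by (intro power_mono) auto
        then have le3: "s ^ 3 * E * leg n (s\<^sup>2 - 1) \<le> 2 ^ 3 * E * ((s\<^sup>2 - 1) * leg n 1)"
          using E0 elim z by (intro mult_mono leg_le leg_nonneg mult_nonneg_nonneg) auto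
        have le: "(real n + 1) * (s ^ 3 * E * leg n (s\<^sup>2 - 1)) \<le> K * ((s\<^sup>2 - 1) * E)"
        proof -
          from le3 have "(real n + 1) * (s ^ 3 * E * leg n (s\<^sup>2 - 1)) \<le> (real n + 1) * (2 ^ 3 * E * ((s\<^sup>2 - 1) * leg n 1))"
            by (rule mult_left_mono) simp
          also have "\<dots> = K * ((s\<^sup>2 - 1) * E)"
            by (simp add: K_def algebra_simps)
          finally show ?thesis .
        qed
        have ge0: "0 \<le> (real n + 1) * (s ^ 3 * E * leg n (s\<^sup>2 - 1))"
          using E0 elim z by (intro mult_nonneg_nonneg leg_nonneg) auto
        have "\<bar>(real n + 1) * (s ^ 3 * E * leg n (s\<^sup>2 - 1)) / D s\<bar>
            = (real n + 1) * (s ^ 3 * E * leg n (s\<^sup>2 - 1)) / D s"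
          using ge0 Dc c0 by (intro abs_of_nonneg divide_nonneg_nonneg) auto
        also have "\<dots> \<le> K * ((s\<^sup>2 - 1) * E) / c"
          using le ge0 Dc c0 by (intro frac_le) auto
        also have "\<dots> \<le> K * (e * c / (2 * (K + 1))) / c"
          using elim(2) y K c0 by (intro divide_right_mono mult_left_mono) (auto simp: E_def intro: less_imp_le)
        also have "\<dots> = (e / 2) * (K / (K + 1))"
        proof -
          have "K + 1 \<noteq> 0" using K by linarith
          then show ?thesis using c0 by (simp add: divide_simps)
        qed
        also have "\<dots> < (e / 2) * 1"
          using e K by (intro mult_strict_left_mono) auto
        finally show ?thesis by simp
      qed
      ultimately have "\<bar>B - \<Omega> / c\<bar> < e"
        using elim(1) unfolding dist_real_def by linarith
      then show "\<bar>integral\<^sup>L sphere_measure (kern (n + 1) s y)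
          - (2 * real n + 1) * leg_coeff n n * sphere_vol TYPE('n) / (real n * (real n + 1))\<bar> < e"
        by (simp only: B_def \<Omega>_def c_def)
    qed
  qed
qed

section \<open>The approximate identity\<close>

definition kern_mass :: "nat \<Rightarrow> real"
  where "kern_mass n = 2 * pi ^ (2 * n + 2) / (fact n * fact (n + 1))"

lemma kern_mass_pos: "0 < kern_mass n"
  by (simp add: kern_mass_def)

text \<open>The sphere of dimension 4n + 3 has volume
  \<open>2 * pi ^ (2 * n + 2) / fact (2 * n + 1)\<close>, and the numerator of the central binomial
  coefficient in \<open>leg_coeff n n\<close> together with 2n + 1 cancels this factorial.\<close>

lemma kern_mass_eq:
  assumes n: "n = CARD('n::finite)"
  shows "(2 * real n + 1) * leg_coeff n n * sphere_vol TYPE('n) / (real n * (real n + 1)) = kern_mass n"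
proof -
  have n0: "0 < n" using n by simp
  have dim: "DIM('n qspace) = 2 * (2 * n + 2)" using n by simp
  have vol: "sphere_vol TYPE('n) = real (2 * (2 * n + 2)) * (pi ^ (2 * n + 2) / fact (2 * n + 2))"
    unfolding measure_sphere_measure dim unit_ball_vol_even ..
  have "real (2 * n choose n) = fact (2 * n) / (fact n * fact n)"
    using binomial_fact[of n "2 * n", where 'a = real] by (simp add: mult_2)
  then have lc: "leg_coeff n n = real n * (fact (2 * n) / (fact n * fact n))"
    by (simp add: leg_coeff_def mult_2)
  have f: "fact (2 * n + 2) = (2 * real n + 2) * ((2 * real n + 1) * fact (2 * n))"
    by (simp add: algebra_simps)
  have f1: "fact (n + 1) = (real n + 1) * fact n" by simp
  have "fact (2 * n) \<noteq> (0::real)" "fact n \<noteq> (0::real)" by simp_all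
  then show ?thesis
    unfolding vol lc f f1 kern_mass_def using n0
    by (simp add: divide_simps)
qed

text \<open>Normalised by the limit of the masses and not by the mass at \<open>s\<close>: the
  constant is then free of \<open>s\<close>, while the mass is at most 1 and tends to 1.\<close>

definition pkern :: "real \<Rightarrow> 'n::finite qspace \<Rightarrow> 'n qspace \<Rightarrow> real"
  where "pkern s y x = (s\<^sup>2 - 1) * kern (CARD('n) + 2) s y x / kern_mass (CARD('n))"

lemma continuous_on_pkern: "y \<in> sphere 0 1 \<Longrightarrow> 1 < s \<Longrightarrow> continuous_on (sphere 0 1) (pkern s y)"
  unfolding pkern_def by (intro continuous_intros continuous_on_kern) (auto simp: kern_mass_pos less_imp_neq[THEN not_sym])

lemma pkern_nonneg: "x \<in> sphere 0 1 \<Longrightarrow> y \<in> sphere 0 1 \<Longrightarrow> 1 < s \<Longrightarrow> 0 \<le> pkern s y x"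
  unfolding pkern_def using kern_pos[of x y s] kern_mass_pos
  by (intro divide_nonneg_pos mult_nonneg_nonneg) (auto intro: less_imp_le)

lemma pkern_commute: "pkern s y x = pkern s x y"
  by (simp add: pkern_def kern_def sdist_commute[of s y x])

lemma integral_pkern:
  fixes y :: "'n::finite qspace"
  assumes "y \<in> sphere 0 1" "1 < s"
  shows "integral\<^sup>L sphere_measure (pkern s y) = integral\<^sup>L sphere_measure (kern (CARD('n) + 1) s y) / kern_mass (CARD('n))"
  using integral_kern_step[OF assms refl] by (simp add: pkern_def[abs_def])

lemma integral_pkern_limit:
  assumes e: "0 < e"
  shows "\<forall>\<^sub>F s in at_right 1. \<forall>y\<in>sphere (0::'n::finite qspace) 1. \<bar>integral\<^sup>L sphere_measure (pkern s y) - 1\<bar> < e"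
proof -
  define m where "m = kern_mass (CARD('n))"
  have m: "0 < m" by (simp add: m_def kern_mass_pos)
  then have "0 < e * m" using e by simp
  from integral_kern_limit[OF refl this, where 'n = 'n, unfolded kern_mass_eq[OF refl, where 'n = 'n]] eventually_at_right_one(1)
  show ?thesis
  proof eventually_elim
    case (elim s)
    show ?case
    proof
      fix y :: "'n qspace" assume y: "y \<in> sphere 0 1"
      have "integral\<^sup>L sphere_measure (pkern s y) - 1 = (integral\<^sup>L sphere_measure (kern (CARD('n) + 1) s y) - m) / m"
        using m by (simp add: integral_pkern[OF y elim(2)] m_def[symmetric] field_simps)
      then have "\<bar>integral\<^sup>L sphere_measure (pkern s y) - 1\<bar> = \<bar>integral\<^sup>L sphere_measure (kern (CARD('n) + 1) s y) - m\<bar> / m"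
        using m by simp
      also have "\<dots> < e"
        using elim(1) y m by (simp add: m_def pos_divide_less_eq)
      finally show "\<bar>integral\<^sup>L sphere_measure (pkern s y) - 1\<bar> < e" .
    qed
  qed
qed

text \<open>Near \<open>y\<close> the function varies little; away from \<open>y\<close> the kernel
  is bounded up to the vanishing factor \<open>s\<^sup>2 - 1\<close>. Uniformity in \<open>y\<close>
  is what the density argument consumes.\<close>

lemma pkern_approximate_identity:
  fixes f :: "'n::finite qspace \<Rightarrow> real"
  assumes f: "continuous_on (sphere 0 1) f" and e: "0 < e"
  shows "\<forall>\<^sub>F s in at_right 1. \<forall>y\<in>sphere 0 1. \<bar>(\<integral>x. pkern s y x * f x \<partial>sphere_measure) - f y\<bar> < e"
proof -
  have "bounded (f ` sphere 0 1)"
    by (intro compact_imp_bounded compact_continuous_image f) simp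
  then obtain M where M': "\<And>x. x \<in> sphere 0 1 \<Longrightarrow> norm (f x) \<le> M" unfolding bounded_iff by blast
  define M1 where "M1 = \<bar>M\<bar> + 1"
  have M: "\<bar>f x\<bar> \<le> M1" if "x \<in> sphere 0 1" for x using M'[OF that] by (simp add: M1_def)
  have M1: "0 < M1" by (simp add: M1_def)
  have "uniformly_continuous_on (sphere 0 1) f"
    by (rule compact_uniformly_continuous[OF f]) simp
  then obtain \<delta> where \<delta>: "0 < \<delta>" "\<And>x y. x \<in> sphere 0 1 \<Longrightarrow> y \<in> sphere 0 1 \<Longrightarrow> dist x y < \<delta> \<Longrightarrow> dist (f x) (f y) < e / 4"
    using e unfolding uniformly_continuous_on_def by (metis zero_less_divide_iff zero_less_numeral)
  define C where "C = 2 * M1 * (inverse ((\<delta>\<^sup>2 / 2)\<^sup>2) ^ (CARD('n) + 2) / kern_mass (CARD('n)))"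
  have "((\<lambda>s::real. (s\<^sup>2 - 1) * (C * sphere_vol TYPE('n))) \<longlongrightarrow> 0 * (C * sphere_vol TYPE('n))) (at_right 1)"
    by (intro tendsto_mult_right tendsto_square_minus_one)
  then have "\<forall>\<^sub>F s in at_right 1. (s\<^sup>2 - 1) * (C * sphere_vol TYPE('n)) < e / 4"
    using e by (intro order_tendstoD(2)[of _ "0 * (C * sphere_vol TYPE('n))"]) auto
  \<comment> \<open>The minimum with 1 keeps the mass below 2, so that points near \<open>y\<close>
    cost at most e/2. Far points cost less than e/4, and the defect of the mass at most e/4.\<close>
  moreover have "0 < min 1 (e / (4 * M1))" using e M1 by simp
  note integral_pkern_limit[OF this, where 'n = 'n]
  ultimately show ?thesis
    using eventually_at_right_one
  proof eventually_elim
    case (elim s)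
    show ?case
    proof
      fix y :: "'n qspace" assume y: "y \<in> sphere 0 1"
      have z: "0 \<le> s\<^sup>2 - 1" using elim by simp
      have cp: "continuous_on (sphere 0 1) (pkern s y)" by (rule continuous_on_pkern[OF y elim(3)])
      define I where "I = integral\<^sup>L sphere_measure (pkern s y)"
      have I: "\<bar>I - 1\<bar> < 1" "\<bar>I - 1\<bar> < e / (4 * M1)" using elim(2) y by (auto simp: I_def)
      have pt: "\<bar>pkern s y x * (f x - f y)\<bar> \<le> e / 4 * pkern s y x + (s\<^sup>2 - 1) * C" if x: "x \<in> sphere 0 1" for x
      proof -
        have p0: "0 \<le> pkern s y x" by (rule pkern_nonneg[OF x y elim(3)])
        have C0: "0 \<le> (s\<^sup>2 - 1) * C" using z M1 kern_mass_pos[of "CARD('n)"] by (simp add: C_def)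
        show ?thesis
        proof (cases "dist x y < \<delta>")
          case True
          have "\<bar>pkern s y x * (f x - f y)\<bar> = pkern s y x * \<bar>f x - f y\<bar>" using p0 by (simp add: abs_mult)
          also have "\<dots> \<le> pkern s y x * (e / 4)"
            using \<delta>(2)[OF x y True] p0 by (intro mult_left_mono) (auto simp: dist_real_def)
          finally show ?thesis using C0 by (simp add: mult.commute)
        next
          case False
          then have "(\<delta>\<^sup>2 / 2)\<^sup>2 \<le> ((norm (x - y))\<^sup>2 / 2)\<^sup>2"
            using \<delta>(1) by (intro power_mono divide_right_mono) (auto simp: dist_norm)
          then have "(\<delta>\<^sup>2 / 2)\<^sup>2 \<le> sdist s y x" using sdist_bounds(2)[OF x y, of s] elim by linarith
          then have "inverse (sdist s y x) \<le> inverse ((\<delta>\<^sup>2 / 2)\<^sup>2)"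
            by (rule le_imp_inverse_le) (use \<delta> in simp)
          then have "kern (CARD('n) + 2) s y x \<le> inverse ((\<delta>\<^sup>2 / 2)\<^sup>2) ^ (CARD('n) + 2)"
            unfolding kern_def using sdist_pos[OF x y elim(3)] by (intro power_mono) auto
          then have "pkern s y x \<le> (s\<^sup>2 - 1) * inverse ((\<delta>\<^sup>2 / 2)\<^sup>2) ^ (CARD('n) + 2) / kern_mass (CARD('n))"
            unfolding pkern_def using z kern_mass_pos[of "CARD('n)"] by (intro divide_right_mono mult_left_mono) auto
          then have "pkern s y x * \<bar>f x - f y\<bar> \<le> ((s\<^sup>2 - 1) * inverse ((\<delta>\<^sup>2 / 2)\<^sup>2) ^ (CARD('n) + 2) / kern_mass (CARD('n))) * (2 * M1)"
            using M[OF x] M[OF y] p0 by (intro mult_mono) auto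
          also have "\<dots> = (s\<^sup>2 - 1) * C" by (simp add: C_def)
          finally have "\<bar>pkern s y x * (f x - f y)\<bar> \<le> (s\<^sup>2 - 1) * C" using p0 by (simp add: abs_mult)
          moreover have "0 \<le> e / 4 * pkern s y x" using e p0 by simp
          ultimately show ?thesis by linarith
        qed
      qed
      have i1: "integrable sphere_measure (\<lambda>x. pkern s y x * (f x - f y))"
        "integrable sphere_measure (pkern s y)" "integrable sphere_measure (\<lambda>x. pkern s y x * f x)"
        by (intro integrable_sphere_measure continuous_intros cp f)+
      have "\<bar>\<integral>x. pkern s y x * (f x - f y) \<partial>sphere_measure\<bar> \<le> (\<integral>x. \<bar>pkern s y x * (f x - f y)\<bar> \<partial>sphere_measure)"
        by (rule integral_abs_bound)
      also have "\<dots> \<le> (\<integral>x. e / 4 * pkern s y x + (s\<^sup>2 - 1) * C \<partial>sphere_measure)"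
        by (intro integral_sphere_measure_mono continuous_intros cp f pt)
      also have "\<dots> = e / 4 * I + (s\<^sup>2 - 1) * (C * sphere_vol TYPE('n))"
        using i1 by (simp add: I_def mult_ac)
      also have "\<dots> < 3 * e / 4"
      proof -
        have "e / 4 * I \<le> e / 4 * 2" using I(1) e by (intro mult_left_mono) auto
        then show ?thesis using elim(1) by linarith
      qed
      finally have 1: "\<bar>\<integral>x. pkern s y x * (f x - f y) \<partial>sphere_measure\<bar> < 3 * e / 4" .
      have 2: "(\<integral>x. pkern s y x * (f x - f y) \<partial>sphere_measure) = (\<integral>x. pkern s y x * f x \<partial>sphere_measure) - I * f y"
        using i1 by (simp add: right_diff_distrib I_def)
      have "\<bar>(I - 1) * f y\<bar> \<le> e / (4 * M1) * M1"
        unfolding abs_mult using I M[OF y] e M1 by (intro mult_mono) auto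
      then have 3: "\<bar>I * f y - f y\<bar> \<le> e / 4" using M1 by (simp add: left_diff_distrib)
      show "\<bar>(\<integral>x. pkern s y x * f x \<partial>sphere_measure) - f y\<bar> < e"
        using 1 3 unfolding 2 by linarith
    qed
  qed
qed

section \<open>Density\<close>

lemma continuous_on_hdot: "continuous_on S (\<lambda>z. hdot (fst z) (snd z))"
  unfolding hdot_def qmult_def qcnj_def
  by (intro continuous_intros continuous_on_component)

text \<open>Finitely many balls cover the compact set; in a fixed enumeration each centre keeps the
  part of its ball that no earlier ball contains. The pieces serve for Riemann sums tagged by their
  centres.\<close>

lemma finite_partition_small:
  fixes S :: "'a::euclidean_space set"
  assumes "compact S" "0 < d"
  obtains I :: "'a set" and A where "finite I" "I \<subseteq> S" "disjoint_family_on A I" "S \<subseteq> (\<Union>i\<in>I. A i)"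
    "\<And>i. i \<in> I \<Longrightarrow> A i \<in> sets borel" "\<And>i x. i \<in> I \<Longrightarrow> x \<in> A i \<Longrightarrow> dist i x < d"
proof -
  obtain I where I: "finite I" "I \<subseteq> S" "S \<subseteq> (\<Union>i\<in>I. ball i d)"
  proof (rule compactE_image[OF assms(1), of S "\<lambda>x. ball x d"])
    show "S \<subseteq> (\<Union>x\<in>S. ball x d)" using assms(2) by auto
  qed auto
  obtain xs where xs: "set xs = I" "distinct xs" using finite_distinct_list[OF I(1)] by blast
  define idx where "idx i = (THE k. k < length xs \<and> xs ! k = i)" for i
  have idx: "idx (xs ! k) = k" if "k < length xs" for k
    unfolding idx_def using that xs(2) by (auto simp: nth_eq_iff_index_eq)
  define A where "A i = ball i d - (\<Union>j<idx i. ball (xs ! j) d)" for i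
  have disj: "A i \<inter> A j = {}" if ij: "i \<in> I" "j \<in> I" "i \<noteq> j" for i j
  proof -
    obtain k l where kl: "k < length xs" "xs ! k = i" "l < length xs" "xs ! l = j"
      using ij(1,2) unfolding xs(1)[symmetric] in_set_conv_nth by blast
    have i: "idx i = k" and j: "idx j = l"
      using idx[OF kl(1)] idx[OF kl(3)] unfolding kl(2,4) .
    have "k \<noteq> l" using ij(3) kl(2,4) by blast
    then consider "k < l" | "l < k" by linarith
    then show ?thesis
    proof cases
      case 1
      then have "A j \<inter> ball i d = {}" unfolding A_def j kl(2)[symmetric] by blast
      then show ?thesis unfolding A_def[of i] by blast
    next
      case 2
      then have "A i \<inter> ball j d = {}" unfolding A_def i kl(4)[symmetric] by blast
      then show ?thesis unfolding A_def[of j] by blast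
    qed
  qed
  have cover: "x \<in> (\<Union>i\<in>I. A i)" if "x \<in> S" for x
  proof -
    have "\<exists>k. k < length xs \<and> x \<in> ball (xs ! k) d"
      using I(3) that xs(1) by (metis UN_E in_set_conv_nth subsetD)
    then obtain k where k: "k < length xs \<and> x \<in> ball (xs ! k) d"
      and min: "\<And>j. j < k \<Longrightarrow> \<not> (j < length xs \<and> x \<in> ball (xs ! j) d)"
      using exists_least_iff[of "\<lambda>k. k < length xs \<and> x \<in> ball (xs ! k) d"] by blast
    have "x \<in> A (xs ! k)" using k min by (auto simp: A_def idx)
    then show ?thesis using k xs(1) by auto
  qed
  show thesis
  proof (rule that[of I A])
    show "disjoint_family_on A I" using disj by (auto simp: disjoint_family_on_def)
    show "A i \<in> sets borel" for i unfolding A_def by (intro sets.Diff sets.countable_UN') auto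
  qed (use I cover in \<open>auto simp: A_def\<close>)
qed

text \<open>Density of the linear span of the functions \<open>pkern s y\<close> in the continuous functions, in dual form.\<close>

lemma pkern_functional_zero:
  fixes \<Phi> :: "('n::finite qspace \<Rightarrow> real) \<Rightarrow> real"
  assumes add: "\<And>f g. continuous_on (sphere 0 1) f \<Longrightarrow> continuous_on (sphere 0 1) g \<Longrightarrow> \<Phi> (\<lambda>x. f x + g x) = \<Phi> f + \<Phi> g"
    and scale: "\<And>f c. continuous_on (sphere 0 1) f \<Longrightarrow> \<Phi> (\<lambda>x. c * f x) = c * \<Phi> f"
    and bound: "\<And>f M. continuous_on (sphere 0 1) f \<Longrightarrow> (\<And>x. x \<in> sphere 0 1 \<Longrightarrow> \<bar>f x\<bar> \<le> M) \<Longrightarrow> \<bar>\<Phi> f\<bar> \<le> K * M"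
    and zero: "\<And>s y. 1 < s \<Longrightarrow> y \<in> sphere 0 1 \<Longrightarrow> \<Phi> (pkern s y) = 0"
    and f: "continuous_on (sphere 0 1) f"
  shows "\<Phi> f = 0"
proof -
  have sumc: "continuous_on (sphere 0 1) (\<lambda>y. \<Sum>z\<in>I. c z * pkern s z y)"
    if "I \<subseteq> sphere 0 1" "1 < s" for I c s
    using that by (intro continuous_intros continuous_on_pkern) auto
  have sum0: "\<Phi> (\<lambda>y. \<Sum>z\<in>I. c z * pkern s z y) = 0"
    if "finite I" "I \<subseteq> sphere 0 1" "1 < s" for I c s
    using that
  proof (induction I rule: finite_induct)
    case empty
    show ?case using scale[of "\<lambda>_. 0" 0] by simp
  next
    case (insert z I)
    have c: "continuous_on (sphere 0 1) (pkern s z)"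
      using insert by (intro continuous_on_pkern) auto
    then have c': "continuous_on (sphere 0 1) (\<lambda>y. c z * pkern s z y)"
      by (intro continuous_intros)
    show ?case
      using insert add[OF c' sumc[of I s c]] scale[OF c, of "c z"] zero[of s z] by simp
  qed
  have "\<bar>\<Phi> f\<bar> \<le> K * e" if e: "0 < e" for e
  proof -
    have "\<forall>\<^sub>F s in at_right 1. 1 < s \<and> (\<forall>y\<in>sphere 0 1. \<bar>(\<integral>x. pkern s y x * f x \<partial>sphere_measure) - f y\<bar> < e / 2)"
      using pkern_approximate_identity[OF f, of "e / 2"] eventually_at_right_one(1) e by (simp add: eventually_conj_iff)
    then have "\<exists>s>1. \<forall>y\<in>sphere 0 1. \<bar>(\<integral>x. pkern s y x * f x \<partial>sphere_measure) - f y\<bar> < e / 2"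
      by (rule eventually_happens'[rotated]) simp
    then obtain s where s: "1 < s" "\<forall>y\<in>sphere 0 1. \<bar>(\<integral>x. pkern s y x * f x \<partial>sphere_measure) - f y\<bar> < e / 2"
      by (elim exE conjE)
    define M where "M = (\<integral>x. \<bar>f x\<bar> \<partial>sphere_measure)"
    have M: "0 \<le> M" unfolding M_def by simp
    define e' where "e' = e / (2 * (M + 1))"
    have e': "0 < e'" "e' * M \<le> e / 2" using e M by (auto simp: e'_def field_simps)
    have "continuous_on (sphere 0 1 \<times> sphere 0 1) (\<lambda>z. sdist s (snd z) (fst z :: 'n qspace))"
      unfolding sdist_def
      by (intro continuous_on_add continuous_on_diff continuous_on_mult continuous_on_power continuous_on_norm
          continuous_on_const continuous_on_inner continuous_on_fst continuous_on_snd continuous_on_id continuous_on_hdot)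
    then have "continuous_on (sphere 0 1 \<times> sphere 0 1) (\<lambda>z. kern m s (snd z) (fst z :: 'n qspace))" for m
      unfolding kern_def
      by (intro continuous_on_power continuous_on_inverse ballI sdist_nonzero[OF _ _ s(1)])
         (simp_all only: mem_Times_iff)
    then have "continuous_on (sphere 0 1 \<times> sphere 0 1) (\<lambda>z. pkern s (snd z) (fst z :: 'n qspace))"
      unfolding pkern_def divide_inverse
      by (intro continuous_on_mult continuous_on_const)
    then have "uniformly_continuous_on (sphere 0 1 \<times> sphere 0 1) (\<lambda>z. pkern s (snd z) (fst z :: 'n qspace))"
      by (rule compact_uniformly_continuous) (intro compact_Times compact_sphere)
    from this[unfolded uniformly_continuous_on_def, rule_format, OF e'(1)]
    obtain d where d: "0 < d" "\<forall>z\<in>sphere 0 1 \<times> sphere 0 1. \<forall>z'\<in>sphere 0 1 \<times> sphere 0 1.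
        dist z' z < d \<longrightarrow> dist (pkern s (snd z') (fst z' :: 'n qspace)) (pkern s (snd z) (fst z)) < e'"
      by (elim exE conjE)
    obtain I A where I: "finite I" "I \<subseteq> sphere (0 :: 'n qspace) 1" "disjoint_family_on A I" "sphere 0 1 \<subseteq> (\<Union>i\<in>I. A i)"
      "\<And>i. i \<in> I \<Longrightarrow> A i \<in> sets borel" "\<And>i x. i \<in> I \<Longrightarrow> x \<in> A i \<Longrightarrow> dist i x < d"
      using finite_partition_small[OF compact_sphere d(1)] by metis
    define c where "c z = (\<integral>x. indicator (A z) x * f x \<partial>sphere_measure)" for z
    \<comment> \<open>A Riemann sum for the smoothed function: on the piece \<open>A z\<close> the
      kernel is frozen at \<open>z\<close>. By symmetry of \<open>pkern\<close> the result is a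
      combination of the functions \<open>pkern s z\<close>.\<close>
    define g where "g y = (\<Sum>z\<in>I. c z * pkern s z y)" for y
    have if0: "integrable sphere_measure f" by (rule integrable_sphere_measure[OF f])
    have ifA: "integrable sphere_measure (\<lambda>x. indicator (A z) x * f x)" if "z \<in> I" for z
    proof -
      have "A z \<inter> sphere 0 1 \<in> sets (sphere_measure :: 'n qspace measure)"
        unfolding sphere_measure_def using I(5)[OF that] by (subst sets_restrict_space_iff) auto
      then have "integrable sphere_measure (\<lambda>x. indicator (A z \<inter> sphere 0 1) x *\<^sub>R f x)"
        by (rule integrable_mult_indicator[OF _ if0])
      then show ?thesis
        by (subst Bochner_Integration.integrable_cong[OF refl]) (auto simp: indicator_def)
    qed
    have fg: "\<bar>f y - g y\<bar> \<le> e" if y: "y \<in> sphere 0 1" for y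
    proof -
      have ip: "integrable sphere_measure (\<lambda>x. pkern s y x * f x)"
        by (intro integrable_sphere_measure continuous_intros continuous_on_pkern y s f)
      have ig: "integrable sphere_measure (\<lambda>x. \<Sum>z\<in>I. pkern s z y * (indicator (A z) x * f x))"
        using ifA by simp
      have "g y = (\<integral>x. (\<Sum>z\<in>I. pkern s z y * (indicator (A z) x * f x)) \<partial>sphere_measure)"
        unfolding g_def c_def using ifA by (simp add: mult.commute)
      then have "(\<integral>x. pkern s y x * f x \<partial>sphere_measure) - g y
          = (\<integral>x. pkern s y x * f x - (\<Sum>z\<in>I. pkern s z y * (indicator (A z) x * f x)) \<partial>sphere_measure)"
        using ip ig by simp
      also have "\<bar>\<dots>\<bar> \<le> (\<integral>x. \<bar>pkern s y x * f x - (\<Sum>z\<in>I. pkern s z y * (indicator (A z) x * f x))\<bar> \<partial>sphere_measure)"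
        by (rule integral_abs_bound)
      also have "\<dots> \<le> (\<integral>x. e' * \<bar>f x\<bar> \<partial>sphere_measure)"
      proof (rule integral_mono)
        fix x :: "'n qspace" assume "x \<in> space sphere_measure"
        then have x: "x \<in> sphere 0 1" by simp
        then obtain z where z: "z \<in> I" "x \<in> A z" using I(4) by auto
        have "indicator (A z') x = (if z' = z then 1 else 0 :: real)" if "z' \<in> I" for z'
          using disjoint_family_onD[OF I(3) z(1) that] z that by (auto simp: indicator_def)
        then have "(\<Sum>z'\<in>I. pkern s z' y * (indicator (A z') x * f x)) = (\<Sum>z'\<in>I. if z' = z then pkern s z y * f x else 0)"
          by (intro sum.cong refl) auto
        also have "\<dots> = pkern s z y * f x" using I(1) z by simp
        finally have eq: "(\<Sum>z'\<in>I. pkern s z' y * (indicator (A z') x * f x)) = pkern s z y * f x" .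
        have zS: "z \<in> sphere 0 1" using z I(2) by auto
        have "dist (y, z) (y, x) < d" using I(6)[OF z] by (simp add: dist_prod_def)
        then have "dist (pkern s z y) (pkern s x y) < e'"
          using d(2)[rule_format, of "(y, x)" "(y, z)"] x y zS by simp
        then have "\<bar>pkern s y x - pkern s z y\<bar> \<le> e'"
          by (simp add: dist_real_def pkern_commute[of s y x] abs_minus_commute)
        then show "\<bar>pkern s y x * f x - (\<Sum>z\<in>I. pkern s z y * (indicator (A z) x * f x))\<bar> \<le> e' * \<bar>f x\<bar>"
          unfolding eq by (simp add: left_diff_distrib[symmetric] abs_mult mult_right_mono)
      qed (use ip ig if0 in auto)
      also have "\<dots> = e' * M" by (simp add: M_def)
      also have "\<dots> \<le> e / 2" by (rule e')
      finally show ?thesis using bspec[OF s(2) y] by linarith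
    qed
    have g: "\<Phi> g = 0" "continuous_on (sphere 0 1) g"
      unfolding g_def using sum0[OF I(1,2) s(1)] sumc[OF I(2) s(1)] by auto
    have "\<Phi> f = \<Phi> (\<lambda>x. (f x - g x) + g x)" by simp
    also have "\<dots> = \<Phi> (\<lambda>x. f x - g x)"
      using add[OF continuous_on_diff[OF f g(2)] g(2)] g(1) by simp
    finally show ?thesis
      using bound[OF continuous_on_diff[OF f g(2)] fg] by simp
  qed
  then have small: "\<bar>\<Phi> f\<bar> \<le> K * e" if "0 < e" for e using that .
  \<comment> \<open>No sign of \<open>K\<close> is assumed, hence the division by
    \<open>\<bar>K\<bar> + 1\<close>.\<close>
  have "\<bar>\<Phi> f\<bar> \<le> 0 + e" if e: "0 < e" for e
  proof -
    have "\<bar>\<Phi> f\<bar> \<le> K * (e / (\<bar>K\<bar> + 1))" by (rule small) (use e in simp)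
    also have "\<dots> \<le> (\<bar>K\<bar> + 1) * (e / (\<bar>K\<bar> + 1))" using e by (intro mult_right_mono) auto
    also have "\<dots> = e" by simp
    finally show ?thesis by simp
  qed
  then have "\<bar>\<Phi> f\<bar> \<le> 0" by (rule field_le_epsilon)
  then show ?thesis by simp
qed

section \<open>The heat semigroup\<close>

lemma set_integral_FTC_Ioi:
  fixes F f :: "real \<Rightarrow> real"
  assumes der: "\<And>t. a < t \<Longrightarrow> (F has_real_derivative f t) (at t)"
    and cont: "\<And>t. a < t \<Longrightarrow> isCont f t"
    and nonneg: "\<And>t. a < t \<Longrightarrow> 0 \<le> f t"
    and lim: "(F \<longlongrightarrow> A) (at_right a)" "(F \<longlongrightarrow> B) at_top"
  shows "set_integrable lborel {a<..} f" "(LBINT t:{a<..}. f t) = B - A"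
proof -
  have e: "einterval (ereal a) \<infinity> = {a<..}" by (auto simp: einterval_def)
  have 1: "((F \<circ> real_of_ereal) \<longlongrightarrow> A) (at_right (ereal a))" "((F \<circ> real_of_ereal) \<longlongrightarrow> B) (at_left \<infinity>)"
    using lim by (simp_all add: ereal_tendsto_simps)
  have 2: "AE t in lborel. ereal a < ereal t \<longrightarrow> ereal t < \<infinity> \<longrightarrow> 0 \<le> f t"
    using nonneg by (intro AE_I2) auto
  have "set_integrable lborel (einterval (ereal a) \<infinity>) f"
    by (rule interval_integral_FTC_nonneg[OF _ _ _ 2 1]) (use der cont in auto)
  then show "set_integrable lborel {a<..} f" by (simp add: e)
  have "(LBINT t=ereal a..\<infinity>. f t) = B - A"
    by (rule interval_integral_FTC_nonneg[OF _ _ _ 2 1]) (use der cont in auto)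
  then show "(LBINT t:{a<..}. f t) = B - A"
    by (simp add: interval_lebesgue_integral_def e)
qed

lemma smooth_on_sphere_const: "smooth_on_sphere (\<lambda>_. c)"
  unfolding smooth_on_sphere_def by (intro allI C_k_on_const open_Compl) simp

lemma sub_laplacian_const:
  assumes "x \<in> sphere 0 1"
  shows "sub_laplacian (\<lambda>_. c) x = 0"
  using sub_laplacian_eq[of "\<lambda>_. c" "\<lambda>_. 0" "\<lambda>_ _. 0" x] assms by simp

lemma continuous_on_smooth_sphere:
  assumes "smooth_on_sphere f"
  shows "continuous_on (sphere 0 1) f"
proof -
  have "C_k_on 0 (- {0}) (\<lambda>x. f (sgn x))" using assms unfolding smooth_on_sphere_def by blast
  then have "continuous_on (sphere 0 1) (\<lambda>x. f (sgn x))"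
    by (auto intro: continuous_on_subset)
  then show ?thesis by (rule continuous_on_eq) (simp add: sgn_div_norm)
qed

locale heat_flow =
  fixes P :: "real \<Rightarrow> ('n::finite qspace \<Rightarrow> real) \<Rightarrow> 'n qspace \<Rightarrow> real"
  assumes heat: "heat_semigroup P"
begin

abbreviation C :: "('n qspace \<Rightarrow> real) \<Rightarrow> bool" where "C f \<equiv> continuous_on (sphere 0 1) f"

lemma continuous_flow: "C f \<Longrightarrow> 0 \<le> t \<Longrightarrow> C (P t f)"
  by (rule heat[unfolded heat_semigroup_def, THEN conjunct1, rule_format])

lemma linear_combination: "C f \<Longrightarrow> C g \<Longrightarrow> 0 \<le> t \<Longrightarrow> x \<in> sphere 0 1 \<Longrightarrow> P t (\<lambda>y. a * f y + b * g y) x = a * P t f x + b * P t g x"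
  by (rule heat[unfolded heat_semigroup_def, THEN conjunct2, THEN conjunct1, rule_format])

lemma contraction: "C f \<Longrightarrow> 0 \<le> t \<Longrightarrow> (\<And>x. x \<in> sphere 0 1 \<Longrightarrow> \<bar>f x\<bar> \<le> M) \<Longrightarrow> x \<in> sphere 0 1 \<Longrightarrow> \<bar>P t f x\<bar> \<le> M"
  by (rule heat[unfolded heat_semigroup_def, THEN conjunct2, THEN conjunct2, THEN conjunct1, rule_format])

lemma at_0: "C f \<Longrightarrow> x \<in> sphere 0 1 \<Longrightarrow> P 0 f x = f x"
  by (rule heat[unfolded heat_semigroup_def, THEN conjunct2, THEN conjunct2, THEN conjunct2, THEN conjunct1, rule_format])

lemma semigroup_law: "C f \<Longrightarrow> 0 \<le> s \<Longrightarrow> 0 \<le> t \<Longrightarrow> x \<in> sphere 0 1 \<Longrightarrow> P (s + t) f x = P s (P t f) x"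
  by (rule heat[unfolded heat_semigroup_def, THEN conjunct2, THEN conjunct2, THEN conjunct2, THEN conjunct2, THEN conjunct1, rule_format])

lemma strongly_continuous: "C f \<Longrightarrow> uniform_limit (sphere 0 1) (\<lambda>t. P t f) f (at_right 0)"
  by (rule heat[unfolded heat_semigroup_def, THEN conjunct2, THEN conjunct2, THEN conjunct2, THEN conjunct2, THEN conjunct2, THEN conjunct1, rule_format])

lemma generator: "smooth_on_sphere f \<Longrightarrow> uniform_limit (sphere 0 1) (\<lambda>t x. (P t f x - f x) / t) (sub_laplacian f) (at_right 0)"
  by (rule heat[unfolded heat_semigroup_def, THEN conjunct2, THEN conjunct2, THEN conjunct2, THEN conjunct2, THEN conjunct2, THEN conjunct2, rule_format])

lemma scale: "C f \<Longrightarrow> 0 \<le> t \<Longrightarrow> x \<in> sphere 0 1 \<Longrightarrow> P t (\<lambda>y. a * f y) x = a * P t f x"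
  using linear_combination[of f f t x a 0] by simp

lemma add: "C f \<Longrightarrow> C g \<Longrightarrow> 0 \<le> t \<Longrightarrow> x \<in> sphere 0 1 \<Longrightarrow> P t (\<lambda>y. f y + g y) x = P t f x + P t g x"
  using linear_combination[of f g t x 1 1] by simp

lemma diff: "C f \<Longrightarrow> C g \<Longrightarrow> 0 \<le> t \<Longrightarrow> x \<in> sphere 0 1 \<Longrightarrow> P t (\<lambda>y. f y - g y) x = P t f x - P t g x"
  using linear_combination[of f g t x 1 "-1"] by simp

lemma contr_diff:
  assumes "C f" "C g" "0 \<le> t" "x \<in> sphere 0 1" "\<And>x. x \<in> sphere 0 1 \<Longrightarrow> \<bar>f x - g x\<bar> \<le> M"
  shows "\<bar>P t f x - P t g x\<bar> \<le> M"
  using contraction[OF continuous_on_diff[OF assms(1,2)] assms(3,5,4)] diff[OF assms(1-4)] by simp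

text \<open>\<open>P t\<close> takes functions on the ambient space; contraction with bound 0 shows
  that only their values on the sphere count.\<close>

lemma cong:
  assumes "C f" "C g" "0 \<le> t" "x \<in> sphere 0 1" "\<And>x. x \<in> sphere 0 1 \<Longrightarrow> f x = g x"
  shows "P t f x = P t g x"
  using contr_diff[OF assms(1-4), of 0] assms(5) by simp

text \<open>For a < b the difference is \<open>P a\<close> applied to
  \<open>P (b - a) f - f\<close>. Contraction makes strong continuity at time 0 uniform in all times
  and points.\<close>

lemma equicontinuous:
  assumes f: "C f" and e: "0 < e"
  shows "\<exists>d>0. \<forall>a b. \<forall>x\<in>sphere 0 1. 0 \<le> a \<longrightarrow> 0 \<le> b \<longrightarrow> \<bar>a - b\<bar> < d \<longrightarrow> \<bar>P a f x - P b f x\<bar> \<le> e"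
proof -
  have "\<forall>\<^sub>F t in at_right 0. \<forall>x\<in>sphere 0 1. dist (P t f x) (f x) < e"
    using strongly_continuous[OF f] e by (rule uniform_limitD)
  then obtain d where d: "0 < d" "\<forall>t>0. t < d \<longrightarrow> (\<forall>x\<in>sphere 0 1. dist (P t f x) (f x) < e)"
    unfolding eventually_at_right_field by (elim exE conjE)
  have less: "\<bar>P b f x - P a f x\<bar> \<le> e" if "0 \<le> a" "a < b" "b < a + d" "x \<in> sphere 0 1" for a b x
  proof -
    have "P b f x = P a (P (b - a) f) x" using semigroup_law[OF f, of a "b - a" x] that by simp
    moreover have "\<bar>P a (P (b - a) f) x - P a f x\<bar> \<le> e"
    proof (rule contr_diff[OF continuous_flow[OF f] f])
      fix y :: "'n qspace" assume "y \<in> sphere 0 1"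
      then have "dist (P (b - a) f y) (f y) < e" using that by (intro d(2)[rule_format]) auto
      then show "\<bar>P (b - a) f y - f y\<bar> \<le> e" by (simp add: dist_real_def)
    qed (use that in auto)
    ultimately show ?thesis by simp
  qed
  show ?thesis
  proof (intro exI[of _ d] conjI allI ballI impI d(1))
    fix a b x assume h: "0 \<le> a" "0 \<le> b" "\<bar>a - b\<bar> < d" and "x \<in> sphere (0::'n qspace) 1"
    note h = h this
    consider "a < b" | "a = b" | "b < a" by linarith
    then show "\<bar>P a f x - P b f x\<bar> \<le> e"
    proof cases
      case 1 then show ?thesis using less[of a b x] h by (simp add: abs_minus_commute)
    next
      case 3 then show ?thesis using less[of b a x] h by simp
    qed (use e in simp)
  qed
qed

lemma continuous_time:
  assumes f: "C f" and x: "x \<in> sphere 0 1"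
  shows "continuous_on {0..} (\<lambda>t. P t f x)"
proof (rule continuous_on_iff[THEN iffD2], intro ballI allI impI)
  fix t e :: real assume "t \<in> {0..}" "0 < e"
  note h = f x this
  then have e2: "0 < e / 2" by simp
  from equicontinuous[OF f e2]
  obtain d where d: "0 < d" "\<forall>a b. \<forall>x\<in>sphere 0 1. 0 \<le> a \<longrightarrow> 0 \<le> b \<longrightarrow> \<bar>a - b\<bar> < d \<longrightarrow> \<bar>P a f x - P b f x\<bar> \<le> e / 2"
    by (elim exE conjE)
  show "\<exists>d>0. \<forall>t'\<in>{0..}. dist t' t < d \<longrightarrow> dist (P t' f x) (P t f x) < e"
  proof (intro exI conjI ballI impI)
    fix t' assume "t' \<in> {0..}" "dist t' t < d"
    then have "\<bar>P t' f x - P t f x\<bar> \<le> e / 2" using h by (intro d(2)[rule_format]) (auto simp: dist_real_def)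
    then show "dist (P t' f x) (P t f x) < e" using h(4) by (simp add: dist_real_def)
  qed (rule d(1))
qed

text \<open>The generator is given only as a limit from the right at time 0. Contraction carries
  this estimate to every base time with the same error. For the left derivative at \<open>t\<close>
  the base time is the smaller \<open>u\<close>, and equicontinuity replaces the derivative at
  \<open>u\<close> by that at \<open>t\<close>.\<close>

lemma has_derivative_time:
  assumes f: "smooth_on_sphere f" and Lf: "C (sub_laplacian f)" and x: "x \<in> sphere 0 1" and t: "0 \<le> t"
  shows "((\<lambda>t. P t f x) has_real_derivative P t (sub_laplacian f) x) (at t within {0..})"
  unfolding has_field_derivative_def has_derivative_within_alt
proof (intro conjI allI impI)
  show "bounded_linear ((*) (P t (sub_laplacian f) x))" by (rule bounded_linear_mult_right)
  fix e :: real assume e: "0 < e"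
  then have e2: "0 < e / 2" by simp
  have Cf: "C f" by (rule continuous_on_smooth_sphere[OF f])
  from equicontinuous[OF Lf e2]
  obtain d1 where d1: "0 < d1" "\<forall>a b. \<forall>x\<in>sphere 0 1. 0 \<le> a \<longrightarrow> 0 \<le> b \<longrightarrow> \<bar>a - b\<bar> < d1 \<longrightarrow> \<bar>P a (sub_laplacian f) x - P b (sub_laplacian f) x\<bar> \<le> e / 2"
    by (elim exE conjE)
  have "\<forall>\<^sub>F h in at_right 0. \<forall>x\<in>sphere 0 1. dist ((P h f x - f x) / h) (sub_laplacian f x) < e / 2"
    using generator[OF f] e2 by (rule uniform_limitD)
  then obtain d2 where d2: "0 < d2" "\<forall>h>0. h < d2 \<longrightarrow> (\<forall>x\<in>sphere 0 1. dist ((P h f x - f x) / h) (sub_laplacian f x) < e / 2)"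
    unfolding eventually_at_right_field by (elim exE conjE)
  have step: "\<bar>P (a + h) f x - P a f x - h * P a (sub_laplacian f) x\<bar> \<le> e / 2 * h"
    if a: "0 \<le> a" and h: "0 < h" "h < d2" for a h
  proof -
    have c1: "C (\<lambda>y. P h f y - f y)" by (intro continuous_on_diff continuous_flow Cf) (use h in simp)
    have c2: "C (\<lambda>y. h * sub_laplacian f y)" by (intro continuous_intros Lf)
    have "P a (\<lambda>y. P h f y - f y) x = P (a + h) f x - P a f x"
      using diff[OF continuous_flow[OF Cf, of h] Cf a x] semigroup_law[OF Cf a, of h x] h x by simp
    moreover have "P a (\<lambda>y. h * sub_laplacian f y) x = h * P a (sub_laplacian f) x"
      by (rule scale[OF Lf a x])
    moreover have "\<bar>P a (\<lambda>y. P h f y - f y) x - P a (\<lambda>y. h * sub_laplacian f y) x\<bar> \<le> e / 2 * h"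
    proof (rule contr_diff[OF c1 c2 a x])
      fix y :: "'n qspace" assume y: "y \<in> sphere 0 1"
      have "(P h f y - f y) - h * sub_laplacian f y = h * ((P h f y - f y) / h - sub_laplacian f y)"
        using h by (simp add: field_simps)
      then have "\<bar>(P h f y - f y) - h * sub_laplacian f y\<bar> = h * \<bar>(P h f y - f y) / h - sub_laplacian f y\<bar>"
        using h by (simp add: abs_mult)
      also have "\<dots> \<le> h * (e / 2)"
        using d2(2)[rule_format, OF h y] h(1) unfolding dist_real_def by (intro mult_left_mono) linarith+
      finally show "\<bar>(P h f y - f y) - h * sub_laplacian f y\<bar> \<le> e / 2 * h" by (simp add: mult.commute)
    qed
    ultimately show ?thesis by simp
  qed
  show "\<exists>d>0. \<forall>u\<in>{0..}. norm (u - t) < d \<longrightarrow> norm (P u f x - P t f x - P t (sub_laplacian f) x * (u - t)) \<le> e * norm (u - t)"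
  proof (intro exI[of _ "min d1 d2"] conjI ballI impI)
    fix u assume u: "u \<in> {0..}" "norm (u - t) < min d1 d2"
    consider "t < u" | "u = t" | "u < t" by linarith
    then show "norm (P u f x - P t f x - P t (sub_laplacian f) x * (u - t)) \<le> e * norm (u - t)"
    proof cases
      case 1
      then have "\<bar>P u f x - P t f x - (u - t) * P t (sub_laplacian f) x\<bar> \<le> e / 2 * (u - t)"
        using step[OF t, of "u - t"] u by simp
      also have "\<dots> \<le> e * (u - t)" using 1 e by (intro mult_right_mono) auto
      finally show ?thesis using 1 by (simp add: mult.commute)
    next
      case 3
      then have 1: "\<bar>P t f x - P u f x - (t - u) * P u (sub_laplacian f) x\<bar> \<le> e / 2 * (t - u)"
        using step[of u "t - u"] u by simp
      have "\<bar>P u (sub_laplacian f) x - P t (sub_laplacian f) x\<bar> \<le> e / 2"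
        using u t x by (intro d1(2)[rule_format]) auto
      then have "(t - u) * \<bar>P u (sub_laplacian f) x - P t (sub_laplacian f) x\<bar> \<le> (t - u) * (e / 2)"
        using 3 by (intro mult_left_mono) auto
      then have 2: "\<bar>(t - u) * (P u (sub_laplacian f) x - P t (sub_laplacian f) x)\<bar> \<le> (t - u) * (e / 2)"
        using 3 by (simp add: abs_mult)
      have "P u f x - P t f x - P t (sub_laplacian f) x * (u - t)
          = - (P t f x - P u f x - (t - u) * P u (sub_laplacian f) x) - (t - u) * (P u (sub_laplacian f) x - P t (sub_laplacian f) x)"
        by (simp add: algebra_simps)
      then have "\<bar>P u f x - P t f x - P t (sub_laplacian f) x * (u - t)\<bar> \<le> e / 2 * (t - u) + (t - u) * (e / 2)"
        using 1 2 by linarith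
      also have "\<dots> = e * \<bar>u - t\<bar>" using 3 by (simp add: algebra_simps)
      finally show ?thesis by simp
    qed simp
  qed (use d1 d2 in auto)
qed

lemma conservative:
  assumes "0 \<le> t" "x \<in> sphere 0 1"
  shows "P t (\<lambda>_. 1) x = 1"
proof -
  have C0: "C (sub_laplacian (\<lambda>_. 1))"
    by (rule continuous_on_eq[of _ "\<lambda>_. 0"]) (auto simp: sub_laplacian_const)
  have "((\<lambda>t. P t (\<lambda>_. 1) x) has_real_derivative 0) (at t within {0..})" if "t \<in> {0..}" for t
  proof -
    \<comment> \<open>The sub-Laplacian of a constant is known to vanish on the sphere only, so
      contraction with bound 0 is applied.\<close>
    have "P t (sub_laplacian (\<lambda>_. 1)) x = 0"
      using contraction[OF C0, of t 0 x] that assms(2) sub_laplacian_const by auto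
    then show ?thesis
      using has_derivative_time[OF smooth_on_sphere_const C0 assms(2), of t] that by simp
  qed
  then have "\<exists>c. \<forall>t\<in>{0..}. P t (\<lambda>_. 1) x = c"
    by (intro has_field_derivative_zero_constant) auto
  then show ?thesis using at_0[of "\<lambda>_. 1" x] assms by force
qed

text \<open>If f takes values between 0 and M, then \<open>f - M / 2\<close> is bounded by
  \<open>M / 2\<close>. Contraction preserves this bound, and constants are preserved by
  \<open>conservative\<close>.\<close>

lemma nonneg:
  assumes f: "C f" and t: "0 \<le> t" and x: "x \<in> sphere 0 1" and f0: "\<And>x. x \<in> sphere 0 1 \<Longrightarrow> 0 \<le> f x"
  shows "0 \<le> P t f x"
proof -
  have "bounded (f ` sphere 0 1)"
    by (intro compact_imp_bounded compact_continuous_image f) simp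
  then obtain M where M: "\<And>x. x \<in> sphere 0 1 \<Longrightarrow> norm (f x) \<le> M" unfolding bounded_iff by blast
  have "\<bar>P t f x - P t (\<lambda>_. M / 2 * 1) x\<bar> \<le> M / 2"
  proof (rule contr_diff[OF f _ t x])
    fix y :: "'n qspace" assume y: "y \<in> sphere 0 1"
    show "\<bar>f y - M / 2 * 1\<bar> \<le> M / 2" using f0[OF y] M[OF y] unfolding real_norm_def by linarith
  qed simp
  moreover have "P t (\<lambda>_. M / 2 * 1) x = M / 2"
    using scale[of "\<lambda>_. 1" t x "M / 2", OF _ t x] conservative[OF t x] by simp
  ultimately show ?thesis by linarith
qed

end

section \<open>The resolvent of the approximate identity\<close>

definition conf_const :: "nat \<Rightarrow> real" where "conf_const n = 4 * real n * (real n + 1)"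

text \<open>The regularised Green function, scaled so that \<lambda> - L maps it to
  \<open>pkern s y\<close> on the sphere, where \<lambda> is \<open>conf_const\<close>.\<close>

definition gkern :: "real \<Rightarrow> 'n::finite qspace \<Rightarrow> 'n qspace \<Rightarrow> real"
  where "gkern s y x = kern (CARD('n) + 1) s y x / (conf_const CARD('n) * kern_mass CARD('n))"

lemma conf_const_pos [simp]: "0 < conf_const CARD('n::finite)"
  by (simp add: conf_const_def)

lemma conf_const_simps [simp]:
  "conf_const CARD('n::finite) \<noteq> 0" "\<bar>conf_const CARD('n)\<bar> = conf_const CARD('n)"
  using conf_const_pos[where 'n = 'n] by linarith+

lemma tendsto_exp_neg_at_top: "0 < c \<Longrightarrow> ((\<lambda>t::real. exp (- (c * t))) \<longlongrightarrow> 0) at_top"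
  by (rule filterlim_compose[OF exp_at_bot])
     (simp add: filterlim_uminus_at_bot filterlim_tendsto_pos_mult_at_top[OF tendsto_const _ filterlim_ident])

lemma set_integral_exp_Ioi:
  fixes c a :: real
  assumes "0 < c"
  shows "set_integrable lborel {a<..} (\<lambda>t. exp (- (c * t)))" "(LBINT t:{a<..}. exp (- (c * t))) = exp (- (c * a)) / c"
proof -
  have "((\<lambda>t. - exp (- (c * t)) / c) has_real_derivative exp (- (c * t))) (at t)" for t
    using assms by (auto intro!: derivative_eq_intros)
  moreover have "isCont (\<lambda>t. exp (- (c * t))) t" for t by (intro continuous_intros)
  moreover have "((\<lambda>t. - exp (- (c * t)) / c) \<longlongrightarrow> - exp (- (c * a)) / c) (at_right a)"
    by (intro tendsto_intros) (use assms in simp)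
  moreover have "((\<lambda>t. - exp (- (c * t)) / c) \<longlongrightarrow> - 0 / c) at_top"
    using assms by (intro tendsto_intros tendsto_exp_neg_at_top) auto
  ultimately show "set_integrable lborel {a<..} (\<lambda>t. exp (- (c * t)))" "(LBINT t:{a<..}. exp (- (c * t))) = exp (- (c * a)) / c"
    using set_integral_FTC_Ioi[of a "\<lambda>t. - exp (- (c * t)) / c" "\<lambda>t. exp (- (c * t))" "- exp (- (c * a)) / c" "- 0 / c"] by auto
qed

lemma set_integrable_exp_mult:
  fixes g :: "real \<Rightarrow> real"
  assumes c: "0 < c" and g: "continuous_on {0..} g" and M: "\<And>t. 0 \<le> t \<Longrightarrow> \<bar>g t\<bar> \<le> M"
  shows "set_integrable lborel {0<..} (\<lambda>t. exp (- (c * t)) * g t)"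
    and "\<bar>LBINT t:{0<..}. exp (- (c * t)) * g t\<bar> \<le> M / c"
proof -
  have "0 \<le> M" using M[of 0] by simp
  have e: "set_integrable lborel {0<..} (\<lambda>t. exp (- (c * t)) * M)"
    using set_integral_exp_Ioi(1)[OF c, of 0] by simp
  have le: "norm (exp (- (c * t)) * g t) \<le> exp (- (c * t)) * M" if "t \<in> {0<..}" for t
    using M[of t] that by (simp add: abs_mult mult_left_mono)
  have "continuous_on {0<..} (\<lambda>t. exp (- (c * t)) * g t)"
    by (intro continuous_intros continuous_on_subset[OF g]) auto
  then have "(\<lambda>t. indicator {0<..} t *\<^sub>R (exp (- (c * t)) * g t)) \<in> borel_measurable borel"
    by (rule borel_measurable_continuous_on_indicator[rotated]) simp
  then have "set_borel_measurable lborel {0<..} (\<lambda>t. exp (- (c * t)) * g t)"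
    by (simp add: set_borel_measurable_def)
  then show i: "set_integrable lborel {0<..} (\<lambda>t. exp (- (c * t)) * g t)"
    by (rule set_integrable_bound[OF e]) (use le \<open>0 \<le> M\<close> in \<open>auto intro!: AE_I2\<close>)
  have "\<bar>LBINT t:{0<..}. exp (- (c * t)) * g t\<bar> \<le> (LBINT t:{0<..}. norm (exp (- (c * t)) * g t))"
    using set_integral_norm_bound[OF i] by simp
  also have "\<dots> \<le> (LBINT t:{0<..}. exp (- (c * t)) * M)"
    by (rule set_integral_mono[OF set_integrable_norm[OF i] e le])
  also have "\<dots> = M / c" using set_integral_exp_Ioi(2)[OF c, of 0] by simp
  finally show "\<bar>LBINT t:{0<..}. exp (- (c * t)) * g t\<bar> \<le> M / c" .
qed

lemma bounded_sphere:
  fixes f :: "'a::euclidean_space \<Rightarrow> real"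
  assumes "continuous_on (sphere 0 1) f"
  shows "\<exists>M\<ge>0. \<forall>x\<in>sphere 0 1. \<bar>f x\<bar> \<le> M"
proof -
  have "bounded (f ` sphere 0 1)"
    by (intro compact_imp_bounded compact_continuous_image assms) simp
  then obtain M where M: "\<forall>x\<in>f ` sphere 0 1. norm x \<le> M" unfolding bounded_iff by blast
  have "\<bar>f x\<bar> \<le> max 0 M" if "x \<in> sphere 0 1" for x
    using bspec[OF M imageI[OF that]] by simp
  then show ?thesis by (intro exI[of _ "max 0 M"] conjI ballI) simp_all
qed

lemma continuous_on_gkern: "y \<in> sphere 0 1 \<Longrightarrow> 1 < s \<Longrightarrow> continuous_on (sphere 0 1) (gkern s y)"
  unfolding gkern_def divide_inverse by (intro continuous_on_mult continuous_on_const continuous_on_kern)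

lemma integral_gkern:
  fixes y :: "'n::finite qspace"
  assumes "y \<in> sphere 0 1" "1 < s"
  shows "conf_const CARD('n) * integral\<^sup>L sphere_measure (gkern s y) = integral\<^sup>L sphere_measure (pkern s y)"
  using conf_const_pos[where 'n = 'n] by (simp add: integral_pkern[OF assms] gkern_def[abs_def])

lemma integral_pkern_le_one:
  fixes y :: "'n::finite qspace"
  assumes "y \<in> sphere 0 1" "1 < s"
  shows "integral\<^sup>L sphere_measure (pkern s y) \<le> 1"
  using integral_kern_le[OF assms(1) refl assms(2)] kern_mass_pos[of "CARD('n)"]
  unfolding kern_mass_eq[OF refl, where 'n = 'n] integral_pkern[OF assms] by simp

text \<open>For \<open>s \<ge> 1\<close> the polynomial \<open>sdist\<close> increases in
  \<open>s\<close> because \<open>x \<bullet> y \<le> 1\<close>. The regularised Green functions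
  thus increase as s decreases to 1.\<close>

lemma gkern_antimono:
  assumes x: "x \<in> sphere 0 1" and y: "y \<in> sphere 0 1" and s: "1 < s" "s \<le> s'"
  shows "gkern s' y x \<le> gkern s y x"
proof -
  have "sdist s' y x - sdist s y x = (s' - s) * (s' + s - 2 * (x \<bullet> y))"
    by (simp add: sdist_def power2_eq_square algebra_simps)
  also have "\<dots> \<ge> 0" using s inner_sphere(2)[OF x y] by (intro mult_nonneg_nonneg) auto
  finally have "sdist s y x \<le> sdist s' y x" by simp
  then have "kern m s' y x \<le> kern m s y x" for m
    unfolding kern_def using sdist_pos[OF x y] s by (intro power_mono le_imp_inverse_le) (auto intro: less_imp_le)
  then show ?thesis
    unfolding gkern_def
    by (intro divide_right_mono mult_nonneg_nonneg less_imp_le[OF kern_mass_pos] less_imp_le[OF conf_const_pos])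
qed

context heat_flow
begin

text \<open>After division by \<lambda> times the mass, \<open>sub_laplacian_kern\<close> says that
  L maps \<open>gkern\<close> to \<lambda> \<open>gkern\<close> - \<open>pkern\<close>;
  \<open>P t\<close> is applied to this by linearity.\<close>

lemma gkern_derivative:
  assumes y: "y \<in> sphere 0 1" and s: "1 < s" and x: "x \<in> sphere 0 1" and t: "0 \<le> t"
  shows "((\<lambda>t. P t (gkern s y) x) has_real_derivative conf_const CARD('n) * P t (gkern s y) x - P t (pkern s y) x) (at t within {0..})"
proof -
  let ?K = "kern (CARD('n) + 1) s y"
  define m where "m = kern_mass CARD('n)"
  have m: "m \<noteq> 0" "conf_const CARD('n) \<noteq> 0"
    using kern_mass_pos[of "CARD('n)"] conf_const_pos[where 'n = 'n] by (simp_all add: m_def)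
  have cK: "C ?K" by (rule continuous_on_kern[OF y s])
  have cp: "C (pkern s y)" by (rule continuous_on_pkern[OF y s])
  have L: "sub_laplacian ?K z = conf_const CARD('n) * ?K z + (- conf_const CARD('n) * m) * pkern s y z" if "z \<in> sphere 0 1" for z
  proof -
    have mp: "(s\<^sup>2 - 1) * kern (CARD('n) + 2) s y z = m * pkern s y z"
      using m by (simp add: pkern_def m_def)
    show ?thesis
      unfolding sub_laplacian_kern[OF that y s refl] mp conf_const_def[symmetric]
      by (simp add: algebra_simps)
  qed
  have cR: "C (\<lambda>z. conf_const CARD('n) * ?K z + (- conf_const CARD('n) * m) * pkern s y z)"
    by (intro continuous_on_add continuous_on_mult continuous_on_const cK cp)
  have cL: "C (sub_laplacian ?K)"
    by (rule continuous_on_eq[OF cR]) (rule L[symmetric])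
  have g: "P u (gkern s y) x = 1 / (conf_const CARD('n) * m) * P u ?K x" if "0 \<le> u" for u
    using scale[OF cK that x, of "1 / (conf_const CARD('n) * m)"] by (simp add: gkern_def[abs_def] m_def)
  have "P t (sub_laplacian ?K) x = conf_const CARD('n) * P t ?K x + (- conf_const CARD('n) * m) * P t (pkern s y) x"
  proof -
    have "P t (sub_laplacian ?K) x = P t (\<lambda>z. conf_const CARD('n) * ?K z + (- conf_const CARD('n) * m) * pkern s y z) x"
      by (rule cong[OF cL cR t x]) (rule L)
    also have "\<dots> = conf_const CARD('n) * P t ?K x + (- conf_const CARD('n) * m) * P t (pkern s y) x"
      by (rule linear_combination[OF cK cp t x])
    finally show ?thesis .
  qed
  then have "((\<lambda>t. P t ?K x) has_real_derivative conf_const CARD('n) * P t ?K x + (- conf_const CARD('n) * m) * P t (pkern s y) x) (at t within {0..})"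
    using has_derivative_time[OF smooth_on_sphere_kern[OF y s] cL x t] by simp
  then have "((\<lambda>t. 1 / (conf_const CARD('n) * m) * P t ?K x) has_real_derivative
      1 / (conf_const CARD('n) * m) * (conf_const CARD('n) * P t ?K x + (- conf_const CARD('n) * m) * P t (pkern s y) x)) (at t within {0..})"
    by (rule DERIV_cmult)
  moreover have "1 / (conf_const CARD('n) * m) * (conf_const CARD('n) * P t ?K x + (- conf_const CARD('n) * m) * P t (pkern s y) x) = conf_const CARD('n) * P t (gkern s y) x - P t (pkern s y) x"
    using m g[OF t] by (simp add: field_simps)
  ultimately have "((\<lambda>t. 1 / (conf_const CARD('n) * m) * P t ?K x) has_real_derivative conf_const CARD('n) * P t (gkern s y) x - P t (pkern s y) x) (at t within {0..})"
    by simp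
  then show ?thesis
    by (rule has_field_derivative_transform_within[OF _ zero_less_one]) (use g t in auto)
qed

lemma at_within_nonneg: "0 < t \<Longrightarrow> at t within {0..} = at (t::real)"
  by (rule at_within_interior) simp

lemma tendsto_at_right_nonneg:
  fixes g :: "real \<Rightarrow> real"
  assumes "continuous_on {0..} g" "0 \<le> a"
  shows "(g \<longlongrightarrow> g a) (at_right a)"
proof -
  have "(g \<longlongrightarrow> g a) (at a within {0..})" using assms by (simp add: continuous_on_def)
  then show ?thesis by (rule tendsto_within_subset) (use assms(2) in auto)
qed

text \<open>The differential equation says that exp(-\<lambda>t) h(t) is the derivative of
  -exp(-\<lambda>t) g(t). It is stated for real functions because it serves both for values of the
  flow at a point and for integrals over the sphere.\<close>

lemma set_integral_resolvent:
  fixes g h :: "real \<Rightarrow> real"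
  assumes g: "continuous_on {0..} g" and h: "continuous_on {0..} h"
    and der: "\<And>t. 0 < t \<Longrightarrow> (g has_real_derivative conf_const CARD('n) * g t - h t) (at t)"
    and h0: "\<And>t. 0 \<le> t \<Longrightarrow> 0 \<le> h t" and M: "\<And>t. 0 \<le> t \<Longrightarrow> \<bar>g t\<bar> \<le> M" and a: "0 \<le> a"
  shows "set_integrable lborel {a<..} (\<lambda>t. exp (- (conf_const CARD('n) * t)) * h t)"
    and "(LBINT t:{a<..}. exp (- (conf_const CARD('n) * t)) * h t) = exp (- (conf_const CARD('n) * a)) * g a"
proof -
  define F where "F t = - (exp (- (conf_const CARD('n) * t)) * g t)" for t
  have dF: "(F has_real_derivative exp (- (conf_const CARD('n) * t)) * h t) (at t)" if "a < t" for t
  proof -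
    have e: "((\<lambda>t. exp (- (conf_const CARD('n) * t))) has_real_derivative exp (- (conf_const CARD('n) * t)) * (- conf_const CARD('n))) (at t)"
      by (auto intro!: derivative_eq_intros)
    have "(g has_real_derivative conf_const CARD('n) * g t - h t) (at t)"
      by (rule der) (use that a in simp)
    from DERIV_minus[OF DERIV_mult[OF e this]] show ?thesis
      unfolding F_def by (rule DERIV_cong) (simp add: algebra_simps)
  qed
  have ch: "isCont (\<lambda>t. exp (- (conf_const CARD('n) * t)) * h t) t" if "a < t" for t
    by (intro continuous_intros continuous_on_interior[OF h]) (use that a in simp)
  have cF: "continuous_on {0..} F" unfolding F_def by (intro continuous_intros g)
  have lim0: "(F \<longlongrightarrow> F a) (at_right a)" by (rule tendsto_at_right_nonneg[OF cF a])
  have "((\<lambda>t. exp (- (conf_const CARD('n) * t)) * M) \<longlongrightarrow> 0 * M) at_top"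
    by (intro tendsto_mult_right tendsto_exp_neg_at_top conf_const_pos)
  then have lim_exp: "((\<lambda>t. exp (- (conf_const CARD('n) * t)) * M) \<longlongrightarrow> 0) at_top" by simp
  have "\<forall>\<^sub>F t in at_top. norm (F t) \<le> exp (- (conf_const CARD('n) * t)) * M"
    using eventually_ge_at_top[of "0::real"]
  proof eventually_elim
    case (elim t)
    then show ?case using M[OF elim] by (simp add: F_def abs_mult)
  qed
  then have limT: "(F \<longlongrightarrow> 0) at_top"
    by (rule Lim_null_comparison[OF _ lim_exp])
  have nn: "0 \<le> exp (- (conf_const CARD('n) * t)) * h t" if "a < t" for t using h0[of t] that a by simp
  show "set_integrable lborel {a<..} (\<lambda>t. exp (- (conf_const CARD('n) * t)) * h t)"
    by (rule set_integral_FTC_Ioi(1)[OF dF ch nn lim0 limT])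
  have "(LBINT t:{a<..}. exp (- (conf_const CARD('n) * t)) * h t) = 0 - F a"
    by (rule set_integral_FTC_Ioi(2)[OF dF ch nn lim0 limT])
  then show "(LBINT t:{a<..}. exp (- (conf_const CARD('n) * t)) * h t) = exp (- (conf_const CARD('n) * a)) * g a"
    by (simp add: F_def)
qed

lemma resolvent_pkern:
  assumes y: "y \<in> sphere 0 1" and s: "1 < s" and x: "x \<in> sphere 0 1" and a: "0 \<le> a"
  shows "set_integrable lborel {a<..} (\<lambda>t. exp (- (conf_const CARD('n) * t)) * P t (pkern s y) x)"
    and "(LBINT t:{a<..}. exp (- (conf_const CARD('n) * t)) * P t (pkern s y) x) = exp (- (conf_const CARD('n) * a)) * P a (gkern s y) x"
proof -
  have cg: "C (gkern s y)" and cp: "C (pkern s y)"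
    by (rule continuous_on_gkern[OF y s] continuous_on_pkern[OF y s])+
  obtain M where M: "\<forall>x\<in>sphere 0 1. \<bar>gkern s y x\<bar> \<le> M" using bounded_sphere[OF cg] by blast
  have "((\<lambda>t. P t (gkern s y) x) has_real_derivative conf_const CARD('n) * P t (gkern s y) x - P t (pkern s y) x) (at t)" if "0 < t" for t
    using gkern_derivative[OF y s x, of t] that by (simp add: at_within_nonneg)
  note h = set_integral_resolvent[OF continuous_time[OF cg x] continuous_time[OF cp x] this
      nonneg[OF cp _ x pkern_nonneg[OF _ y s]] contraction[OF cg _ bspec[OF M] x] a]
  show "set_integrable lborel {a<..} (\<lambda>t. exp (- (conf_const CARD('n) * t)) * P t (pkern s y) x)"
    and "(LBINT t:{a<..}. exp (- (conf_const CARD('n) * t)) * P t (pkern s y) x) = exp (- (conf_const CARD('n) * a)) * P a (gkern s y) x"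
    by (rule h; assumption)+
qed

section \<open>Invariance of the volume under the flow\<close>

lemma continuous_integral_time:
  assumes f: "C f"
  shows "continuous_on {0..} (\<lambda>t. integral\<^sup>L sphere_measure (P t f))"
proof (rule continuous_on_iff[THEN iffD2], intro ballI allI impI)
  fix t e :: real assume t: "t \<in> {0..}" and e: "0 < e"
  define v where "v = sphere_vol TYPE('n)"
  have v: "0 \<le> v" by (simp add: v_def)
  have "0 < e / (v + 1)" using e v by simp
  from equicontinuous[OF f this]
  obtain d where d: "0 < d" "\<forall>a b. \<forall>x\<in>sphere 0 1. 0 \<le> a \<longrightarrow> 0 \<le> b \<longrightarrow> \<bar>a - b\<bar> < d \<longrightarrow> \<bar>P a f x - P b f x\<bar> \<le> e / (v + 1)"
    by (elim exE conjE)
  show "\<exists>d>0. \<forall>t'\<in>{0..}. dist t' t < d \<longrightarrow> dist (integral\<^sup>L sphere_measure (P t' f)) (integral\<^sup>L sphere_measure (P t f)) < e"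
  proof (intro exI[of _ d] conjI ballI impI d(1))
    fix t' assume t': "t' \<in> {0..}" "dist t' t < d"
    have c: "C (P t' f)" "C (P t f)" using t t' by (auto intro: continuous_flow[OF f])
    have "\<bar>integral\<^sup>L sphere_measure (P t' f) - integral\<^sup>L sphere_measure (P t f)\<bar> = \<bar>\<integral>x. P t' f x - P t f x \<partial>sphere_measure\<bar>"
      using c by (simp add: integrable_sphere_measure)
    also have "\<dots> \<le> (\<integral>x. \<bar>P t' f x - P t f x\<bar> \<partial>sphere_measure)" by (rule integral_abs_bound)
    also have "\<dots> \<le> e / (v + 1) * v"
      unfolding v_def
    proof (rule integral_sphere_bounds(1))
      fix x :: "'n qspace" assume "x \<in> sphere 0 1"
      then show "\<bar>P t' f x - P t f x\<bar> \<le> e / (sphere_vol TYPE('n) + 1)"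
        using t t' d(2)[rule_format, of x t' t] by (simp add: v_def dist_real_def)
    qed (intro continuous_intros c)
    also have "\<dots> < e" using e v by (simp add: field_simps)
    finally show "dist (integral\<^sup>L sphere_measure (P t' f)) (integral\<^sup>L sphere_measure (P t f)) < e"
      by (simp add: dist_real_def)
  qed
qed

lemma integral_contr:
  assumes f: "C f" and t: "0 \<le> t" and M: "\<And>x. x \<in> sphere 0 1 \<Longrightarrow> \<bar>f x\<bar> \<le> M"
  shows "\<bar>integral\<^sup>L sphere_measure (P t f)\<bar> \<le> M * sphere_vol TYPE('n)"
proof -
  have "\<bar>integral\<^sup>L sphere_measure (P t f)\<bar> \<le> (\<integral>x. \<bar>P t f x\<bar> \<partial>sphere_measure)" by (rule integral_abs_bound)
  also have "\<dots> \<le> M * sphere_vol TYPE('n)"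
    by (rule integral_sphere_bounds(1)) (intro continuous_intros continuous_flow f t, rule contraction[OF f t M])
  finally show ?thesis .
qed

lemma integral_gkern_derivative:
  assumes y: "y \<in> sphere 0 1" and s: "1 < s" and t: "0 < t"
  shows "((\<lambda>t. integral\<^sup>L sphere_measure (P t (gkern s y))) has_real_derivative
    conf_const CARD('n) * integral\<^sup>L sphere_measure (P t (gkern s y)) - integral\<^sup>L sphere_measure (P t (pkern s y))) (at t)"
proof -
  have cg: "C (gkern s y)" and cp: "C (pkern s y)"
    by (rule continuous_on_gkern[OF y s] continuous_on_pkern[OF y s])+
  obtain M where M: "\<forall>x\<in>sphere 0 1. \<bar>gkern s y x\<bar> \<le> M" using bounded_sphere[OF cg] by blast
  obtain M' where M': "\<forall>x\<in>sphere 0 1. \<bar>pkern s y x\<bar> \<le> M'" using bounded_sphere[OF cp] by blast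
  have "((\<lambda>t. integral\<^sup>L sphere_measure (P t (gkern s y))) has_real_derivative
      (\<integral>x. conf_const CARD('n) * P t (gkern s y) x - P t (pkern s y) x \<partial>sphere_measure)) (at t)"
  proof (rule has_real_derivative_integral[OF sphere_measure.finite_measure_axioms,
        where T = "{0<..}" and h = "\<lambda>t. P t (gkern s y)" and h' = "\<lambda>t x. conf_const CARD('n) * P t (gkern s y) x - P t (pkern s y) x" and C = "conf_const CARD('n) * M + M'"])
    fix t :: real assume t: "t \<in> {0<..}"
    then have t0: "0 < t" "0 \<le> t" by auto
    show "integrable sphere_measure (P t (gkern s y))"
      by (intro integrable_sphere_measure continuous_flow cg t0)
    fix x assume "x \<in> space (sphere_measure :: 'n qspace measure)"
    then have x: "x \<in> sphere 0 1" by simp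
    show "((\<lambda>t. P t (gkern s y) x) has_real_derivative conf_const CARD('n) * P t (gkern s y) x - P t (pkern s y) x) (at t)"
      using gkern_derivative[OF y s x t0(2)] t0 by (simp add: at_within_nonneg)
    have "\<bar>conf_const CARD('n) * P t (gkern s y) x\<bar> \<le> conf_const CARD('n) * M"
      using contraction[OF cg t0(2) bspec[OF M] x] conf_const_pos[where 'n = 'n] by (simp add: abs_mult)
    moreover have "\<bar>P t (pkern s y) x\<bar> \<le> M'" by (rule contraction[OF cp t0(2) bspec[OF M'] x])
    ultimately show "\<bar>conf_const CARD('n) * P t (gkern s y) x - P t (pkern s y) x\<bar> \<le> conf_const CARD('n) * M + M'" by linarith
  qed (use t in auto)
  then show ?thesis
    using t by (simp add: integrable_sphere_measure continuous_flow cg cp)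
qed

text \<open>Invariance averaged over time. For \<open>h = pkern s y\<close> the time integral is the
  integral of \<open>gkern s y\<close>, so the claim is \<open>integral_gkern\<close>; both sides
  are bounded linear functionals of \<open>h\<close>, and \<open>pkern_functional_zero\<close> does
  the rest.\<close>

lemma resolvent_invariant:
  assumes h: "C h"
  shows "conf_const CARD('n) * (LBINT t:{0<..}. exp (- (conf_const CARD('n) * t)) * integral\<^sup>L sphere_measure (P t h)) = integral\<^sup>L sphere_measure h"
proof -
  define R where "R h = (LBINT t:{0<..}. exp (- (conf_const CARD('n) * t)) * integral\<^sup>L sphere_measure (P t h))" for h
  define v where "v = sphere_vol TYPE('n)"
  have lp: "0 < conf_const CARD('n)" by (rule conf_const_pos)
  have RI: "set_integrable lborel {0<..} (\<lambda>t. exp (- (conf_const CARD('n) * t)) * integral\<^sup>L sphere_measure (P t f))" if f: "C f" for f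
  proof -
    obtain M where M: "\<forall>x\<in>sphere 0 1. \<bar>f x\<bar> \<le> M" using bounded_sphere[OF f] by blast
    show ?thesis
      by (rule set_integrable_exp_mult(1)[OF lp continuous_integral_time[OF f] integral_contr[OF f _ bspec[OF M]]])
  qed
  have "conf_const CARD('n) * R h - integral\<^sup>L sphere_measure h = 0"
  proof (rule pkern_functional_zero[where \<Phi> = "\<lambda>h. conf_const CARD('n) * R h - integral\<^sup>L sphere_measure h" and K = "2 * v", OF _ _ _ _ h])
    fix f g :: "'n qspace \<Rightarrow> real" assume f: "C f" and g: "C g"
    have "R (\<lambda>x. f x + g x) = (LBINT t:{0<..}. exp (- (conf_const CARD('n) * t)) * integral\<^sup>L sphere_measure (P t f)
        + exp (- (conf_const CARD('n) * t)) * integral\<^sup>L sphere_measure (P t g))"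
      unfolding R_def
    proof (rule set_lebesgue_integral_cong)
      show "\<forall>t. t \<in> {0<..} \<longrightarrow> exp (- (conf_const CARD('n) * t)) * integral\<^sup>L sphere_measure (P t (\<lambda>x. f x + g x))
        = exp (- (conf_const CARD('n) * t)) * integral\<^sup>L sphere_measure (P t f) + exp (- (conf_const CARD('n) * t)) * integral\<^sup>L sphere_measure (P t g)"
      proof (intro allI impI)
        fix t :: real assume "t \<in> {0<..}"
        then have t: "0 \<le> t" by simp
        have "integral\<^sup>L sphere_measure (P t (\<lambda>x. f x + g x)) = (\<integral>x. P t f x + P t g x \<partial>sphere_measure)"
          by (intro Bochner_Integration.integral_cong refl add[OF f g t]) simp
        also have "\<dots> = integral\<^sup>L sphere_measure (P t f) + integral\<^sup>L sphere_measure (P t g)"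
          by (intro Bochner_Integration.integral_add integrable_sphere_measure continuous_flow f g t)
        finally show "exp (- (conf_const CARD('n) * t)) * integral\<^sup>L sphere_measure (P t (\<lambda>x. f x + g x))
          = exp (- (conf_const CARD('n) * t)) * integral\<^sup>L sphere_measure (P t f) + exp (- (conf_const CARD('n) * t)) * integral\<^sup>L sphere_measure (P t g)"
          by (simp add: distrib_left)
      qed
    qed simp
    then have "R (\<lambda>x. f x + g x) = R f + R g"
      unfolding R_def by (simp add: set_integral_add(2)[OF RI[OF f] RI[OF g]])
    moreover have "(\<integral>x. f x + g x \<partial>sphere_measure) = integral\<^sup>L sphere_measure f + integral\<^sup>L sphere_measure g"
      by (intro Bochner_Integration.integral_add integrable_sphere_measure f g)
    ultimately show "conf_const CARD('n) * R (\<lambda>x. f x + g x) - (\<integral>x. f x + g x \<partial>sphere_measure)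
      = (conf_const CARD('n) * R f - integral\<^sup>L sphere_measure f) + (conf_const CARD('n) * R g - integral\<^sup>L sphere_measure g)"
      by (simp add: algebra_simps)
  next
    fix f :: "'n qspace \<Rightarrow> real" and c :: real assume f: "C f"
    have "R (\<lambda>x. c * f x) = (LBINT t:{0<..}. c * (exp (- (conf_const CARD('n) * t)) * integral\<^sup>L sphere_measure (P t f)))"
      unfolding R_def
    proof (rule set_lebesgue_integral_cong)
      show "\<forall>t. t \<in> {0<..} \<longrightarrow> exp (- (conf_const CARD('n) * t)) * integral\<^sup>L sphere_measure (P t (\<lambda>x. c * f x))
        = c * (exp (- (conf_const CARD('n) * t)) * integral\<^sup>L sphere_measure (P t f))"
      proof (intro allI impI)
        fix t :: real assume "t \<in> {0<..}"
        then have t: "0 \<le> t" by simp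
        have "integral\<^sup>L sphere_measure (P t (\<lambda>x. c * f x)) = (\<integral>x. c * P t f x \<partial>sphere_measure)"
          by (intro Bochner_Integration.integral_cong refl scale[OF f t]) simp
        then show "exp (- (conf_const CARD('n) * t)) * integral\<^sup>L sphere_measure (P t (\<lambda>x. c * f x))
          = c * (exp (- (conf_const CARD('n) * t)) * integral\<^sup>L sphere_measure (P t f))" by simp
      qed
    qed simp
    then show "conf_const CARD('n) * R (\<lambda>x. c * f x) - (\<integral>x. c * f x \<partial>sphere_measure) = c * (conf_const CARD('n) * R f - integral\<^sup>L sphere_measure f)"
      unfolding R_def by (simp add: algebra_simps)
  next
    fix f :: "'n qspace \<Rightarrow> real" and M assume f: "C f" and M: "\<And>x. x \<in> sphere 0 1 \<Longrightarrow> \<bar>f x\<bar> \<le> M"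
    have "\<bar>R f\<bar> \<le> M * v / conf_const CARD('n)"
      unfolding R_def v_def
      by (rule set_integrable_exp_mult(2)[OF lp continuous_integral_time[OF f] integral_contr[OF f _ M]])
    then have "\<bar>conf_const CARD('n) * R f\<bar> \<le> M * v" using lp by (simp add: abs_mult pos_le_divide_eq mult.commute)
    moreover have "\<bar>integral\<^sup>L sphere_measure f\<bar> \<le> M * v"
    proof -
      have "integral\<^sup>L sphere_measure f = integral\<^sup>L sphere_measure (P 0 f)"
        by (intro Bochner_Integration.integral_cong refl) (simp add: at_0[OF f])
      then show ?thesis using integral_contr[OF f order_refl M] by (simp add: v_def)
    qed
    ultimately show "\<bar>conf_const CARD('n) * R f - integral\<^sup>L sphere_measure f\<bar> \<le> 2 * v * M" by (simp add: mult.commute)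
  next
    fix s :: real and y :: "'n qspace" assume s: "1 < s" and y: "y \<in> sphere 0 1"
    have cg: "C (gkern s y)" and cp: "C (pkern s y)"
      by (rule continuous_on_gkern[OF y s] continuous_on_pkern[OF y s])+
    obtain M where M: "\<forall>x\<in>sphere 0 1. \<bar>gkern s y x\<bar> \<le> M" using bounded_sphere[OF cg] by blast
    have "R (pkern s y) = exp (- (conf_const CARD('n) * 0)) * integral\<^sup>L sphere_measure (P 0 (gkern s y))"
      unfolding R_def
      by (rule set_integral_resolvent(2)[OF continuous_integral_time[OF cg] continuous_integral_time[OF cp]
            integral_gkern_derivative[OF y s] _ integral_contr[OF cg _ bspec[OF M]] order_refl])
         (auto intro!: Bochner_Integration.integral_nonneg nonneg[OF cp] pkern_nonneg y s)
    also have "integral\<^sup>L sphere_measure (P 0 (gkern s y)) = integral\<^sup>L sphere_measure (gkern s y)"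
      by (intro Bochner_Integration.integral_cong refl) (simp add: at_0[OF cg])
    finally show "conf_const CARD('n) * R (pkern s y) - integral\<^sup>L sphere_measure (pkern s y) = 0"
      using integral_gkern[OF y s] by simp
  qed
  then show ?thesis by (simp add: R_def)
qed

lemma integral_pkern_invariant:
  assumes y: "y \<in> sphere 0 1" and s: "1 < s" and t: "0 \<le> t"
  shows "integral\<^sup>L sphere_measure (P t (pkern s y)) = integral\<^sup>L sphere_measure (pkern s y)"
proof -
  \<comment> \<open>The resolvent identity gives \<open>h = \<lambda> g\<close>, whence \<open>g' = \<lambda> g - h = 0\<close>.\<close>
  have cg: "C (gkern s y)" and cp: "C (pkern s y)"
    by (rule continuous_on_gkern[OF y s] continuous_on_pkern[OF y s])+
  obtain M where M: "\<forall>x\<in>sphere 0 1. \<bar>gkern s y x\<bar> \<le> M" using bounded_sphere[OF cg] by blast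
  define g where "g t = integral\<^sup>L sphere_measure (P t (gkern s y))" for t
  define h where "h t = integral\<^sup>L sphere_measure (P t (pkern s y))" for t
  have gc: "continuous_on {0..} g" and hc: "continuous_on {0..} h"
    unfolding g_def h_def by (rule continuous_integral_time[OF cg] continuous_integral_time[OF cp])+
  have dg: "(g has_real_derivative conf_const CARD('n) * g t - h t) (at t)" if "0 < t" for t
    unfolding g_def h_def by (rule integral_gkern_derivative[OF y s that])
  \<comment> \<open>The averaged invariance is applied to \<open>P t (pkern s y)\<close>, which is
    merely continuous; this is where its validity beyond the functions \<open>pkern\<close> is
    needed.\<close>
  have hg: "h t = conf_const CARD('n) * g t" if t: "0 \<le> t" for t
  proof -
    have shift: "continuous_on {0..} (\<lambda>u. g (t + u))" "continuous_on {0..} (\<lambda>u. h (t + u))"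
      using t by (auto intro!: continuous_on_compose2[OF gc] continuous_on_compose2[OF hc] continuous_intros)
    have "((\<lambda>u. g (t + u)) has_real_derivative conf_const CARD('n) * g (t + u) - h (t + u)) (at u)" if "0 < u" for u
    proof -
      have d1: "((\<lambda>u. t + u) has_real_derivative 1) (at u)" by (auto intro!: derivative_eq_intros)
      have d2: "(g has_real_derivative conf_const CARD('n) * g (t + u) - h (t + u)) (at (t + u))"
        by (rule dg) (use t that in simp)
      show ?thesis
        using DERIV_chain2[where f = g and g = "\<lambda>u. t + u", OF d2 d1] by simp
    qed
    then have "(LBINT u:{0<..}. exp (- (conf_const CARD('n) * u)) * h (t + u)) = exp (- (conf_const CARD('n) * 0)) * g (t + 0)"
    proof (rule set_integral_resolvent(2)[OF shift])
      show "0 \<le> h (t + u)" if "0 \<le> u" for u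
        unfolding h_def using that t
        by (auto intro!: Bochner_Integration.integral_nonneg nonneg[OF cp] pkern_nonneg y s)
      show "\<bar>g (t + u)\<bar> \<le> M * sphere_vol TYPE('n)" if "0 \<le> u" for u
        unfolding g_def using that t by (intro integral_contr[OF cg _ bspec[OF M]]) auto
    qed auto
    moreover have "(LBINT u:{0<..}. exp (- (conf_const CARD('n) * u)) * h (t + u))
        = (LBINT u:{0<..}. exp (- (conf_const CARD('n) * u)) * integral\<^sup>L sphere_measure (P u (P t (pkern s y))))"
    proof (rule set_lebesgue_integral_cong)
      have "h (t + u) = integral\<^sup>L sphere_measure (P u (P t (pkern s y)))" if "0 < u" for u
        unfolding h_def using that semigroup_law[OF cp, of u t] t
        by (intro Bochner_Integration.integral_cong refl) (simp add: add.commute)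
      then show "\<forall>u. u \<in> {0<..} \<longrightarrow> exp (- (conf_const CARD('n) * u)) * h (t + u)
          = exp (- (conf_const CARD('n) * u)) * integral\<^sup>L sphere_measure (P u (P t (pkern s y)))" by simp
    qed simp
    ultimately show ?thesis
      using resolvent_invariant[OF continuous_flow[OF cp t]] by (simp add: h_def)
  qed
  have "g t = g 0"
  proof (cases "t = 0")
    case False
    show ?thesis
    proof (rule DERIV_isconst_end[of 0 t g])
      show "0 < t" using False t by simp
      show "continuous_on {0..t} g" by (rule continuous_on_subset[OF gc]) auto
      show "(g has_real_derivative 0) (at x)" if "0 < x" "x < t" for x
        using dg[OF that(1)] hg[of x] that by simp
    qed
  qed simp
  then have "h t = h 0" using hg[OF t] hg[of 0] by simp
  also have "h 0 = integral\<^sup>L sphere_measure (pkern s y)"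
    unfolding h_def by (intro Bochner_Integration.integral_cong refl) (simp add: at_0[OF cp])
  finally show ?thesis by (simp add: h_def)
qed

end

section \<open>The Green function\<close>

lemma north_pole_sphere: "north_pole \<in> sphere 0 1"
  by (simp add: north_pole_def norm_Pair)

lemma sdist_north_pole:
  "sdist 1 q north_pole = 1 - 2 * qRe (snd q) + (norm (snd q))\<^sup>2"
proof -
  have h: "hdot north_pole q = qcnj (snd q)"
    by (simp add: hdot_def north_pole_def qmult_def flip: zero_prod_def) (simp add: q_one_def)
  have "north_pole \<bullet> q = qRe (snd q)"
    by (simp add: north_pole_def inner_qspace q_one_def qRe_def inner_prod_def inner_complex_def)
  then show ?thesis by (simp add: sdist_def h)
qed

definition green_limit :: "'n::finite qspace \<Rightarrow> 'n qspace \<Rightarrow> real"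
  where "green_limit y x = inverse (sdist 1 y x) ^ (CARD('n) + 1) / (conf_const CARD('n) * kern_mass CARD('n))"

lemma tendsto_gkern:
  assumes "sdist 1 y x \<noteq> 0"
  shows "((\<lambda>s. gkern s y x) \<longlongrightarrow> green_limit y x) (at_right 1)"
proof -
  have "((\<lambda>s. sdist s y x) \<longlongrightarrow> sdist 1 y x) (at_right 1)"
    unfolding sdist_def by (intro tendsto_intros)
  then show ?thesis
    unfolding gkern_def green_limit_def kern_def
    using assms kern_mass_pos[of "CARD('a)"] by (intro tendsto_intros) simp_all
qed

locale heat_flow_kernel = heat_flow P for P :: "real \<Rightarrow> ('n::finite qspace \<Rightarrow> real) \<Rightarrow> 'n qspace \<Rightarrow> real" +
  fixes p :: "real \<Rightarrow> 'n qspace \<Rightarrow> real"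
  assumes continuous_p: "0 < t \<Longrightarrow> continuous_on (sphere 0 1) (p t)"
    and kernel: "0 < t \<Longrightarrow> continuous_on (sphere 0 1) f \<Longrightarrow> P t f north_pole = (\<integral>x. p t x * f x \<partial>sphere_measure)"
begin

text \<open>The kernel at the north pole is tested against the approximate identity at
  \<open>q\<close>; continuity of \<open>p t\<close> alone recovers its value there.\<close>

lemma tendsto_p:
  assumes q: "q \<in> sphere 0 1" and t: "0 < t"
  shows "((\<lambda>s. P t (pkern s q) north_pole) \<longlongrightarrow> p t q) (at_right 1)"
proof (rule tendstoI)
  fix e :: real assume e: "0 < e"
  from pkern_approximate_identity[OF continuous_p[OF t] e] eventually_at_right_one(1)
  show "\<forall>\<^sub>F s in at_right 1. dist (P t (pkern s q) north_pole) (p t q) < e"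
  proof eventually_elim
    case (elim s)
    have "P t (pkern s q) north_pole = (\<integral>x. pkern s q x * p t x \<partial>sphere_measure)"
      using kernel[OF t continuous_on_pkern[OF q elim(2)]] by (simp add: mult.commute)
    then show ?case using bspec[OF elim(1) q] by (simp add: dist_real_def)
  qed
qed

text \<open>The time is split as a + (t - a). The flow for time t - a keeps the approximate identity
  nonnegative with mass at most 1, and the remaining step integrates it against the bounded function
  \<open>p a\<close>.\<close>

lemma pkern_flow_bounded:
  assumes q: "q \<in> sphere 0 1" and a: "0 < a"
  obtains M where "0 \<le> M" "\<And>s t. 1 < s \<Longrightarrow> a \<le> t \<Longrightarrow> \<bar>P t (pkern s q) north_pole\<bar> \<le> M"
proof -
  obtain M where M: "0 \<le> M" "\<forall>x\<in>sphere 0 1. \<bar>p a x\<bar> \<le> M"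
    using bounded_sphere[OF continuous_p[OF a]] by (elim exE conjE)
  have "\<bar>P t (pkern s q) north_pole\<bar> \<le> M" if s: "1 < s" and t: "a \<le> t" for s t
  proof -
    define f where "f = P (t - a) (pkern s q)"
    have cp: "C (pkern s q)" by (rule continuous_on_pkern[OF q s])
    have cf: "C f" unfolding f_def by (rule continuous_flow[OF cp]) (use t in simp)
    have f0: "0 \<le> f x" if "x \<in> sphere 0 1" for x
      unfolding f_def by (rule nonneg[OF cp _ that pkern_nonneg[OF _ q s]]) (use t in auto)
    have "P t (pkern s q) north_pole = P a f north_pole"
      using semigroup_law[OF cp, of a "t - a" north_pole] t a north_pole_sphere by (simp add: f_def)
    then have "\<bar>P t (pkern s q) north_pole\<bar> = \<bar>\<integral>x. p a x * f x \<partial>sphere_measure\<bar>"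
      using kernel[OF a cf] by simp
    also have "\<dots> \<le> (\<integral>x. \<bar>p a x * f x\<bar> \<partial>sphere_measure)" by (rule integral_abs_bound)
    also have "\<dots> \<le> (\<integral>x. M * f x \<partial>sphere_measure)"
    proof (rule integral_sphere_measure_mono)
      show "C (\<lambda>x. \<bar>p a x * f x\<bar>)" "C (\<lambda>x. M * f x)"
        by (intro continuous_intros continuous_p a cf)+
      fix x :: "'n qspace" assume x: "x \<in> sphere 0 1"
      show "\<bar>p a x * f x\<bar> \<le> M * f x"
        using bspec[OF M(2) x] f0[OF x] by (simp add: abs_mult mult_right_mono)
    qed
    also have "\<dots> = M * integral\<^sup>L sphere_measure (pkern s q)"
      using integral_pkern_invariant[OF q s, of "t - a"] t by (simp add: f_def)
    also have "\<dots> \<le> M * 1" by (intro mult_left_mono integral_pkern_le_one q s M)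
    finally show ?thesis by simp
  qed
  then show thesis by (intro that[OF M(1)])
qed

text \<open>For times beyond \<open>a\<close> the integrands are dominated by a constant times the
  exponential. The constant depends on \<open>a\<close>, so the limit s \<rightarrow> 1 is taken
  before a \<rightarrow> 0.\<close>

lemma set_integral_kernel_Ioi:
  assumes q: "q \<in> sphere 0 1" and a: "0 < a"
    and X: "filterlim X (at_right 1) sequentially" "\<And>j. 1 < X j"
  shows "set_integrable lborel {a<..} (\<lambda>t. exp (- (conf_const CARD('n) * t)) * p t q)"
    and "(\<lambda>j. exp (- (conf_const CARD('n) * a)) * P a (gkern (X j) q) north_pole)
      \<longlonglongrightarrow> (LBINT t:{a<..}. exp (- (conf_const CARD('n) * t)) * p t q)"
proof -
  let ?w = "\<lambda>t. exp (- (conf_const CARD('n) * t))"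
  define u where "u j t = indicator {a<..} t *\<^sub>R (?w t * P t (pkern (X j) q) north_pole)" for j t
  define v where "v t = indicator {a<..} t *\<^sub>R (?w t * p t q)" for t
  obtain M where M: "0 \<le> M" "\<And>s t. 1 < s \<Longrightarrow> a \<le> t \<Longrightarrow> \<bar>P t (pkern s q) north_pole\<bar> \<le> M"
    using pkern_flow_bounded[OF q a] by metis
  have int: "integrable lborel (u j)" for j
    using resolvent_pkern(1)[OF q X(2) north_pole_sphere less_imp_le[OF a]]
    by (simp add: u_def[abs_def] set_integrable_def)
  have w: "integrable lborel (\<lambda>t. indicator {a<..} t *\<^sub>R (?w t * M))"
  proof -
    have "set_integrable lborel {a<..} (\<lambda>t. ?w t * M)"
      using set_integral_exp_Ioi(1)[OF conf_const_pos[where 'n = 'n], of a] by simp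
    then show ?thesis by (simp add: set_integrable_def)
  qed
  have lim: "(\<lambda>j. u j t) \<longlonglongrightarrow> v t" for t
  proof (cases "a < t")
    case True
    have "(\<lambda>j. P t (pkern (X j) q) north_pole) \<longlonglongrightarrow> p t q"
      by (rule filterlim_compose[OF tendsto_p[OF q] X(1)]) (use True a in simp)
    then show ?thesis unfolding u_def v_def by (intro tendsto_intros)
  qed (simp add: u_def v_def)
  have meas: "v \<in> borel_measurable lborel"
    by (rule borel_measurable_LIMSEQ_metric[OF _ lim]) (rule borel_measurable_integrable[OF int])
  have bd: "norm (u j t) \<le> indicator {a<..} t *\<^sub>R (?w t * M)" for j t
    using M(2)[OF X(2)[of j], of t] by (auto simp: u_def indicator_def abs_mult)
  have "integrable lborel v"
    by (rule integrable_dominated_convergence[where s = u, OF meas _ w])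
       (use borel_measurable_integrable[OF int] lim bd in auto)
  then show "set_integrable lborel {a<..} (\<lambda>t. ?w t * p t q)"
    by (simp add: v_def[abs_def] set_integrable_def)
  have "(\<lambda>j. integral\<^sup>L lborel (u j)) \<longlonglongrightarrow> integral\<^sup>L lborel v"
    by (rule integral_dominated_convergence[where s = u, OF meas _ w])
       (use borel_measurable_integrable[OF int] lim bd in auto)
  moreover have "integral\<^sup>L lborel (u j) = ?w a * P a (gkern (X j) q) north_pole" for j
    using resolvent_pkern(2)[OF q X(2) north_pole_sphere less_imp_le[OF a], of j]
    by (simp add: u_def[abs_def] set_lebesgue_integral_def)
  ultimately show "(\<lambda>j. ?w a * P a (gkern (X j) q) north_pole) \<longlonglongrightarrow> (LBINT t:{a<..}. ?w t * p t q)"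
    by (simp add: v_def[abs_def] set_lebesgue_integral_def)
qed

text \<open>By \<open>resolvent_pkern\<close> both sides are integrals of the same nonnegative
  function, over times beyond \<open>a\<close> and over all positive times.\<close>

lemma green_decreasing:
  assumes q: "q \<in> sphere 0 1" and s: "1 < s" and a: "0 \<le> a"
  shows "exp (- (conf_const CARD('n) * a)) * P a (gkern s q) north_pole \<le> gkern s q north_pole"
proof -
  have cp: "C (pkern s q)" by (rule continuous_on_pkern[OF q s])
  note r = resolvent_pkern[OF q s north_pole_sphere]
  have "(LBINT t:{a<..}. exp (- (conf_const CARD('n) * t)) * P t (pkern s q) north_pole)
      \<le> (LBINT t:{0<..}. exp (- (conf_const CARD('n) * t)) * P t (pkern s q) north_pole)"
    unfolding set_lebesgue_integral_def
  proof (rule integral_mono)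
    show "integrable lborel (\<lambda>t. indicator {a<..} t *\<^sub>R (exp (- (conf_const CARD('n) * t)) * P t (pkern s q) north_pole))"
      "integrable lborel (\<lambda>t. indicator {0<..} t *\<^sub>R (exp (- (conf_const CARD('n) * t)) * P t (pkern s q) north_pole))"
      using r(1)[OF a] r(1)[OF order_refl] by (simp_all add: set_integrable_def)
    fix t :: real
    have "0 \<le> P t (pkern s q) north_pole" if "0 < t"
      by (rule nonneg[OF cp _ north_pole_sphere pkern_nonneg[OF _ q s]]) (use that in auto)
    then show "indicator {a<..} t *\<^sub>R (exp (- (conf_const CARD('n) * t)) * P t (pkern s q) north_pole)
        \<le> indicator {0<..} t *\<^sub>R (exp (- (conf_const CARD('n) * t)) * P t (pkern s q) north_pole)"
      using a by (auto simp: indicator_def)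
  qed
  then show ?thesis
    unfolding r(2)[OF a] r(2)[OF order_refl] by (simp add: at_0[OF continuous_on_gkern[OF q s] north_pole_sphere])
qed

text \<open>\<open>green_decreasing\<close> bounds the integral beyond \<open>a\<close> by G. From
  below it dominates each regularised value at time \<open>a\<close>, since these increase along
  \<open>X\<close> to it. For a fixed index, a \<rightarrow> 0 leaves the regularised Green function
  at the north pole, and only then does the index tend to infinity.\<close>

lemma green_function:
  assumes q: "q \<in> sphere 0 1" and nz: "sdist 1 q north_pole \<noteq> 0"
  shows "set_integrable lborel {0<..} (\<lambda>t. exp (- (conf_const CARD('n) * t)) * p t q)"
    and "(LBINT t:{0<..}. exp (- (conf_const CARD('n) * t)) * p t q) = green_limit q north_pole"
proof -
  let ?w = "\<lambda>t. exp (- (conf_const CARD('n) * t))"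
  define G where "G = green_limit q north_pole"
  define X where "X j = 1 + inverse (real (Suc j))" for j
  have X1: "1 < X j" for j by (simp add: X_def)
  have "X \<longlonglongrightarrow> 1 + 0" unfolding X_def by (intro tendsto_intros LIMSEQ_inverse_real_of_nat)
  then have X: "filterlim X (at_right 1) sequentially"
    by (auto simp: filterlim_at X_def)
  have gX: "(\<lambda>j. gkern (X j) q north_pole) \<longlonglongrightarrow> G"
    unfolding G_def by (rule filterlim_compose[OF tendsto_gkern[OF nz] X])
  define U where "U a = (LBINT t:{a<..}. ?w t * p t q)" for a
  have UI: "set_integrable lborel {a<..} (\<lambda>t. ?w t * p t q)" if "0 < a" for a
    by (rule set_integral_kernel_Ioi(1)[OF q that X X1])
  have Ulim: "(\<lambda>j. ?w a * P a (gkern (X j) q) north_pole) \<longlonglongrightarrow> U a" if "0 < a" for a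
    unfolding U_def by (rule set_integral_kernel_Ioi(2)[OF q that X X1])
  have upper: "U a \<le> G" if a: "0 < a" for a
    using Ulim[OF a] gX by (rule LIMSEQ_le) (use green_decreasing[OF q X1 less_imp_le[OF a]] in auto)
  have lower: "?w a * P a (gkern (X i) q) north_pole \<le> U a" if a: "0 < a" for a i
  proof (rule LIMSEQ_le_const[OF Ulim[OF a]], intro exI allI impI)
    fix j assume j: "i \<le> j"
    then have XX: "X j \<le> X i" by (simp add: X_def frac_le inverse_eq_divide)
    have cg: "C (gkern (X k) q)" for k by (rule continuous_on_gkern[OF q X1])
    have "0 \<le> P a (\<lambda>x. gkern (X j) q x - gkern (X i) q x) north_pole"
      by (rule nonneg[OF continuous_on_diff[OF cg cg] less_imp_le[OF a] north_pole_sphere])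
         (use gkern_antimono[OF _ q X1 XX] in simp)
    then show "?w a * P a (gkern (X i) q) north_pole \<le> ?w a * P a (gkern (X j) q) north_pole"
      by (simp add: diff[OF cg cg less_imp_le[OF a] north_pole_sphere])
  qed
  define a where "a j = inverse (real (Suc j))" for j
  have a0: "0 < a j" for j by (simp add: a_def)
  have alim: "filterlim a (at_right 0) sequentially"
    unfolding filterlim_at using a0 LIMSEQ_inverse_real_of_nat
    by (auto simp: a_def[abs_def])
  have Ua: "(\<lambda>j. U (a j)) \<longlonglongrightarrow> G"
  proof (rule order_tendstoI)
    fix c assume "c < G"
    then have "\<forall>\<^sub>F i in sequentially. c < gkern (X i) q north_pole"
      using order_tendstoD(1)[OF gX] by blast
    then obtain i where i: "c < gkern (X i) q north_pole"
      using eventually_happens'[OF sequentially_bot] by blast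
    have cg: "C (gkern (X i) q)" by (rule continuous_on_gkern[OF q X1])
    have "continuous_on {0..} (\<lambda>t. ?w t * P t (gkern (X i) q) north_pole)"
      by (intro continuous_intros continuous_time[OF cg north_pole_sphere])
    from tendsto_at_right_nonneg[OF this order_refl]
    have "((\<lambda>t. ?w t * P t (gkern (X i) q) north_pole) \<longlongrightarrow> gkern (X i) q north_pole) (at_right 0)"
      by (simp add: at_0[OF cg north_pole_sphere])
    from order_tendstoD(1)[OF filterlim_compose[OF this alim] i]
    show "\<forall>\<^sub>F j in sequentially. c < U (a j)"
      by eventually_elim (rule less_le_trans[OF _ lower[OF a0]])
  next
    fix c assume "G < c"
    then show "\<forall>\<^sub>F j in sequentially. U (a j) < c"
      using upper[OF a0] by (intro always_eventually allI) (rule le_less_trans)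
  qed
  \<comment> \<open>Positivity makes the truncated integrands increase with \<open>j\<close>, so
    monotone convergence yields integrability as well as the value.\<close>
  have p0: "0 \<le> p t q" if t: "0 < t" for t
  proof (rule tendsto_lowerbound[OF tendsto_p[OF q t]])
    show "\<forall>\<^sub>F s in at_right 1. 0 \<le> P t (pkern s q) north_pole"
      using eventually_at_right_one(1)
    proof eventually_elim
      case (elim s)
      show ?case
        by (rule nonneg[OF continuous_on_pkern[OF q elim] less_imp_le[OF t] north_pole_sphere pkern_nonneg[OF _ q elim]])
    qed
  qed simp
  define v where "v j t = indicator {a j<..} t *\<^sub>R (?w t * p t q)" for j t
  define v0 where "v0 t = indicator {0<..} t *\<^sub>R (?w t * p t q)" for t
  have vi: "integrable lborel (v j)" for j
    using UI[OF a0, of j] by (simp add: v_def[abs_def] set_integrable_def)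
  have amono: "a k \<le> a j" if "j \<le> k" for j k
    using that by (simp add: a_def frac_le inverse_eq_divide)
  have vm: "mono (\<lambda>j. v j t)" for t
  proof (rule monoI)
    fix j k :: nat assume "j \<le> k"
    then have "a k \<le> a j" by (rule amono)
    then show "v j t \<le> v k t"
      using p0[of t] a0[of k] unfolding v_def by (auto simp: indicator_def)
  qed
  have vl: "(\<lambda>j. v j t) \<longlonglongrightarrow> v0 t" for t
  proof (cases "0 < t")
    case True
    have "a \<longlonglongrightarrow> 0" using alim by (simp add: filterlim_at)
    then have "\<forall>\<^sub>F j in sequentially. a j < t" using True by (rule order_tendstoD(2))
    then have "\<forall>\<^sub>F j in sequentially. v j t = v0 t"
      by eventually_elim (use True in \<open>simp add: v_def v0_def\<close>)
    then show ?thesis by (rule tendsto_eventually)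
  next
    case False
    then have "v j t = v0 t" for j using a0[of j] by (auto simp: v_def v0_def indicator_def)
    then show ?thesis by simp
  qed
  have v0m: "v0 \<in> borel_measurable lborel"
    by (rule borel_measurable_LIMSEQ_metric[OF borel_measurable_integrable[OF vi] vl])
  have vU: "(\<lambda>j. integral\<^sup>L lborel (v j)) \<longlonglongrightarrow> G"
    using Ua by (simp add: U_def v_def[abs_def] set_lebesgue_integral_def)
  have "integrable lborel v0"
    by (rule integrable_monotone_convergence[OF vi AE_I2[OF vm] AE_I2[OF vl] vU v0m])
  then show "set_integrable lborel {0<..} (\<lambda>t. ?w t * p t q)"
    by (simp add: v0_def[abs_def] set_integrable_def)
  have "integral\<^sup>L lborel v0 = G"
    by (rule integral_monotone_convergence[OF vi AE_I2[OF vm] AE_I2[OF vl] vU v0m])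
  then show "(LBINT t:{0<..}. ?w t * p t q) = green_limit q north_pole"
    by (simp add: v0_def[abs_def] set_lebesgue_integral_def G_def)
qed

end

lemma green_constant:
  assumes "0 < n"
  shows "1 / (conf_const n * kern_mass n) = Gamma (real n) * Gamma (real n + 1) / (8 * pi ^ (2 * n + 2))"
proof -
  obtain k where k: "n = Suc k" using assms by (cases n) auto
  have "Gamma (real n) = fact k" "Gamma (real n + 1) = fact n"
    using Gamma_fact[of k, where 'a = real] Gamma_fact[of n, where 'a = real] by (simp_all add: k add.commute)
  then show ?thesis
    by (simp add: conf_const_def kern_mass_def k divide_simps)
qed

theorem theorem2p9:
  fixes p :: "real \<Rightarrow> 'n::finite qspace \<Rightarrow> real"
    and q :: "'n qspace" and n :: nat and r \<eta> :: real
  assumes "n = CARD('n)"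
    and "heat_kernel p"
    and "0 \<le> r" "r < pi / 2" "0 \<le> \<eta>" "\<eta> \<le> pi" "(r, \<eta>) \<noteq> (0, 0)"
    and "q \<in> sphere 0 1" "norm (snd q) = cos r" "qRe (snd q) = cos r * cos \<eta>"
  shows "set_integrable lborel {0<..} (\<lambda>t. exp (- (4 * real n * (real n + 1) * t)) * p t q) \<and>
         (LBINT t:{0<..}. exp (- (4 * real n * (real n + 1) * t)) * p t q) =
           Gamma (real n) * Gamma (real n + 1) /
             (8 * pi ^ (2 * n + 2) * (1 - 2 * cos r * cos \<eta> + (cos r)\<^sup>2) ^ (n + 1))"
proof -
  obtain P where P: "heat_semigroup P"
    and p: "\<forall>t>0. continuous_on (sphere 0 1) (p t) \<and>
        (\<forall>f. continuous_on (sphere 0 1) f \<longrightarrow> P t f north_pole = (LINT x:sphere 0 1|sphere_volume. p t x * f x))"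
    using \<open>heat_kernel p\<close> unfolding heat_kernel_def by (elim exE conjE)
  interpret heat_flow_kernel P p
    by unfold_locales (use P p in \<open>simp_all add: set_integral_sphere_volume\<close>)
  define D where "D = 1 - 2 * cos r * cos \<eta> + (cos r)\<^sup>2"
  have D: "sdist 1 q north_pole = D"
    using assms(9,10) by (simp add: sdist_north_pole D_def)
  have "0 < D"
  proof -
    have c: "0 < cos r" using assms(3,4) by (intro cos_gt_zero_pi) auto
    \<comment> \<open>Two nonnegative summands: the first is positive unless r = 0, and the second
      is positive if r = 0 and \<eta> > 0.\<close>
    have eq: "D = (1 - cos r)\<^sup>2 + 2 * cos r * (1 - cos \<eta>)"
      by (simp add: D_def power2_eq_square algebra_simps)
    show ?thesis
    proof (cases "r = 0")
      case True
      then have "0 < \<eta>" using assms(5,7) by auto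
      then have "cos \<eta> < cos 0" using assms(6) by (intro cos_monotone_0_pi) auto
      then show ?thesis using True by (simp add: eq)
    next
      case False
      then have "cos r < cos 0" using assms(3,4) by (intro cos_monotone_0_pi) auto
      then have "0 < (1 - cos r)\<^sup>2" by simp
      moreover have "0 \<le> 2 * cos r * (1 - cos \<eta>)" using c by simp
      ultimately show ?thesis unfolding eq by linarith
    qed
  qed
  then have nz: "sdist 1 q north_pole \<noteq> 0" by (simp add: D)
  have n0: "0 < n" using assms(1) by simp
  have val: "green_limit q north_pole = Gamma (real n) * Gamma (real n + 1) / (8 * pi ^ (2 * n + 2) * D ^ (n + 1))"
  proof -
    have "green_limit q north_pole = inverse D ^ (n + 1) * (1 / (conf_const n * kern_mass n))"
      unfolding green_limit_def D assms(1) by (rule divide_inverse[THEN trans]) (simp only: inverse_eq_divide)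
    then show ?thesis
      unfolding green_constant[OF n0] by (simp only: divide_inverse inverse_mult_distrib power_inverse mult_ac)
  qed
  show ?thesis
    using green_function[OF assms(8) nz] val by (simp only: assms(1) conf_const_def D_def)
qed

end
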